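(* Let $g \colon \mathbb{R}^{+} \to \mathbb{R}^{+}$ be a continuous function such that $g(0)=0$, $g(s)>0$ for all $s>0$, $\lim_{s\to0^{+}} g(s)/s = 0$ and $\lim_{s\to+\infty} g(s)/s = 0$. Let $T>0$ and let $a \colon \mathbb{R} \to \mathbb{R}$ be a $T$-periodic locally integrable function for which there exist $2m+1$ points (with $m\geq 1$) $\sigma_{1}<\tau_{1}<\ldots<\sigma_{i}<\tau_{i}<\ldots<\sigma_{m}<\tau_{m}<\sigma_{m+1}$, with $\sigma_{m+1}-\sigma_{1}=T$, such that, for $i=1,\ldots,m$, $a\succ0$ on $I^{+}_{i}:=[\sigma_{i},\tau_{i}]$ and $a\prec0$ on $I^{-}_{i}:=[\tau_{i},\sigma_{i+1}]$. Then there exists $\lambda^{*}>0$ such that for each $\lambda>\lambda^{*}$ there exists $\mu^{*}(\lambda)>0$ such that for each $\mu>\mu^{*}(\lambda)$ the equation $$u''+\bigl(\lambda a^{+}(t)-\mu a^{-}(t)\bigr)g(u)=0$$ has at least $3^{m}-1$ positive $T$-periodic solutions. More precisely, for every constant $\rho>0$ there exists $\lambda^{*}=\lambda^{*}(\rho)>0$ such that for each $\lambda>\lambda^{*}$ there exist two constants $r,R$ with $0<r<\rho<R$ and $\mu^{*}(\lambda)=\mu^{*}(\lambda,r,R)>0$ such that for any $\mu>\mu^{*}(\lambda)$ and any finite string $\mathcal{S}=(\mathcal{S}_{1},\ldots,\mathcal{S}_{m})\in\{0,1,2\}^{m}$ with $\mathcal{S}\neq(0,\ldots,0)$, there exists a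 positive $T$-periodic solution $u(t)$ of the equation such that, for each $i=1,\ldots,m$: \begin{itemize} \item $\max_{t\in I^{+}_{i}}u(t)<r$, if $\mathcal{S}_{i}=0$; \item $r<\max_{t\in I^{+}_{i}}u(t)<\rho$, if $\mathcal{S}_{i}=1$; \item $\rho<\max_{t\in I^{+}_{i}}u(t)<R$, if $\mathcal{S}_{i}=2$. \end{itemize}
   Context: $\mathbb{R}^{+}:=[0,+\infty)$; $a^{+}=\max\{a,0\}$ and $a^{-}=\max\{-a,0\}$. On a given interval, $w\succ0$ means that $w(t)\geq0$ for almost every $t$ and $w$ is not almost everywhere zero on that interval; $w\prec0$ means $-w\succ0$. Solutions are meant in the Carathéodory sense ($u$ is $C^{1}$ with $u'$ locally absolutely continuous and the equation holds almost everywhere). A positive $T$-periodic solution is a solution defined on $\mathbb{R}$ with $u(t)=u(t+T)>0$ for all $t\in\mathbb{R}$. *)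

theory Defs
  imports "HOL-Analysis.Analysis"
begin

definition positive_part :: "(real \<Rightarrow> real) \<Rightarrow> real \<Rightarrow> real"
  where "positive_part a t = max (a t) 0"

definition negative_part :: "(real \<Rightarrow> real) \<Rightarrow> real \<Rightarrow> real"
  where "negative_part a t = max (- a t) 0"

definition locally_integrable :: "(real \<Rightarrow> real) \<Rightarrow> bool"
  where "locally_integrable f \<longleftrightarrow> (\<forall>x y. f absolutely_integrable_on {x..y})"

text \<open>The relation \<open>w \<succ> 0\<close> on \<open>I\<close>; the relation \<open>w \<prec> 0\<close> on \<open>I\<close> is \<open>ae_pos_on (\<lambda>t. - w t) I\<close>.\<close>

definition ae_pos_on :: "(real \<Rightarrow> real) \<Rightarrow> real set \<Rightarrow> bool"
  where "ae_pos_on w I \<longleftrightarrow>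
    (AE t in lebesgue. t \<in> I \<longrightarrow> w t \<ge> 0) \<and> \<not> (AE t in lebesgue. t \<in> I \<longrightarrow> w t = 0)"

definition absolutely_continuous_on_Icc :: "real \<Rightarrow> real \<Rightarrow> (real \<Rightarrow> real) \<Rightarrow> bool"
  where "absolutely_continuous_on_Icc x y f \<longleftrightarrow>
    (\<forall>\<epsilon>>0. \<exists>\<delta>>0. \<forall>(n::nat) p q.
      (\<forall>k<n. x \<le> p k \<and> p k \<le> q k \<and> q k \<le> y) \<longrightarrow>
      disjoint_family_on (\<lambda>k. {p k<..<q k}) {..<n} \<longrightarrow>
      (\<Sum>k<n. q k - p k) < \<delta> \<longrightarrow>
      (\<Sum>k<n. \<bar>f (q k) - f (p k)\<bar>) < \<epsilon>)"

definition locally_absolutely_continuous :: "(real \<Rightarrow> real) \<Rightarrow> bool"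
  where "locally_absolutely_continuous f \<longleftrightarrow> (\<forall>x y. absolutely_continuous_on_Icc x y f)"

text \<open>Caratheodory solutions, defined on the whole line, of \<open>u'' + q(t) g(u) = 0\<close>. The value of
  \<open>deriv (deriv u)\<close> at a point is meaningful only together with differentiability of \<open>deriv u\<close>
  there.\<close>

definition caratheodory_solution ::
    "(real \<Rightarrow> real) \<Rightarrow> (real \<Rightarrow> real) \<Rightarrow> (real \<Rightarrow> real) \<Rightarrow> bool"
  where "caratheodory_solution q g u \<longleftrightarrow>
    u C1_differentiable_on UNIV \<and>
    locally_absolutely_continuous (deriv u) \<and>
    (AE t in lebesgue. deriv u differentiable (at t) \<and> deriv (deriv u) t + q t * g (u t) = 0)"

definition positive_periodic_solution ::
    "real \<Rightarrow> (real \<Rightarrow> real) \<Rightarrow> (real \<Rightarrow> real) \<Rightarrow> (real \<Rightarrow> real) \<Rightarrow> bool"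
  where "positive_periodic_solution T q g u \<longleftrightarrow>
    caratheodory_solution q g u \<and> (\<forall>t. u t = u (t + T) \<and> u t > 0)"

definition weight :: "(real \<Rightarrow> real) \<Rightarrow> real \<Rightarrow> real \<Rightarrow> real \<Rightarrow> real"
  where "weight a l \<mu> t = l * positive_part a t - \<mu> * negative_part a t"

text \<open>Below, \<open>u\<close> is continuous and \<open>I i\<close> is a nonempty compact interval, so that the supremum is the
  maximum of \<open>u\<close> on \<open>I i\<close>. (\<^const>\<open>Max\<close> is specified for finite sets only.)\<close>

definition follows_string ::
    "nat \<Rightarrow> (nat \<Rightarrow> real set) \<Rightarrow> real \<Rightarrow> real \<Rightarrow> real \<Rightarrow> (nat \<Rightarrow> nat) \<Rightarrow> (real \<Rightarrow> real) \<Rightarrow> bool"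
  where "follows_string m I r \<rho> R S u \<longleftrightarrow>
    (\<forall>i\<in>{1..m}.
      (S i = 0 \<longrightarrow> (SUP t\<in>I i. u t) < r) \<and>
      (S i = 1 \<longrightarrow> r < (SUP t\<in>I i. u t) \<and> (SUP t\<in>I i. u t) < \<rho>) \<and>
      (S i = 2 \<longrightarrow> \<rho> < (SUP t\<in>I i. u t) \<and> (SUP t\<in>I i. u t) < R))"

end

theory Submission
  imports Defs "HOL-Complex_Analysis.Great_Picard"
begin

text \<open>In every lobe \<open>[\<sigma>\<^sub>i, \<tau>\<^sub>i]\<close> pick a point \<open>t\<^sub>i\<close> that splits the mass of the weight, and look
  for broken periodic solutions: \<open>u\<close> solves the equation between consecutive \<open>t\<^sub>i\<close>, \<open>u(t\<^sub>i) = s\<^sub>i\<close>, and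
  \<open>u'\<close> may jump by \<open>D\<^sub>i\<close> at \<open>t\<^sub>i\<close>. Each \<open>s\<^sub>i\<close> is confined to \<open>[0, r\<^sub>0]\<close>, \<open>[r\<^sub>1, \<rho>\<^sub>1]\<close> or \<open>[\<rho>\<^sub>2, R]\<close> according to
  the symbol 0, 1 or 2, and Schauder's theorem, applied to \<open>u\<close> and \<open>s\<close> simultaneously with \<open>s\<^sub>i\<close> pushed by
  \<open>\<plusminus> D\<^sub>i\<close> and clamped to its interval, gives a broken solution in which \<open>D\<^sub>i = 0\<close> unless \<open>s\<^sub>i\<close> sits at the end
  of its interval towards which \<open>D\<^sub>i\<close> pushes. Choosing the signs suitably, these kinks are impossible:
  if \<open>s\<^sub>i \<in> {r\<^sub>0, r\<^sub>1, R}\<close>, the nonlinearity is so small compared with \<open>s\<^sub>i\<close> in the lobe that \<open>D\<^sub>i \<ge> 0\<close> would let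
  \<open>u\<close> enter a neighbouring gap almost horizontally, where convexity throws it above \<open>R\<close> for large \<open>\<mu>\<close>; if
  \<open>s\<^sub>i \<in> {\<rho>\<^sub>1, \<rho>\<^sub>2}\<close>, then \<open>D\<^sub>i \<le> 0\<close> would make \<open>u\<close> concave on half of the lobe and negative at its end for large
  \<open>\<lambda>\<close>; and at \<open>s\<^sub>i = 0\<close> nonnegativity forces \<open>D\<^sub>i \<ge> 0\<close>.

  To keep broken solutions under control, the nonlinearity in the lobe is truncated at level \<open>C s\<^sub>i\<close>. A
  nonnegative function without kink is concave on the lobe, hence at most \<open>C s\<^sub>i\<close> there, and the truncation
  is not felt.\<close>

section \<open>Fixed points\<close>

text \<open>Since \<open>g\<close> is only continuous, nodal values need not determine a broken
  solution, so there is no evident continuous map from \<open>s\<close> to the kinks to which a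
  Poincare-Miranda argument on \<open>s\<close> alone could be applied. This is why function and
  nodal values are sought in one fixed point; the sign of the kink at the ends of each interval then
  plays the part of Miranda's boundary condition.

  The truncation breaks a circularity: before kinks are excluded, \<open>u\<close> may grow on a
  lobe out of proportion to \<open>s i\<close>, and smallness of \<open>g\<close> near the level
  \<open>s i\<close> would say nothing about it. The constant \<open>C\<close> only compares the
  lengths of the two parts of the lobes, so it is available before \<open>\<rho>1\<close>, which
  must satisfy \<open>C * \<rho>1 < \<rho>\<close>, and before \<lambda>.

  All strings are realised, the zero string possibly by u = 0. A nonzero symbol gives a positive
  nodal value, and since \<open>g s / s\<close> is bounded near 0, a zero of \<open>u\<close> would
  propagate until it hits a translate of that node.\<close>

definition box_upto :: "nat \<Rightarrow> (nat \<Rightarrow> real) \<Rightarrow> (nat \<Rightarrow> real) \<Rightarrow> (nat \<Rightarrow> real) set"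
  where "box_upto n lo hi = {z. \<forall>i<n. lo i \<le> z i \<and> z i \<le> hi i}"

lemma abs_le_divideI:
  fixes d :: real
  assumes "d = h * c" "0 \<le> h" "0 \<le> c" "c \<le> 1 / K"
  shows "\<bar>d\<bar> \<le> h / K"
  using assms mult_left_mono[of c "1 / K" h] mult_nonneg_nonneg[of h c] by simp

text \<open>Kuhn's labelling argument: a vertex gets label 0 in direction \<open>i\<close> when
  \<open>F\<close> does not decrease its \<open>i\<close>-th coordinate. A cell that shows both
  labels in every direction yields, for each \<open>i\<close>, nearby points \<open>r\<close>,
  \<open>s\<close> with \<open>r i \<le> F r i\<close> and \<open>F s i \<le> s i\<close>; the mesh
  then tends to 0. The dimension is a number rather than a type because the discretisation in
  \<open>schauder_lipschitz\<close> lets it grow.\<close>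

lemma brouwer_box_upto:
  fixes F :: "(nat \<Rightarrow> real) \<Rightarrow> nat \<Rightarrow> real"
  assumes le: "\<And>i. i < n \<Longrightarrow> lo i \<le> hi i"
    and maps: "\<And>z. z \<in> box_upto n lo hi \<Longrightarrow> F z \<in> box_upto n lo hi"
    and cont: "\<And>X z i. \<lbrakk>\<And>k. X k \<in> box_upto n lo hi; z \<in> box_upto n lo hi;
        \<And>j. j < n \<Longrightarrow> (\<lambda>k. X k j) \<longlonglongrightarrow> z j; i < n\<rbrakk> \<Longrightarrow> (\<lambda>k. F (X k) i) \<longlonglongrightarrow> F z i"
  obtains z where "z \<in> box_upto n lo hi" "\<And>i. i < n \<Longrightarrow> F z i = z i"
proof -
  let ?B = "box_upto n lo hi"
  have approx: "\<exists>q\<in>?B. \<forall>i<n. \<exists>r\<in>?B. \<exists>s\<in>?B.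
      (\<forall>j<n. \<bar>r j - q j\<bar> \<le> (hi j - lo j) / Suc k \<and> \<bar>s j - q j\<bar> \<le> (hi j - lo j) / Suc k) \<and>
      r i \<le> F r i \<and> F s i \<le> s i" for k
  proof -
    define pt :: "(nat \<Rightarrow> nat) \<Rightarrow> nat \<Rightarrow> real"
      where "pt x i = lo i + (hi i - lo i) * (real (x i) / real (Suc k))" for x i
    \<comment> \<open>Kuhn's lemma wants label 1 on the upper face even where \<open>F\<close> keeps
      the coordinate. As \<open>F\<close> maps into the box, \<open>F\<close> does not increase the
      coordinate there, so a nonzero label still has the intended meaning.\<close>
    define label :: "(nat \<Rightarrow> nat) \<Rightarrow> nat \<Rightarrow> nat"
      where "label x i = (if x i \<noteq> Suc k \<and> pt x i \<le> F (pt x) i then 0 else 1)" for x i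
    have pt_in: "pt x \<in> ?B" if x: "\<forall>i<n. x i \<le> Suc k" for x
    proof -
      have "0 \<le> (hi i - lo i) * (real (x i) / real (Suc k))"
        "(hi i - lo i) * (real (x i) / real (Suc k)) \<le> hi i - lo i" if "i < n" for i
      proof -
        have "0 \<le> real (x i) / real (Suc k)" "real (x i) / real (Suc k) \<le> 1"
          using x that by auto
        then show "0 \<le> (hi i - lo i) * (real (x i) / real (Suc k))"
          "(hi i - lo i) * (real (x i) / real (Suc k)) \<le> hi i - lo i"
          using le[OF that] mult_nonneg_nonneg[of "hi i - lo i"] mult_left_le[of _ "hi i - lo i"]
          by (simp_all del: of_nat_Suc times_divide_eq_right)
      qed
      then show ?thesis
        by (force simp: box_upto_def pt_def)
    qed
    have pt_diff: "\<bar>pt y j - pt x j\<bar> \<le> (hi j - lo j) / Suc k"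
      if "x j \<le> y j" "y j \<le> x j + 1" "j < n" for x y j
    proof -
      have "pt y j - pt x j = (hi j - lo j) * ((real (y j) - real (x j)) / Suc k)"
        unfolding pt_def by (metis add_diff_cancel_left diff_divide_distrib right_diff_distrib)
      moreover have "0 \<le> (real (y j) - real (x j)) / Suc k" "(real (y j) - real (x j)) / Suc k \<le> 1 / Suc k"
        using that by (auto intro!: divide_right_mono)
      ultimately show ?thesis
        using le[OF that(3)] by (intro abs_le_divideI) auto
    qed
    have lab1: "\<forall>x. (\<forall>i<n. x i \<le> Suc k) \<longrightarrow> (\<forall>i<n. label x i = 0 \<or> label x i = 1)"
      by (simp add: label_def)
    have lab2: "\<forall>x. (\<forall>i<n. x i \<le> Suc k) \<longrightarrow> (\<forall>i<n. x i = 0 \<longrightarrow> label x i = 0)"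
    proof (intro allI impI)
      fix x :: "nat \<Rightarrow> nat" and i assume x: "\<forall>i<n. x i \<le> Suc k" and i: "i < n" "x i = 0"
      then show "label x i = 0"
        using maps[OF pt_in[OF x]] by (simp add: label_def box_upto_def) (simp add: pt_def)
    qed
    have lab3: "\<forall>x. (\<forall>i<n. x i \<le> Suc k) \<longrightarrow> (\<forall>i<n. x i = Suc k \<longrightarrow> label x i = 1)"
      by (simp add: label_def)
    obtain q where q: "\<forall>i<n. q i < Suc k"
      and rs: "\<forall>i<n. \<exists>r s. (\<forall>j<n. q j \<le> r j \<and> r j \<le> q j + 1) \<and>
          (\<forall>j<n. q j \<le> s j \<and> s j \<le> q j + 1) \<and> label r i \<noteq> label s i"
      by (rule kuhn_lemma[OF _ lab1 lab2 lab3]) auto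
    have F_le: "F (pt x) i \<le> pt x i" if "label x i \<noteq> 0" "\<forall>i<n. x i \<le> Suc k" "i < n" for x i
      using that maps[OF pt_in[OF that(2)]]
      by (auto simp: label_def box_upto_def pt_def split: if_splits)
    have F_ge: "pt x i \<le> F (pt x) i" if "label x i = 0" for x i
      using that by (auto simp: label_def split: if_splits)
    show ?thesis
    proof (rule bexI[of _ "pt q"], intro allI impI)
      show "pt q \<in> ?B" using q by (intro pt_in) auto
    next
      fix i assume "i < n"
      then obtain r s where r: "\<forall>j<n. q j \<le> r j \<and> r j \<le> q j + 1"
        and s: "\<forall>j<n. q j \<le> s j \<and> s j \<le> q j + 1" and ne: "label r i \<noteq> label s i"
        using rs by blast
      have le_Suc: "\<forall>j<n. r j \<le> Suc k" "\<forall>j<n. s j \<le> Suc k"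
        using r s q by (metis Suc_eq_plus1 Suc_leI le_trans)+
      have B: "pt r \<in> ?B" "pt s \<in> ?B" using pt_in le_Suc by auto
      have "\<bar>pt r j - pt q j\<bar> \<le> (hi j - lo j) / Suc k \<and> \<bar>pt s j - pt q j\<bar> \<le> (hi j - lo j) / Suc k"
        if "j < n" for j
        using pt_diff[of q j r] pt_diff[of q j s] r s that by auto
      moreover have "label r i = 0 \<and> label s i \<noteq> 0 \<or> label s i = 0 \<and> label r i \<noteq> 0"
        using ne by (auto simp: label_def split: if_splits)
      ultimately show "\<exists>r\<in>?B. \<exists>s\<in>?B.
          (\<forall>j<n. \<bar>r j - pt q j\<bar> \<le> (hi j - lo j) / Suc k \<and> \<bar>s j - pt q j\<bar> \<le> (hi j - lo j) / Suc k) \<and>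
          r i \<le> F r i \<and> F s i \<le> s i"
        using B F_le F_ge le_Suc \<open>i < n\<close> by blast
    qed
  qed
  obtain Q where Q: "\<And>k. Q k \<in> ?B" and QQ: "\<And>k. \<forall>i<n. \<exists>r\<in>?B. \<exists>s\<in>?B.
      (\<forall>j<n. \<bar>r j - Q k j\<bar> \<le> (hi j - lo j) / Suc k \<and> \<bar>s j - Q k j\<bar> \<le> (hi j - lo j) / Suc k) \<and>
      r i \<le> F r i \<and> F s i \<le> s i"
    using approx by metis
  obtain R S where RS: "\<And>k i. i < n \<Longrightarrow> R k i \<in> ?B \<and> S k i \<in> ?B \<and>
      (\<forall>j<n. \<bar>R k i j - Q k j\<bar> \<le> (hi j - lo j) / Suc k \<and> \<bar>S k i j - Q k j\<bar> \<le> (hi j - lo j) / Suc k) \<and>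
      R k i i \<le> F (R k i) i \<and> F (S k i) i \<le> S k i i"
    using QQ by metis
  define M where "M = (\<Sum>j<n. \<bar>lo j\<bar> + \<bar>hi j\<bar>)"
  have M: "norm (Q k j) \<le> M" if "j \<in> {..<n}" for k j
  proof -
    have "\<bar>Q k j\<bar> \<le> \<bar>lo j\<bar> + \<bar>hi j\<bar>" using Q[of k] that by (force simp: box_upto_def)
    also have "\<dots> \<le> M" unfolding M_def using that by (intro member_le_sum) auto
    finally show ?thesis by simp
  qed
  obtain \<kappa> :: "nat \<Rightarrow> nat" where \<kappa>: "strict_mono \<kappa>"
    and conv: "\<And>j. j \<in> {..<n} \<Longrightarrow> \<exists>l. (\<lambda>k. Q (\<kappa> k) j) \<longlonglongrightarrow> l"
    using function_convergent_subsequence[of "{..<n}" Q M, OF _ M] by blast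
  then obtain z where z: "\<And>j. j < n \<Longrightarrow> (\<lambda>k. Q (\<kappa> k) j) \<longlonglongrightarrow> z j"
    by (metis lessThan_iff)
  have zB: "z \<in> ?B"
    using Q by (auto simp: box_upto_def intro: LIMSEQ_le_const[OF z] LIMSEQ_le_const2[OF z])
  have close: "(\<lambda>k. Y k j) \<longlonglongrightarrow> z j"
    if "\<And>k. \<bar>Y k j - Q (\<kappa> k) j\<bar> \<le> (hi j - lo j) / Suc (\<kappa> k)" "j < n" for Y :: "nat \<Rightarrow> nat \<Rightarrow> real" and j
  proof -
    have "(\<lambda>k. (hi j - lo j) / Suc k) \<longlonglongrightarrow> 0"
      using tendsto_mult[OF tendsto_const[of "hi j - lo j"] LIMSEQ_inverse_real_of_nat]
      by (simp add: divide_inverse)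
    then have "(\<lambda>k. (hi j - lo j) / Suc (\<kappa> k)) \<longlonglongrightarrow> 0"
      using LIMSEQ_subseq_LIMSEQ[OF _ \<kappa>] by (fastforce simp: o_def)
    then have "(\<lambda>k. Y k j - Q (\<kappa> k) j) \<longlonglongrightarrow> 0"
      by (rule Lim_null_comparison[rotated]) (use that in auto)
    from tendsto_add[OF this z[OF that(2)]] show ?thesis by simp
  qed
  have "F z i = z i" if i: "i < n" for i
  proof (rule antisym)
    have R: "(\<lambda>k. R (\<kappa> k) i j) \<longlonglongrightarrow> z j" and S: "(\<lambda>k. S (\<kappa> k) i j) \<longlonglongrightarrow> z j" if "j < n" for j
      using RS[OF i] that by (auto intro: close)
    have FR: "(\<lambda>k. F (R (\<kappa> k) i) i) \<longlonglongrightarrow> F z i" and FS: "(\<lambda>k. F (S (\<kappa> k) i) i) \<longlonglongrightarrow> F z i"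
      using RS[OF i] zB R S i by (auto intro: cont)
    show "z i \<le> F z i" using RS[OF i] by (intro LIMSEQ_le[OF R[OF i] FR]) auto
    show "F z i \<le> z i" using RS[OF i] by (intro LIMSEQ_le[OF FS S[OF i]]) auto
  qed
  with zB show ?thesis using that by blast
qed

text \<open>Continuity is required only under pointwise convergence, so that step functions through finitely
  many nodal values can serve as approximations of the unknown function.\<close>

lemma schauder_lipschitz:
  fixes W :: "(real \<Rightarrow> real) \<Rightarrow> (nat \<Rightarrow> real) \<Rightarrow> real \<Rightarrow> real"
    and Z :: "(real \<Rightarrow> real) \<Rightarrow> (nat \<Rightarrow> real) \<Rightarrow> nat \<Rightarrow> real"
  assumes "\<alpha> < \<beta>"
    and le: "\<And>i. i < m \<Longrightarrow> lo i \<le> hi i"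
    and bdd: "\<And>v s t. \<lbrakk>v \<in> borel_measurable borel; s \<in> box_upto m lo hi; t \<in> {\<alpha>..\<beta>}\<rbrakk> \<Longrightarrow> \<bar>W v s t\<bar> \<le> M"
    and lip: "\<And>v s t t'. \<lbrakk>v \<in> borel_measurable borel; s \<in> box_upto m lo hi; t \<in> {\<alpha>..\<beta>}; t' \<in> {\<alpha>..\<beta>}\<rbrakk>
        \<Longrightarrow> \<bar>W v s t - W v s t'\<bar> \<le> L * \<bar>t - t'\<bar>"
    and Z: "\<And>v s. \<lbrakk>v \<in> borel_measurable borel; s \<in> box_upto m lo hi\<rbrakk> \<Longrightarrow> Z v s \<in> box_upto m lo hi"
    and contW: "\<And>V v X s t. \<lbrakk>\<And>k. V k \<in> borel_measurable borel; v \<in> borel_measurable borel;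
        \<And>t. t \<in> {\<alpha>..\<beta>} \<Longrightarrow> (\<lambda>k. V k t) \<longlonglongrightarrow> v t; \<And>k. X k \<in> box_upto m lo hi; s \<in> box_upto m lo hi;
        \<And>i. i < m \<Longrightarrow> (\<lambda>k. X k i) \<longlonglongrightarrow> s i; t \<in> {\<alpha>..\<beta>}\<rbrakk> \<Longrightarrow> (\<lambda>k. W (V k) (X k) t) \<longlonglongrightarrow> W v s t"
    and contZ: "\<And>V v X s i. \<lbrakk>\<And>k. V k \<in> borel_measurable borel; v \<in> borel_measurable borel;
        \<And>t. t \<in> {\<alpha>..\<beta>} \<Longrightarrow> (\<lambda>k. V k t) \<longlonglongrightarrow> v t; \<And>k. X k \<in> box_upto m lo hi; s \<in> box_upto m lo hi;
        \<And>i. i < m \<Longrightarrow> (\<lambda>k. X k i) \<longlonglongrightarrow> s i; i < m\<rbrakk> \<Longrightarrow> (\<lambda>k. Z (V k) (X k) i) \<longlonglongrightarrow> Z v s i"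
  obtains u s where "u \<in> borel_measurable borel" "s \<in> box_upto m lo hi"
    "\<And>t. t \<in> {\<alpha>..\<beta>} \<Longrightarrow> W u s t = u t" "\<And>i. i < m \<Longrightarrow> Z u s i = s i"
proof -
  let ?B = "box_upto m lo hi"
  \<comment> \<open>Approximate fixed points: Brouwer is applied to the \<open>N + 2\<close> values
    of \<open>W\<close> at the grid points, followed by the \<open>m\<close> parameters, which
    therefore start at index \<open>Suc (Suc N)\<close>.\<close>
  have "\<exists>v\<in>borel_measurable borel. \<exists>s\<in>?B. (\<forall>t\<in>{\<alpha>..\<beta>}. \<bar>v t - W v s t\<bar> \<le> L * ((\<beta> - \<alpha>) / Suc N)) \<and>
      (\<forall>i<m. Z v s i = s i)" for N
  proof -
    \<comment> \<open>Rounds down to the grid. Outside the interval \<open>nat\<close> and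
      \<open>min\<close> keep the index in range, so \<open>st z\<close> is a Borel step function on
      the whole line.\<close>
    define ix :: "real \<Rightarrow> nat" where "ix t = min (nat \<lfloor>Suc N * ((t - \<alpha>) / (\<beta> - \<alpha>))\<rfloor>) (Suc N)" for t
    define y :: "nat \<Rightarrow> real" where "y k = \<alpha> + (\<beta> - \<alpha>) * (k / Suc N)" for k
    define st :: "(nat \<Rightarrow> real) \<Rightarrow> real \<Rightarrow> real" where "st z t = z (ix t)" for z t
    define sh :: "(nat \<Rightarrow> real) \<Rightarrow> nat \<Rightarrow> real" where "sh z i = z (i + Suc (Suc N))" for z i
    define lo' where "lo' k = (if k \<le> Suc N then - M else lo (k - Suc (Suc N)))" for k
    define hi' where "hi' k = (if k \<le> Suc N then M else hi (k - Suc (Suc N)))" for k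
    define F where "F z k = (if k \<le> Suc N then W (st z) (sh z) (y k) else Z (st z) (sh z) (k - Suc (Suc N)))"
      for z k
    let ?n = "m + Suc (Suc N)"
    let ?B' = "box_upto ?n lo' hi'"
    have y_in: "y k \<in> {\<alpha>..\<beta>}" if "k \<le> Suc N" for k
    proof -
      have "0 \<le> real k / Suc N" "real k / Suc N \<le> 1" using that by auto
      then have "0 \<le> (\<beta> - \<alpha>) * (real k / Suc N)" "(\<beta> - \<alpha>) * (real k / Suc N) \<le> \<beta> - \<alpha>"
        using \<open>\<alpha> < \<beta>\<close> mult_nonneg_nonneg[of "\<beta> - \<alpha>"] mult_left_le[of _ "\<beta> - \<alpha>"]
        by (simp_all del: of_nat_Suc times_divide_eq_right)
      then show ?thesis by (auto simp: y_def)
    qed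
    have ix_close: "\<bar>t - y (ix t)\<bar> \<le> (\<beta> - \<alpha>) / Suc N" if t: "t \<in> {\<alpha>..\<beta>}" for t
    proof -
      define x where "x = Suc N * ((t - \<alpha>) / (\<beta> - \<alpha>))"
      have x0: "0 \<le> x" "x \<le> Suc N"
        using t \<open>\<alpha> < \<beta>\<close> by (auto simp: x_def field_simps simp del: of_nat_Suc)
      then have "nat \<lfloor>x\<rfloor> \<le> Suc N" by linarith
      then have "ix t = nat \<lfloor>x\<rfloor>" unfolding ix_def x_def[symmetric] by (rule min_absorb1)
      then have ixe: "real (ix t) = real_of_int \<lfloor>x\<rfloor>" using x0(1) by simp
      have tx: "t = \<alpha> + (\<beta> - \<alpha>) * (x / Suc N)"
        using \<open>\<alpha> < \<beta>\<close> by (simp add: x_def del: of_nat_Suc)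
      have "t - y (ix t) = (\<beta> - \<alpha>) * ((x - \<lfloor>x\<rfloor>) / Suc N)"
        unfolding y_def ixe by (subst tx) (metis add_diff_cancel_left diff_divide_distrib right_diff_distrib)
      moreover have "0 \<le> (x - \<lfloor>x\<rfloor>) / Suc N" "(x - \<lfloor>x\<rfloor>) / Suc N \<le> 1 / Suc N"
        by (auto intro!: divide_nonneg_nonneg divide_right_mono simp del: of_nat_Suc) linarith+
      ultimately show ?thesis
        using \<open>\<alpha> < \<beta>\<close> by (intro abs_le_divideI) auto
    qed
    have st_meas: "st z \<in> borel_measurable borel" for z
      unfolding st_def ix_def by measurable
    have sh_in: "sh z \<in> ?B" if "z \<in> ?B'" for z
      unfolding box_upto_def
    proof (intro CollectI allI impI)
      fix i assume "i < m"
      then show "lo i \<le> sh z i \<and> sh z i \<le> hi i"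
        using that unfolding box_upto_def sh_def lo'_def hi'_def
        by (auto dest!: spec[of _ "i + Suc (Suc N)"])
    qed
    have M0: "0 \<le> M"
    proof -
      have "lo \<in> ?B" using le by (auto simp: box_upto_def)
      then show ?thesis using bdd[of "\<lambda>_. 0" lo \<alpha>] \<open>\<alpha> < \<beta>\<close> by fastforce
    qed
    obtain z where z: "z \<in> ?B'" and Fz: "\<And>k. k < ?n \<Longrightarrow> F z k = z k"
    proof (rule brouwer_box_upto[of ?n lo' hi' F])
      show "lo' i \<le> hi' i" if "i < ?n" for i
        using that le M0 by (auto simp: lo'_def hi'_def)
      show "F z \<in> ?B'" if z: "z \<in> ?B'" for z
      proof -
        have "\<bar>W (st z) (sh z) (y k)\<bar> \<le> M" if "k \<le> Suc N" for k
          by (intro bdd st_meas sh_in z y_in that)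
        moreover have "lo (k - Suc (Suc N)) \<le> Z (st z) (sh z) (k - Suc (Suc N)) \<and>
            Z (st z) (sh z) (k - Suc (Suc N)) \<le> hi (k - Suc (Suc N))" if "k < ?n" "\<not> k \<le> Suc N" for k
          using Z[OF st_meas sh_in[OF z], of z] that by (auto simp: box_upto_def)
        ultimately show ?thesis
          unfolding box_upto_def F_def lo'_def hi'_def by (auto simp: abs_le_iff minus_le_iff)
      qed
      show "(\<lambda>k. F (X k) i) \<longlonglongrightarrow> F z i"
        if X: "\<And>k. X k \<in> ?B'" and z: "z \<in> ?B'" and lim: "\<And>j. j < ?n \<Longrightarrow> (\<lambda>k. X k j) \<longlonglongrightarrow> z j"
          and i: "i < ?n" for X z i
      proof -
        have 1: "(\<lambda>k. st (X k) t) \<longlonglongrightarrow> st z t" for t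
          unfolding st_def by (rule lim) (simp add: ix_def)
        have 2: "(\<lambda>k. sh (X k) j) \<longlonglongrightarrow> sh z j" if "j < m" for j
          unfolding sh_def by (rule lim) (use that in simp)
        show ?thesis
        proof (cases "i \<le> Suc N")
          case True
          have "(\<lambda>k. W (st (X k)) (sh (X k)) (y i)) \<longlonglongrightarrow> W (st z) (sh z) (y i)"
            by (rule contW) (use st_meas 1 2 sh_in X z y_in True in auto)
          with True show ?thesis by (simp add: F_def)
        next
          case False
          have "(\<lambda>k. Z (st (X k)) (sh (X k)) (i - Suc (Suc N))) \<longlonglongrightarrow> Z (st z) (sh z) (i - Suc (Suc N))"
            by (rule contZ) (use st_meas 1 2 sh_in X z False i in auto)
          with False show ?thesis by (simp add: F_def)
        qed
      qed
    qed blast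
    show ?thesis
    proof (intro bexI[of _ "st z"] bexI[of _ "sh z"] conjI ballI allI impI)
      fix t assume t: "t \<in> {\<alpha>..\<beta>}"
      have ixle: "ix t \<le> Suc N" by (simp add: ix_def)
      have "L \<ge> 0"
        using lip[OF st_meas sh_in[OF z], of \<alpha> \<beta> z] \<open>\<alpha> < \<beta>\<close>
        by (smt (verit) atLeastAtMost_iff mult_nonneg_nonneg mult_neg_pos abs_ge_zero)
      have "st z t = W (st z) (sh z) (y (ix t))"
        using Fz[of "ix t"] ixle by (simp add: F_def st_def)
      then have "\<bar>st z t - W (st z) (sh z) t\<bar> \<le> L * \<bar>y (ix t) - t\<bar>"
        using lip[OF st_meas sh_in[OF z] y_in[OF ixle] t, of z] by simp
      also have "\<dots> \<le> L * ((\<beta> - \<alpha>) / Suc N)"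
        using ix_close[OF t] \<open>L \<ge> 0\<close> by (intro mult_left_mono) (auto simp: abs_minus_commute)
      finally show "\<bar>st z t - W (st z) (sh z) t\<bar> \<le> L * ((\<beta> - \<alpha>) / Suc N)" .
    next
      fix i assume "i < m"
      then show "Z (st z) (sh z) i = sh z i" using Fz[of "i + Suc (Suc N)"] by (simp add: F_def sh_def)
    qed (use st_meas sh_in z in auto)
  qed
  then obtain V S where V: "\<And>N. V N \<in> borel_measurable borel" and S: "\<And>N. S N \<in> ?B"
    and VW: "\<And>N t. t \<in> {\<alpha>..\<beta>} \<Longrightarrow> \<bar>V N t - W (V N) (S N) t\<bar> \<le> L * ((\<beta> - \<alpha>) / Suc N)"
    and ZS: "\<And>N i. i < m \<Longrightarrow> Z (V N) (S N) i = S N i"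
    by metis
  let ?W = "\<lambda>N. W (V N) (S N)"
  \<comment> \<open>The \<open>V N\<close> are step functions, so compactness is drawn from their
    equi-Lipschitz images under \<open>W\<close>; \<open>VW\<close> later carries the limit back to
    \<open>V N\<close>.\<close>
  obtain w \<kappa> where contw: "continuous_on {\<alpha>..\<beta>} w" and \<kappa>: "strict_mono (\<kappa> :: nat \<Rightarrow> nat)"
    and unif: "\<And>e. 0 < e \<Longrightarrow> \<exists>N. \<forall>n x. n \<ge> N \<and> x \<in> {\<alpha>..\<beta>} \<longrightarrow> norm (?W (\<kappa> n) x - w x) < e"
  proof (rule Arzela_Ascoli[of "{\<alpha>..\<beta>}" ?W M])
    show "norm (?W n x) \<le> M" if "x \<in> {\<alpha>..\<beta>}" for n x using bdd[OF V S that] by simp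
    show "\<exists>d>0. \<forall>n y. y \<in> {\<alpha>..\<beta>} \<and> norm (x - y) < d \<longrightarrow> norm (?W n x - ?W n y) < e"
      if x: "x \<in> {\<alpha>..\<beta>}" and "0 < e" for x e
    proof (intro exI[of _ "e / (\<bar>L\<bar> + 1)"] conjI allI impI)
      fix n y assume y: "y \<in> {\<alpha>..\<beta>} \<and> norm (x - y) < e / (\<bar>L\<bar> + 1)"
      have "\<bar>?W n x - ?W n y\<bar> \<le> L * \<bar>x - y\<bar>" using lip[OF V S x] y by blast
      also have "\<dots> \<le> (\<bar>L\<bar> + 1) * \<bar>x - y\<bar>" by (intro mult_right_mono) auto
      also have "\<dots> < e" using y by (simp add: field_simps)
      finally show "norm (?W n x - ?W n y) < e" by simp
    qed (use \<open>0 < e\<close> in auto)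
  qed auto
  obtain M' where M': "\<And>N i. i \<in> {..<m} \<Longrightarrow> norm (S N i) \<le> M'"
  proof
    fix N i assume i: "i \<in> {..<m}"
    have "\<bar>S N i\<bar> \<le> \<bar>lo i\<bar> + \<bar>hi i\<bar>" using S[of N] i by (force simp: box_upto_def)
    also have "\<dots> \<le> (\<Sum>i<m. \<bar>lo i\<bar> + \<bar>hi i\<bar>)" using i by (intro member_le_sum) auto
    finally show "norm (S N i) \<le> (\<Sum>i<m. \<bar>lo i\<bar> + \<bar>hi i\<bar>)" by simp
  qed
  obtain \<nu> :: "nat \<Rightarrow> nat" where \<nu>: "strict_mono \<nu>"
    and conv: "\<And>i. i \<in> {..<m} \<Longrightarrow> \<exists>l. (\<lambda>k. S (\<kappa> (\<nu> k)) i) \<longlonglongrightarrow> l"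
    using function_convergent_subsequence[of "{..<m}" "\<lambda>k. S (\<kappa> k)" M', OF _ M'] by blast
  then obtain s where s: "\<And>i. i < m \<Longrightarrow> (\<lambda>k. S (\<kappa> (\<nu> k)) i) \<longlonglongrightarrow> s i"
    by (metis lessThan_iff)
  have sB: "s \<in> ?B"
    using S by (auto simp: box_upto_def intro: LIMSEQ_le_const[OF s] LIMSEQ_le_const2[OF s])
  \<comment> \<open>Continued by constants, because \<open>contW\<close> and \<open>contZ\<close>
    ask for a function measurable on the whole line.\<close>
  define u where "u t = w (max \<alpha> (min \<beta> t))" for t
  have u_eq: "u t = w t" if "t \<in> {\<alpha>..\<beta>}" for t using that by (simp add: u_def)
  have "continuous_on UNIV u"
    unfolding u_def by (rule continuous_on_compose2[OF contw]) (use \<open>\<alpha> < \<beta>\<close> in \<open>auto intro!: continuous_intros\<close>)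
  then have um: "u \<in> borel_measurable borel" by (rule borel_measurable_continuous_onI)
  define \<theta> where "\<theta> k = \<kappa> (\<nu> k)" for k
  have \<theta>: "strict_mono \<theta>" using \<kappa> \<nu> by (simp add: \<theta>_def strict_mono_def)
  have Wlim: "(\<lambda>k. ?W (\<theta> k) t) \<longlonglongrightarrow> u t" if t: "t \<in> {\<alpha>..\<beta>}" for t
  proof -
    have "(\<lambda>k. ?W (\<kappa> k) t) \<longlonglongrightarrow> w t"
      by (rule LIMSEQ_I) (use unif t in blast)
    from LIMSEQ_subseq_LIMSEQ[OF this \<nu>] show ?thesis using u_eq[OF t] by (simp add: o_def \<theta>_def)
  qed
  have Vlim: "(\<lambda>k. V (\<theta> k) t) \<longlonglongrightarrow> u t" if t: "t \<in> {\<alpha>..\<beta>}" for t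
  proof -
    have "(\<lambda>k. L * (\<beta> - \<alpha>) * inverse (Suc k)) \<longlonglongrightarrow> 0"
      using tendsto_mult[OF tendsto_const[of "L * (\<beta> - \<alpha>)"] LIMSEQ_inverse_real_of_nat] by simp
    from LIMSEQ_subseq_LIMSEQ[OF this \<theta>] have "(\<lambda>k. L * (\<beta> - \<alpha>) * inverse (Suc (\<theta> k))) \<longlonglongrightarrow> 0"
      by (simp add: o_def)
    then have "(\<lambda>k. V (\<theta> k) t - ?W (\<theta> k) t) \<longlonglongrightarrow> 0"
      by (rule Lim_null_comparison[rotated]) (use VW[OF t] in \<open>simp add: divide_inverse mult.assoc\<close>)
    from tendsto_add[OF this Wlim[OF t]] show ?thesis by simp
  qed
  show ?thesis
  proof (rule that[OF um sB])
    fix t assume t: "t \<in> {\<alpha>..\<beta>}"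
    have "(\<lambda>k. ?W (\<theta> k) t) \<longlonglongrightarrow> W u s t"
      by (rule contW) (use V um Vlim S sB s t in \<open>auto simp: \<theta>_def\<close>)
    then show "W u s t = u t" using Wlim[OF t] LIMSEQ_unique by blast
  next
    fix i assume i: "i < m"
    have "(\<lambda>k. Z (V (\<theta> k)) (S (\<theta> k)) i) \<longlonglongrightarrow> Z u s i"
      by (rule contZ) (use V um Vlim S sB s i in \<open>auto simp: \<theta>_def\<close>)
    then show "Z u s i = s i" using s[OF i] ZS[OF i] LIMSEQ_unique by (simp add: \<theta>_def) blast
  qed
qed

section \<open>Broken solutions\<close>

text \<open>The sign of \<open>e i\<close> chooses the direction in which the kink at \<open>t i\<close> pushes the nodal value \<open>s i\<close>. The
  node \<open>t m\<close> is identified with \<open>t 0\<close>.\<close>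

lemma broken_solution:
  fixes t lo hi e :: "nat \<Rightarrow> real" and f :: "(nat \<Rightarrow> real) \<Rightarrow> real \<Rightarrow> real \<Rightarrow> real" and b :: "real \<Rightarrow> real"
  assumes m: "0 < m" and t: "\<And>j. j < m \<Longrightarrow> t j < t (Suc j)"
    and le: "\<And>i. i < m \<Longrightarrow> lo i \<le> hi i"
    and e: "\<And>i. i < m \<Longrightarrow> e i \<noteq> 0"
    and b: "b integrable_on {t 0..t m}"
    and fint: "\<And>v s. \<lbrakk>v \<in> borel_measurable borel; s \<in> box_upto m lo hi\<rbrakk>
        \<Longrightarrow> (\<lambda>x. f s (v x) x) absolutely_integrable_on {t 0..t m}"
    and fb: "\<And>s y x. \<lbrakk>s \<in> box_upto m lo hi; x \<in> {t 0..t m}\<rbrakk> \<Longrightarrow> \<bar>f s y x\<bar> \<le> b x"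
    and fcont: "\<And>X s Y y x. \<lbrakk>\<And>k. X k \<in> box_upto m lo hi; s \<in> box_upto m lo hi;
        \<And>i. i < m \<Longrightarrow> (\<lambda>k. X k i) \<longlonglongrightarrow> s i; Y \<longlonglongrightarrow> y; x \<in> {t 0..t m}\<rbrakk>
        \<Longrightarrow> (\<lambda>k. f (X k) (Y k) x) \<longlonglongrightarrow> f s y x"
  obtains u s p where "s \<in> box_upto m lo hi" "continuous_on {t 0..t m} u"
    "(\<lambda>x. f s (u x) x) absolutely_integrable_on {t 0..t m}"
    "\<And>j. j < m \<Longrightarrow> u (t j) = s j" "\<And>j. j < m \<Longrightarrow> u (t (Suc j)) = s (Suc j mod m)"
    "\<And>j x. \<lbrakk>j < m; x \<in> {t j..t (Suc j)}\<rbrakk> \<Longrightarrow>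
      (u has_real_derivative p j - integral {t j..x} (\<lambda>x. f s (u x) x)) (at x within {t j..t (Suc j)})"
    "\<And>j i D. \<lbrakk>j < m; i = Suc j mod m;
        D = p i - (p j - integral {t j..t (Suc j)} (\<lambda>x. f s (u x) x))\<rbrakk>
      \<Longrightarrow> D = 0 \<or> s i = lo i \<and> e i * D < 0 \<or> s i = hi i \<and> e i * D > 0"
proof -
  let ?B = "box_upto m lo hi"
  define \<alpha> \<beta> where "\<alpha> = t 0" and "\<beta> = t m"
  define len where "len j = t (Suc j) - t j" for j
  have len: "0 < len j" if "j < m" for j using t that by (simp add: len_def)
  have t_mono: "t i \<le> t j" if "i \<le> j" "j \<le> m" for i j
    using that
  proof (induction j)
    case (Suc j)
    then show ?case using t[of j] by (cases "i = Suc j") auto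
  qed simp
  have t_in: "t j \<in> {\<alpha>..\<beta>}" if "j \<le> m" for j
    using t_mono[of 0 j] t_mono[of j m] that by (simp add: \<alpha>_def \<beta>_def)
  have "\<alpha> < \<beta>" using t[OF m] t_in[of "Suc 0"] m by (simp add: \<alpha>_def)
  define h where "h v s x = f s (v x) x" for v s x
  define H where "H v s x = integral {\<alpha>..x} (h v s)" for v s x
  define Q where "Q v s x = integral {\<alpha>..x} (H v s)" for v s x
  \<comment> \<open>The second derivative is inverted on each piece: \<open>- Q\<close> formally has
    second derivative \<open>- h\<close>, and the piecewise linear function with node values
    \<open>A\<close> corrects it so that \<open>W v s\<close> equals \<open>s j\<close> at
    \<open>t j\<close>. Here \<open>clip j x\<close> is the length of the part of piece
    \<open>j\<close> to the left of \<open>x\<close>, so slopes times clips add up to the increase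
    of that function since \<open>t 0\<close>.\<close>
  define A where "A v s j = s (j mod m) + Q v s (t j)" for v s j
  define sl where "sl v s j = (A v s (Suc j) - A v s j) / len j" for v s j
  define clip where "clip j x = max 0 (min (x - t j) (len j))" for j x
  define W where "W v s x = s 0 + (\<Sum>j<m. sl v s j * clip j x) - Q v s x" for v s x
  \<comment> \<open>Right minus left derivative at node \<open>i\<close>. For \<open>i = 0\<close>
    the left derivative is taken at \<open>t m\<close>, the end of piece
    \<open>m - 1\<close>.\<close>
  define D where "D v s i = (let j = (if i = 0 then m - 1 else i - 1) in
      (sl v s i - H v s (t i)) - (sl v s j - H v s (t (Suc j))))" for v s i
  define Z where "Z v s i = max (lo i) (min (hi i) (s i + e i * D v s i))" for v s i
  define IB where "IB = integral {\<alpha>..\<beta>} b"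
  define SB where "SB = (\<Sum>i<m. \<bar>lo i\<bar> + \<bar>hi i\<bar>)"
  have b0: "0 \<le> b x" if "x \<in> {\<alpha>..\<beta>}" for x
  proof -
    have "lo \<in> ?B" using le by (auto simp: box_upto_def)
    then show ?thesis using fb[of lo x 0] that by (auto simp: \<alpha>_def \<beta>_def)
  qed
  have sSB: "\<bar>s (i mod m)\<bar> \<le> SB" if "s \<in> ?B" for s i
  proof -
    have im: "i mod m < m" using m by simp
    then have "\<bar>s (i mod m)\<bar> \<le> \<bar>lo (i mod m)\<bar> + \<bar>hi (i mod m)\<bar>" using that by (force simp: box_upto_def)
    also have "\<dots> \<le> SB" unfolding SB_def using im by (intro member_le_sum) auto
    finally show ?thesis .
  qed
  have hint: "h v s absolutely_integrable_on {\<alpha>..\<beta>}" if "v \<in> borel_measurable borel" "s \<in> ?B" for v s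
    using fint[OF that] by (simp add: h_def[abs_def] \<alpha>_def \<beta>_def)
  have hint': "h v s integrable_on {c..d}"
    if "v \<in> borel_measurable borel" "s \<in> ?B" "\<alpha> \<le> c" "d \<le> \<beta>" for v s c d
    using hint[OF that(1,2)] that(3,4)
    by (meson absolutely_integrable_on_def atLeastatMost_subset_iff integrable_on_subinterval)
  have bint: "b integrable_on {\<alpha>..x}" if "x \<le> \<beta>" for x
    using b that by (auto simp: \<alpha>_def \<beta>_def intro: integrable_on_subinterval)
  have HB: "\<bar>H v s x\<bar> \<le> IB" if vs: "v \<in> borel_measurable borel" "s \<in> ?B" and x: "x \<in> {\<alpha>..\<beta>}" for v s x
  proof -
    have "norm (H v s x) \<le> integral {\<alpha>..x} b" unfolding H_def
      using x fb[OF vs(2)] by (intro integral_norm_bound_integral hint' vs bint) (auto simp: h_def \<alpha>_def \<beta>_def)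
    also have "\<dots> \<le> IB" unfolding IB_def
      using x b0 by (intro integral_subset_le bint) auto
    finally show ?thesis by simp
  qed
  have IB0: "0 \<le> IB" unfolding IB_def using b0 by (intro integral_nonneg bint) auto
  have Hcont: "continuous_on {\<alpha>..\<beta>} (H v s)" if "v \<in> borel_measurable borel" "s \<in> ?B" for v s
    unfolding H_def using that by (intro indefinite_integral_continuous_1 hint') auto
  have Qder: "(Q v s has_real_derivative H v s x) (at x within {\<alpha>..\<beta>})"
    if "v \<in> borel_measurable borel" "s \<in> ?B" "x \<in> {\<alpha>..\<beta>}" for v s x
    unfolding Q_def using that by (intro integral_has_real_derivative Hcont) auto
  have Qlip: "\<bar>Q v s x - Q v s y\<bar> \<le> IB * \<bar>x - y\<bar>"
    if "v \<in> borel_measurable borel" "s \<in> ?B" "x \<in> {\<alpha>..\<beta>}" "y \<in> {\<alpha>..\<beta>}" for v s x y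
    using field_differentiable_bound[of "{\<alpha>..\<beta>}" "Q v s" "H v s" IB x y] Qder HB that by auto
  have Q\<alpha>: "Q v s \<alpha> = 0" for v s by (simp add: Q_def)
  have QB: "\<bar>Q v s x\<bar> \<le> IB * (\<beta> - \<alpha>)"
    if "v \<in> borel_measurable borel" "s \<in> ?B" "x \<in> {\<alpha>..\<beta>}" for v s x
  proof -
    have "\<bar>Q v s x\<bar> \<le> IB * \<bar>x - \<alpha>\<bar>" using Qlip[OF that, of \<alpha>] that(3) by (simp add: Q\<alpha>)
    also have "\<dots> \<le> IB * (\<beta> - \<alpha>)" using that(3) IB0 by (intro mult_left_mono) auto
    finally show ?thesis .
  qed
  define c where "c j = (2 * SB + 2 * (IB * (\<beta> - \<alpha>))) / len j" for j
  have slB: "\<bar>sl v s j\<bar> \<le> c j" if "v \<in> borel_measurable borel" "s \<in> ?B" "j < m" for v s j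
  proof -
    have "\<bar>A v s (Suc j) - A v s j\<bar> \<le> 2 * SB + 2 * (IB * (\<beta> - \<alpha>))"
      using sSB[OF that(2), of j] sSB[OF that(2), of "Suc j"] QB[OF that(1,2) t_in, of j]
        QB[OF that(1,2) t_in, of "Suc j"] that(3) by (simp add: A_def)
    then show ?thesis using len[OF that(3)] by (simp add: sl_def c_def divide_right_mono)
  qed
  define L where "L = (\<Sum>j<m. c j) + IB"
  have Wlip: "\<bar>W v s x - W v s y\<bar> \<le> L * \<bar>x - y\<bar>"
    if vs: "v \<in> borel_measurable borel" "s \<in> ?B" and xy: "x \<in> {\<alpha>..\<beta>}" "y \<in> {\<alpha>..\<beta>}" for v s x y
  proof -
    have "\<bar>(\<Sum>j<m. sl v s j * clip j x) - (\<Sum>j<m. sl v s j * clip j y)\<bar> \<le>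
        (\<Sum>j<m. \<bar>sl v s j * clip j x - sl v s j * clip j y\<bar>)"
      by (simp flip: sum_subtractf)
    also have "\<dots> \<le> (\<Sum>j<m. c j * \<bar>x - y\<bar>)"
    proof (rule sum_mono)
      fix j assume "j \<in> {..<m}"
      then have j: "j < m" by simp
      have "\<bar>sl v s j * clip j x - sl v s j * clip j y\<bar> = \<bar>sl v s j\<bar> * \<bar>clip j x - clip j y\<bar>"
        by (simp add: abs_mult flip: right_diff_distrib)
      also have "\<dots> \<le> c j * \<bar>x - y\<bar>"
        using slB[OF vs j] by (intro mult_mono) (auto simp: clip_def)
      finally show "\<bar>sl v s j * clip j x - sl v s j * clip j y\<bar> \<le> c j * \<bar>x - y\<bar>" .
    qed
    finally have "\<bar>(\<Sum>j<m. sl v s j * clip j x) - (\<Sum>j<m. sl v s j * clip j y)\<bar> \<le> (\<Sum>j<m. c j) * \<bar>x - y\<bar>"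
      by (simp add: sum_distrib_right)
    then show ?thesis using Qlip[OF vs xy] unfolding W_def L_def by (simp add: distrib_right)
  qed
  have W\<alpha>: "W v s \<alpha> = s 0" for v s
  proof -
    have "clip j \<alpha> = 0" if "j < m" for j using t_in[of j] len[OF that] that by (auto simp: clip_def)
    then show ?thesis by (simp add: W_def Q\<alpha>)
  qed
  have WB: "\<bar>W v s x\<bar> \<le> SB + \<bar>L\<bar> * (\<beta> - \<alpha>)"
    if vs: "v \<in> borel_measurable borel" "s \<in> ?B" and x: "x \<in> {\<alpha>..\<beta>}" for v s x
  proof -
    have "\<bar>W v s x - W v s \<alpha>\<bar> \<le> L * \<bar>x - \<alpha>\<bar>" using x by (intro Wlip vs) auto
    also have "\<dots> \<le> \<bar>L\<bar> * (\<beta> - \<alpha>)" using x by (intro mult_mono) auto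
    finally show ?thesis using sSB[OF vs(2), of 0] by (simp add: W\<alpha>)
  qed
  have lims: "(\<lambda>k. H (V k) (X k) x) \<longlonglongrightarrow> H v s x" "(\<lambda>k. Q (V k) (X k) x) \<longlonglongrightarrow> Q v s x"
    if V: "\<And>k. V k \<in> borel_measurable borel" and v: "v \<in> borel_measurable borel"
      and Vv: "\<And>t. t \<in> {\<alpha>..\<beta>} \<Longrightarrow> (\<lambda>k. V k t) \<longlonglongrightarrow> v t"
      and X: "\<And>k. X k \<in> ?B" and s: "s \<in> ?B" and Xs: "\<And>i. i < m \<Longrightarrow> (\<lambda>k. X k i) \<longlonglongrightarrow> s i"
      and x: "x \<in> {\<alpha>..\<beta>}" for V v X s x
  proof -
    have H: "(\<lambda>k. H (V k) (X k) x) \<longlonglongrightarrow> H v s x" if x: "x \<in> {\<alpha>..\<beta>}" for x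
      unfolding H_def
    proof (rule dominated_convergence[where h=b])
      show "h (V k) (X k) integrable_on {\<alpha>..x}" for k using x by (intro hint' V X) auto
      show "b integrable_on {\<alpha>..x}" using x by (intro bint) auto
      show "norm (h (V k) (X k) y) \<le> b y" if "y \<in> {\<alpha>..x}" for k y
        using fb[OF X[of k], of y "V k y"] that x by (auto simp: h_def \<alpha>_def \<beta>_def)
      show "(\<lambda>k. h (V k) (X k) y) \<longlonglongrightarrow> h v s y" if "y \<in> {\<alpha>..x}" for y
        unfolding h_def using that x
        by (intro fcont X s Xs Vv) (auto simp: \<alpha>_def \<beta>_def)
    qed
    then show "(\<lambda>k. H (V k) (X k) x) \<longlonglongrightarrow> H v s x" using x by blast
    show "(\<lambda>k. Q (V k) (X k) x) \<longlonglongrightarrow> Q v s x"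
      unfolding Q_def
    proof (rule dominated_convergence[where h="\<lambda>_. IB"])
      show "H (V k) (X k) integrable_on {\<alpha>..x}" for k
        using x by (intro integrable_continuous_real continuous_on_subset[OF Hcont[OF V X]]) auto
      show "(\<lambda>_. IB) integrable_on {\<alpha>..x}" by (intro integrable_continuous_real continuous_on_const)
      show "norm (H (V k) (X k) y) \<le> IB" if "y \<in> {\<alpha>..x}" for k y
        using that x HB[OF V[of k] X[of k], of y] by auto
      show "(\<lambda>k. H (V k) (X k) y) \<longlonglongrightarrow> H v s y" if "y \<in> {\<alpha>..x}" for y
        using H that x by auto
    qed
  qed
  have sl_lim: "(\<lambda>k. sl (V k) (X k) j) \<longlonglongrightarrow> sl v s j"
    if V: "\<And>k. V k \<in> borel_measurable borel" and v: "v \<in> borel_measurable borel"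
      and Vv: "\<And>t. t \<in> {\<alpha>..\<beta>} \<Longrightarrow> (\<lambda>k. V k t) \<longlonglongrightarrow> v t"
      and X: "\<And>k. X k \<in> ?B" and s: "s \<in> ?B" and Xs: "\<And>i. i < m \<Longrightarrow> (\<lambda>k. X k i) \<longlonglongrightarrow> s i"
      and j: "j < m" for V v X s j
    unfolding sl_def A_def
    using len[OF j] j m by (intro tendsto_intros Xs lims[OF V v Vv X s Xs] t_in) auto
  obtain u s where um: "u \<in> borel_measurable borel" and sB: "s \<in> ?B"
    and Wu: "\<And>x. x \<in> {\<alpha>..\<beta>} \<Longrightarrow> W u s x = u x" and Zs: "\<And>i. i < m \<Longrightarrow> Z u s i = s i"
  proof (rule schauder_lipschitz[of \<alpha> \<beta> m lo hi W "SB + \<bar>L\<bar> * (\<beta> - \<alpha>)" L Z])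
    show "Z v s \<in> ?B" for v s using le by (auto simp: Z_def box_upto_def)
  next
    fix V :: "nat \<Rightarrow> real \<Rightarrow> real" and v :: "real \<Rightarrow> real"
      and X :: "nat \<Rightarrow> nat \<Rightarrow> real" and s :: "nat \<Rightarrow> real" and x :: real
    assume *: "\<And>k. V k \<in> borel_measurable borel" "v \<in> borel_measurable borel"
      "\<And>t. t \<in> {\<alpha>..\<beta>} \<Longrightarrow> (\<lambda>k. V k t) \<longlonglongrightarrow> v t"
      "\<And>k. X k \<in> ?B" "s \<in> ?B" "\<And>i. i < m \<Longrightarrow> (\<lambda>k. X k i) \<longlonglongrightarrow> s i"
    show "(\<lambda>k. W (V k) (X k) x) \<longlonglongrightarrow> W v s x" if "x \<in> {\<alpha>..\<beta>}"
      unfolding W_def using m that by (intro tendsto_intros * sl_lim[OF *] lims[OF *]) auto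
    show "(\<lambda>k. Z (V k) (X k) i) \<longlonglongrightarrow> Z v s i" if i: "i < m" for i
      unfolding Z_def D_def Let_def using i
      by (intro tendsto_intros tendsto_max tendsto_min * sl_lim[OF *] lims[OF *] t_in) auto
  qed (use \<open>\<alpha> < \<beta>\<close> le WB Wlip in auto)
  define p where "p j = sl u s j - H u s (t j)" for j
  have W_piece: "W u s x = s j + Q u s (t j) + sl u s j * (x - t j) - Q u s x"
    if j: "j < m" and x: "x \<in> {t j..t (Suc j)}" for j x
  proof -
    have "(\<Sum>i<m. sl u s i * clip i x) = (\<Sum>i<Suc j. sl u s i * clip i x)"
    proof (rule sum.mono_neutral_right)
      show "\<forall>i\<in>{..<m} - {..<Suc j}. sl u s i * clip i x = 0"
      proof
        fix i assume "i \<in> {..<m} - {..<Suc j}"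
        then have "t (Suc j) \<le> t i" "i < m" by (auto intro: t_mono)
        then show "sl u s i * clip i x = 0" using x len[of i] by (simp add: clip_def)
      qed
    qed (use j in auto)
    also have "\<dots> = (\<Sum>i<j. A u s (Suc i) - A u s i) + sl u s j * (x - t j)"
    proof -
      have "sl u s i * clip i x = A u s (Suc i) - A u s i" if "i < j" for i
      proof -
        have "t (Suc i) \<le> t j" using that j by (intro t_mono) auto
        then have "clip i x = len i" using x len[of i] that j by (simp add: clip_def len_def)
        then show ?thesis using len[of i] that j by (simp add: sl_def)
      qed
      moreover have "clip j x = x - t j" using x by (auto simp: clip_def len_def)
      ultimately show ?thesis by simp
    qed
    also have "(\<Sum>i<j. A u s (Suc i) - A u s i) = A u s j - A u s 0"
      by (rule sum_lessThan_telescope)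
    finally show ?thesis using j by (simp add: W_def A_def Q\<alpha>[unfolded \<alpha>_def])
  qed
  have piece_sub: "{t j..t (Suc j)} \<subseteq> {\<alpha>..\<beta>}" if "j < m" for j
    using t_in[of j] t_in[of "Suc j"] that by auto
  have Hdiff: "H u s x = H u s y + integral {y..x} (h u s)" if "y \<in> {\<alpha>..\<beta>}" "x \<in> {\<alpha>..\<beta>}" "y \<le> x" for x y
    unfolding H_def using that
    by (subst Henstock_Kurzweil_Integration.integral_combine[symmetric, of \<alpha> y x]) (auto intro!: hint' um sB)
  show ?thesis
  proof (rule that[of s u p])
    show "s \<in> ?B" by (fact sB)
    have "continuous_on {\<alpha>..\<beta>} (W u s)"
      by (rule lipschitz_on_continuous_on[of "\<bar>L\<bar>"])
        (auto simp: lipschitz_on_def dist_real_def intro!: order_trans[OF Wlip[OF um sB]] mult_right_mono)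
    then have "continuous_on {\<alpha>..\<beta>} u" by (rule continuous_on_eq) (rule Wu)
    then show "continuous_on {t 0..t m} u" by (simp add: \<alpha>_def \<beta>_def)
    show "(\<lambda>x. f s (u x) x) absolutely_integrable_on {t 0..t m}"
      by (rule fint[OF um sB])
    show "u (t j) = s j" if j: "j < m" for j
      using Wu[OF t_in, of j] W_piece[OF j, of "t j"] t[OF j] j by simp
    show "u (t (Suc j)) = s (Suc j mod m)" if j: "j < m" for j
      using Wu[OF t_in, of "Suc j"] W_piece[OF j, of "t (Suc j)"] t[OF j] j len[OF j]
      by (simp add: sl_def A_def len_def[symmetric])
    have integral_eq: "integral {c..d} (\<lambda>x. f s (u x) x) = integral {c..d} (h u s)" for c d
      by (simp add: h_def[abs_def])
    show "(u has_real_derivative p j - integral {t j..x} (\<lambda>x. f s (u x) x)) (at x within {t j..t (Suc j)})"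
      if j: "j < m" and x: "x \<in> {t j..t (Suc j)}" for j x
    proof -
      have x': "x \<in> {\<alpha>..\<beta>}" using piece_sub[OF j] x by blast
      have "p j - integral {t j..x} (h u s) = sl u s j - H u s x"
        using Hdiff[OF t_in x', of j] j x by (simp add: p_def)
      moreover have "((\<lambda>x. s j + Q u s (t j) + sl u s j * (x - t j) - Q u s x)
          has_real_derivative sl u s j - H u s x) (at x within {t j..t (Suc j)})"
        by (auto intro!: derivative_eq_intros DERIV_subset[OF Qder[OF um sB x'] piece_sub[OF j]])
      moreover have "s j + Q u s (t j) + sl u s j * (y - t j) - Q u s y = u y" if "y \<in> {t j..t (Suc j)}" for y
        using W_piece[OF j that] Wu[of y] piece_sub[OF j] that by auto
      ultimately show ?thesis
        unfolding integral_eq using has_field_derivative_transform_within[OF _ zero_less_one x] by simp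
    qed
    show "D' = 0 \<or> s i = lo i \<and> e i * D' < 0 \<or> s i = hi i \<and> e i * D' > 0"
      if j: "j < m" and i: "i = Suc j mod m"
        and D': "D' = p i - (p j - integral {t j..t (Suc j)} (\<lambda>x. f s (u x) x))" for i j D'
    proof -
      have im: "i < m" using m i by simp
      have "(if i = 0 then m - 1 else i - 1) = j"
        using i j by (cases "Suc j = m") auto
      then have "D u s i = D'"
        using Hdiff[OF t_in t_in, of j "Suc j"] j t[OF j]
        unfolding D' integral_eq D_def by (simp add: p_def Let_def)
      then have "max (lo i) (min (hi i) (s i + e i * D')) = s i" using Zs[OF im] by (simp add: Z_def)
      moreover have "lo i \<le> s i" "s i \<le> hi i" using sB im by (auto simp: box_upto_def)
      ultimately have "e i * D' = 0 \<or> s i = lo i \<and> e i * D' < 0 \<or> s i = hi i \<and> e i * D' > 0"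
        by linarith
      then show ?thesis using e[OF im] by simp
    qed
  qed
qed

section \<open>Integrals and one-dimensional comparison\<close>

lemma increment_ge:
  fixes u F :: "real \<Rightarrow> real"
  assumes "a \<le> b" and der: "\<And>x. x \<in> {a..b} \<Longrightarrow> (u has_real_derivative F x) (at x within S)" and "{a..b} \<subseteq> S"
    and ge: "\<And>x. x \<in> {a..b} \<Longrightarrow> c \<le> F x"
  shows "u a + c * (b - a) \<le> u b"
proof -
  obtain x where x: "x \<in> {a..b}" "u b - u a = F x * (b - a)"
    using mvt_very_simple[of a b u "\<lambda>x. (*) (F x)"] assms(1)
      DERIV_subset[OF der \<open>{a..b} \<subseteq> S\<close>] by (auto simp: has_field_derivative_def)
  have "c * (b - a) \<le> F x * (b - a)" using ge[OF x(1)] assms(1) by (intro mult_right_mono) auto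
  with x show ?thesis by simp
qed

lemma increment_le:
  fixes u F :: "real \<Rightarrow> real"
  assumes "a \<le> b" and der: "\<And>x. x \<in> {a..b} \<Longrightarrow> (u has_real_derivative F x) (at x within S)" and "{a..b} \<subseteq> S"
    and le: "\<And>x. x \<in> {a..b} \<Longrightarrow> F x \<le> c"
  shows "u b \<le> u a + c * (b - a)"
proof -
  have "- u a + (- c) * (b - a) \<le> - u b"
    by (rule increment_ge[where F="\<lambda>x. - F x" and S=S]) (use assms in \<open>auto intro!: DERIV_minus\<close>)
  then show ?thesis by simp
qed

lemma integral_split:
  fixes h :: "real \<Rightarrow> real"
  assumes "h integrable_on {\<alpha>..\<beta>}" "\<alpha> \<le> x" "x \<le> y" "y \<le> \<beta>"
  shows "integral {\<alpha>..y} h = integral {\<alpha>..x} h + integral {x..y} h"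
  using assms
  by (intro Henstock_Kurzweil_Integration.integral_combine[symmetric])
    (auto intro: integrable_on_subinterval)

text \<open>In a gap the sign of \<open>h\<close> is known only on the open interval, since its end
  points are counted with the lobes.\<close>

lemma integral_le_interior:
  fixes f g :: "real \<Rightarrow> real"
  assumes "f integrable_on {a..b}" "g integrable_on {a..b}" "\<And>x. x \<in> {a<..<b} \<Longrightarrow> f x \<le> g x"
  shows "integral {a..b} f \<le> integral {a..b} g"
  using integral_le[of f "{a<..<b}" g] assms
  by (simp add: integrable_on_open_interval_real integral_open_interval_real)

section \<open>Convex escape and concave crash on a single piece\<close>

text \<open>The piece runs through half a lobe, a gap and half a lobe. With initial slope at least 0
  and mass at most \<open>s / (2 * T)\<close> up to \<tau>, the slope stays above
  \<open>- s / (2 * T)\<close> until \<sigma>, so \<open>u\<close> loses at most half of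
  \<open>s\<close> and the strict convexity in the gap is available throughout. The gap adds
  \<open>\<delta> * integral N\<close> to the slope; after the losses \<open>s / (2 * T)\<close> and
  \<open>B\<close> at least \<open>R / (\<beta> - \<sigma>)\<close> remains, enough to climb by
  \<open>R\<close> on the last interval.\<close>

lemma convex_escape_right:
  fixes u h N :: "real \<Rightarrow> real"
  assumes ord: "\<alpha> \<le> \<tau>" "\<tau> \<le> \<sigma>" "\<sigma> < \<beta>" "\<beta> - \<alpha> \<le> T"
    and der: "\<And>x. x \<in> {\<alpha>..\<beta>} \<Longrightarrow> (u has_real_derivative p - integral {\<alpha>..x} h) (at x within {\<alpha>..\<beta>})"
    and hint: "h integrable_on {\<alpha>..\<beta>}"
    and p: "0 \<le> p" and s: "u \<alpha> = s" "0 < s"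
    and small: "\<And>x. x \<in> {\<alpha>..\<tau>} \<Longrightarrow> integral {\<alpha>..x} h \<le> s / (2 * T)"
    and nonpos: "\<And>x. x \<in> {\<tau><..<\<sigma>} \<Longrightarrow> h x \<le> 0"
    and neg: "\<And>x. \<lbrakk>x \<in> {\<tau><..<\<sigma>}; s / 2 \<le> u x\<rbrakk> \<Longrightarrow> h x \<le> - (\<delta> * N x)"
    and Nint: "N integrable_on {\<tau>..\<sigma>}"
    and bd: "\<And>x. x \<in> {\<sigma>..\<beta>} \<Longrightarrow> integral {\<sigma>..x} h \<le> B"
    and large: "B + s / (2 * T) + R / (\<beta> - \<sigma>) \<le> \<delta> * integral {\<tau>..\<sigma>} N"
  shows "R < u \<beta>"
proof -
  have hint': "h integrable_on {c..d}" if "\<alpha> \<le> c" "d \<le> \<beta>" for c d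
    using hint that by (auto intro: integrable_on_subinterval)
  have T: "0 < T" using ord by linarith
  have low: "integral {\<alpha>..x} h \<le> s / (2 * T)" if "x \<in> {\<alpha>..\<sigma>}" for x
  proof (cases "x \<le> \<tau>")
    case False
    have "integral {\<tau>..x} h \<le> integral {\<tau>..x} (\<lambda>_. 0)"
      using that ord False by (intro integral_le_interior hint' nonpos) auto
    then show ?thesis
      using integral_split[OF hint, of \<tau> x] small[of \<tau>] that False ord by auto
  qed (use small that in auto)
  have u_ge: "s / 2 \<le> u x" if x: "x \<in> {\<alpha>..\<sigma>}" for x
  proof -
    have "u \<alpha> + (- (s / (2 * T))) * (x - \<alpha>) \<le> u x"
      using x ord p low
      by (intro increment_ge[where S="{\<alpha>..\<beta>}" and F="\<lambda>x. p - integral {\<alpha>..x} h"] der) force+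
    moreover have "s / (2 * T) * (x - \<alpha>) \<le> s / (2 * T) * T"
      using x ord s T by (intro mult_left_mono) auto
    ultimately show ?thesis using s T by simp
  qed
  have "integral {\<tau>..\<sigma>} h \<le> integral {\<tau>..\<sigma>} (\<lambda>x. - (\<delta> * N x))"
    using ord u_ge neg by (intro integral_le_interior hint' integrable_neg integrable_on_mult_right Nint) auto
  then have mid: "integral {\<alpha>..\<sigma>} h \<le> s / (2 * T) - \<delta> * integral {\<tau>..\<sigma>} N"
    using integral_split[OF hint, of \<tau> \<sigma>] small[of \<tau>] ord by auto
  have "integral {\<alpha>..x} h \<le> - (R / (\<beta> - \<sigma>))" if "x \<in> {\<sigma>..\<beta>}" for x
    using integral_split[OF hint, of \<sigma> x] mid bd[OF that] large that ord by auto
  then have "u \<sigma> + R / (\<beta> - \<sigma>) * (\<beta> - \<sigma>) \<le> u \<beta>"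
    using ord p
    by (intro increment_ge[where S="{\<alpha>..\<beta>}" and F="\<lambda>x. p - integral {\<alpha>..x} h"] der) force+
  then show ?thesis using u_ge[of \<sigma>] ord s by auto
qed

text \<open>Under x -> -x, data prescribed at the right end become data at the left end with the
  slope negated, so each "left" estimate below is its "right" twin applied to the reflected
  function.\<close>

lemma derivative_reflect:
  fixes u h :: "real \<Rightarrow> real"
  assumes der: "\<And>x. x \<in> {\<alpha>..\<beta>} \<Longrightarrow> (u has_real_derivative q + integral {x..\<beta>} h) (at x within {\<alpha>..\<beta>})"
    and x: "x \<in> {-\<beta>..-\<alpha>}"
  shows "((\<lambda>x. u (- x)) has_real_derivative - q - integral {-\<beta>..x} (\<lambda>x. h (- x))) (at x within {-\<beta>..-\<alpha>})"
proof -
  have "- x \<in> {\<alpha>..\<beta>}" using x by auto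
  have img: "uminus ` {-\<beta>..-\<alpha>} = {\<alpha>..\<beta>}" by simp
  have "(u \<circ> uminus has_real_derivative (q + integral {-x..\<beta>} h) * (- 1)) (at x within {-\<beta>..-\<alpha>})"
    by (rule DERIV_image_chain) (auto simp only: img intro!: der \<open>- x \<in> {\<alpha>..\<beta>}\<close> derivative_eq_intros)
  moreover have "integral {-\<beta>..x} (\<lambda>x. h (- x)) = integral {-x..\<beta>} h"
    using Henstock_Kurzweil_Integration.integral_reflect_real[of \<beta> "-x" h] by simp
  ultimately show ?thesis by (simp add: o_def)
qed

lemma convex_escape_left:
  fixes u h N :: "real \<Rightarrow> real"
  assumes ord: "\<alpha> < \<tau>" "\<tau> \<le> \<sigma>" "\<sigma> \<le> \<beta>" "\<beta> - \<alpha> \<le> T"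
    and der: "\<And>x. x \<in> {\<alpha>..\<beta>} \<Longrightarrow> (u has_real_derivative q + integral {x..\<beta>} h) (at x within {\<alpha>..\<beta>})"
    and hint: "h integrable_on {\<alpha>..\<beta>}"
    and q: "q \<le> 0" and s: "u \<beta> = s" "0 < s"
    and small: "\<And>x. x \<in> {\<sigma>..\<beta>} \<Longrightarrow> integral {x..\<beta>} h \<le> s / (2 * T)"
    and nonpos: "\<And>x. x \<in> {\<tau><..<\<sigma>} \<Longrightarrow> h x \<le> 0"
    and neg: "\<And>x. \<lbrakk>x \<in> {\<tau><..<\<sigma>}; s / 2 \<le> u x\<rbrakk> \<Longrightarrow> h x \<le> - (\<delta> * N x)"
    and Nint: "N integrable_on {\<tau>..\<sigma>}"
    and bd: "\<And>x. x \<in> {\<alpha>..\<tau>} \<Longrightarrow> integral {x..\<tau>} h \<le> B"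
    and large: "B + s / (2 * T) + R / (\<tau> - \<alpha>) \<le> \<delta> * integral {\<tau>..\<sigma>} N"
  shows "R < u \<alpha>"
proof -
  have refl: "integral {c..d} (\<lambda>x. f (- x)) = integral {-d..-c} f" for f :: "real \<Rightarrow> real" and c d
    using Henstock_Kurzweil_Integration.integral_reflect_real[of "-c" "-d" f] by simp
  have "R < (\<lambda>x. u (- x)) (- \<alpha>)"
  proof (rule convex_escape_right[where u="\<lambda>x. u (- x)" and R=R and \<beta>="-\<alpha>" and \<alpha>="-\<beta>" and \<tau>="-\<sigma>" and \<sigma>="-\<tau>" and h="\<lambda>x. h (- x)"
        and N="\<lambda>x. N (- x)" and p="-q" and T=T and s=s and B=B and \<delta>=\<delta>])
    show "((\<lambda>x. u (- x)) has_real_derivative - q - integral {-\<beta>..x} (\<lambda>x. h (- x))) (at x within {-\<beta>..-\<alpha>})"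
      if "x \<in> {-\<beta>..-\<alpha>}" for x using derivative_reflect[OF der that] .
    show "integral {-\<beta>..x} (\<lambda>x. h (- x)) \<le> s / (2 * T)" if "x \<in> {-\<beta>..-\<sigma>}" for x
      using small[of "-x"] that by (simp add: refl)
    show "integral {-\<tau>..x} (\<lambda>x. h (- x)) \<le> B" if "x \<in> {-\<tau>..-\<alpha>}" for x
      using bd[of "-x"] that by (simp add: refl)
  qed (use assms refl Henstock_Kurzweil_Integration.integrable_reflect_real[where f=h] Henstock_Kurzweil_Integration.integrable_reflect_real[where f=N] in auto)
  then show ?thesis by simp
qed

text \<open>With nonpositive slope at \<alpha> the concave function \<open>u\<close> stays below
  \<open>s\<close>, and, being nonnegative at \<tau>, it stays above the chord from
  \<open>(\<alpha>, s)\<close> to \<open>(\<tau>, 0)\<close>. Up to \<theta> it is thus bounded away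
  from 0, where \<open>h\<close> has enough mass to make the slope so negative that the remaining
  length \<open>\<tau> - \<theta>\<close> brings \<open>u\<close> below 0.\<close>

lemma concave_crash_right:
  fixes u h N :: "real \<Rightarrow> real"
  assumes ord: "\<alpha> < \<theta>" "\<theta> < \<tau>"
    and der: "\<And>x. x \<in> {\<alpha>..\<tau>} \<Longrightarrow> (u has_real_derivative p - integral {\<alpha>..x} h) (at x within {\<alpha>..\<tau>})"
    and hint: "h integrable_on {\<alpha>..\<tau>}" and h0: "\<And>x. x \<in> {\<alpha>..\<tau>} \<Longrightarrow> 0 \<le> h x"
    and p: "p \<le> 0" and s: "u \<alpha> = s" "0 < s" and u0: "0 \<le> u \<tau>"
    and pos: "\<And>x. \<lbrakk>x \<in> {\<alpha>..\<theta>}; s * ((\<tau> - \<theta>) / (\<tau> - \<alpha>)) \<le> u x; u x \<le> s\<rbrakk> \<Longrightarrow> \<delta> * N x \<le> h x"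
    and Nint: "N integrable_on {\<alpha>..\<theta>}"
    and large: "s < \<delta> * integral {\<alpha>..\<theta>} N * (\<tau> - \<theta>)"
  shows False
proof -
  define F where "F x = p - integral {\<alpha>..x} h" for x
  have hint': "h integrable_on {c..d}" if "\<alpha> \<le> c" "d \<le> \<tau>" for c d
    using hint that by (auto intro: integrable_on_subinterval)
  have F_anti: "F y \<le> F x" if "\<alpha> \<le> x" "x \<le> y" "y \<le> \<tau>" for x y
  proof -
    have "0 \<le> integral {x..y} h" using that h0 by (intro integral_nonneg hint') auto
    then show ?thesis using integral_split[OF hint that] by (simp add: F_def)
  qed
  have F\<alpha>: "F \<alpha> = p" by (simp add: F_def)
  have der': "(u has_real_derivative F x) (at x within {\<alpha>..\<tau>})" if "x \<in> {\<alpha>..\<tau>}" for x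
    using der[OF that] by (simp add: F_def)
  have u_le: "u x \<le> s" if "x \<in> {\<alpha>..\<tau>}" for x
  proof -
    have "u x \<le> u \<alpha> + 0 * (x - \<alpha>)"
    proof (rule increment_le[where F=F and S="{\<alpha>..\<tau>}"])
      show "F y \<le> 0" if "y \<in> {\<alpha>..x}" for y
        using F_anti[of \<alpha> y] F\<alpha> p that \<open>x \<in> {\<alpha>..\<tau>}\<close> by auto
    qed (use that der' in auto)
    with s show ?thesis by simp
  qed
  have u_ge: "s * ((\<tau> - \<theta>) / (\<tau> - \<alpha>)) \<le> u x" if x: "x \<in> {\<alpha>..\<theta>}" for x
  proof -
    have 1: "u \<alpha> + F x * (x - \<alpha>) \<le> u x"
      using x ord by (intro increment_ge[where S="{\<alpha>..\<tau>}" and F=F] der' F_anti) auto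
    have 2: "u \<tau> \<le> u x + F x * (\<tau> - x)"
      using x ord by (intro increment_le[where S="{\<alpha>..\<tau>}" and F=F] der' F_anti) auto
    \<comment> \<open>The chord inequality: weighting the two one-sided estimates by
      \<open>\<tau> - x\<close> and \<open>x - \<alpha>\<close> eliminates the unknown slope
      \<open>F x\<close>.\<close>
    have "(u \<alpha> + F x * (x - \<alpha>)) * (\<tau> - x) \<le> u x * (\<tau> - x)"
      using 1 x ord by (intro mult_right_mono) auto
    moreover have "0 \<le> (u x + F x * (\<tau> - x)) * (x - \<alpha>)"
      using 2 u0 x ord by (intro mult_nonneg_nonneg) auto
    ultimately have "s * (\<tau> - x) \<le> u x * (\<tau> - \<alpha>)"
      using s by (simp add: algebra_simps)
    moreover have "s * (\<tau> - \<theta>) \<le> s * (\<tau> - x)" using x s by (intro mult_left_mono) auto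
    ultimately show ?thesis using ord by (simp add: field_simps)
  qed
  have "integral {\<alpha>..\<theta>} (\<lambda>x. \<delta> * N x) \<le> integral {\<alpha>..\<theta>} h"
    using ord u_le u_ge by (intro integral_le hint' integrable_on_mult_right Nint pos) auto
  then have "F \<theta> \<le> - (\<delta> * integral {\<alpha>..\<theta>} N)" using p by (simp add: F_def)
  then have "F x \<le> - (\<delta> * integral {\<alpha>..\<theta>} N)" if "x \<in> {\<theta>..\<tau>}" for x
    using F_anti[of \<theta> x] that ord by auto
  then have "u \<tau> \<le> u \<theta> + (- (\<delta> * integral {\<alpha>..\<theta>} N)) * (\<tau> - \<theta>)"
    using ord by (intro increment_le[where S="{\<alpha>..\<tau>}" and F=F] der') auto
  then show False using u_le[of \<theta>] ord u0 large by auto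
qed

lemma concave_crash_left:
  fixes u h N :: "real \<Rightarrow> real"
  assumes ord: "\<sigma> < \<theta>" "\<theta> < \<beta>"
    and der: "\<And>x. x \<in> {\<sigma>..\<beta>} \<Longrightarrow> (u has_real_derivative q + integral {x..\<beta>} h) (at x within {\<sigma>..\<beta>})"
    and hint: "h integrable_on {\<sigma>..\<beta>}" and h0: "\<And>x. x \<in> {\<sigma>..\<beta>} \<Longrightarrow> 0 \<le> h x"
    and q: "0 \<le> q" and s: "u \<beta> = s" "0 < s" and u0: "0 \<le> u \<sigma>"
    and pos: "\<And>x. \<lbrakk>x \<in> {\<theta>..\<beta>}; s * ((\<theta> - \<sigma>) / (\<beta> - \<sigma>)) \<le> u x; u x \<le> s\<rbrakk> \<Longrightarrow> \<delta> * N x \<le> h x"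
    and Nint: "N integrable_on {\<theta>..\<beta>}"
    and large: "s < \<delta> * integral {\<theta>..\<beta>} N * (\<theta> - \<sigma>)"
  shows False
proof -
  have refl: "integral {c..d} (\<lambda>x. f (- x)) = integral {-d..-c} f" for f :: "real \<Rightarrow> real" and c d
    using Henstock_Kurzweil_Integration.integral_reflect_real[of "-c" "-d" f] by simp
  show False
  proof (rule concave_crash_right[where \<alpha>="-\<beta>" and \<tau>="-\<sigma>" and \<theta>="-\<theta>" and u="\<lambda>x. u (- x)"
        and h="\<lambda>x. h (- x)" and N="\<lambda>x. N (- x)" and p="-q" and s=s and \<delta>=\<delta>])
    show "((\<lambda>x. u (- x)) has_real_derivative - q - integral {-\<beta>..x} (\<lambda>x. h (- x))) (at x within {-\<beta>..-\<sigma>})"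
      if "x \<in> {-\<beta>..-\<sigma>}" for x using derivative_reflect[OF der that] .
  qed (use assms refl Henstock_Kurzweil_Integration.integrable_reflect_real[where f=h] Henstock_Kurzweil_Integration.integrable_reflect_real[where f=N] in auto)
qed

text \<open>At a negative minimum the slope is 0, and it remains 0 as long as \<open>u\<close> is
  nonpositive because \<open>h\<close> vanishes there. So \<open>u\<close> could never climb back to
  its nonnegative value at \<beta>.\<close>

lemma nonneg_of_boundary:
  fixes u h :: "real \<Rightarrow> real"
  assumes der: "\<And>x. x \<in> {\<alpha>..\<beta>} \<Longrightarrow> (u has_real_derivative p - integral {\<alpha>..x} h) (at x within {\<alpha>..\<beta>})"
    and hint: "h integrable_on {\<alpha>..\<beta>}"
    and h0: "\<And>x. \<lbrakk>x \<in> {\<alpha>..\<beta>}; u x \<le> 0\<rbrakk> \<Longrightarrow> h x = 0"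
    and bdry: "0 \<le> u \<alpha>" "0 \<le> u \<beta>" and x: "x \<in> {\<alpha>..\<beta>}"
  shows "0 \<le> u x"
proof (rule ccontr)
  assume neg: "\<not> 0 \<le> u x"
  define F where "F x = p - integral {\<alpha>..x} h" for x
  have der': "(u has_real_derivative F x) (at x within {\<alpha>..\<beta>})" if "x \<in> {\<alpha>..\<beta>}" for x
    using der[OF that] by (simp add: F_def)
  have cont: "continuous_on {\<alpha>..\<beta>} u"
    by (rule DERIV_continuous_on[of _ u F]) (rule der')
  have der_at: "(u has_real_derivative F x) (at x)" if "\<alpha> < x" "x < \<beta>" for x
    using der'[of x] at_within_interior[of x "{\<alpha>..\<beta>}"] that by simp
  obtain y where y: "y \<in> {\<alpha>..\<beta>}" and ymin: "\<And>z. z \<in> {\<alpha>..\<beta>} \<Longrightarrow> u y \<le> u z"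
    using continuous_attains_inf[OF compact_Icc _ cont] x by blast
  have uy: "u y < 0" using ymin[OF x] neg by simp
  then have y': "\<alpha> < y" "y < \<beta>" using y bdry by (auto simp: less_le)
  have "F y = 0"
    by (rule DERIV_local_min[OF der_at[OF y'], of "min (y - \<alpha>) (\<beta> - y)"]) (use y' in \<open>auto intro!: ymin\<close>)
  \<comment> \<open>The least point \<open>b\<close> of \<open>Z\<close> is the first return to
    nonnegative values after the minimum \<open>y\<close>.\<close>
  define Z where "Z = {z \<in> {y..\<beta>}. u z \<in> {0..}}"
  have "continuous_on {y..\<beta>} u" by (rule continuous_on_subset[OF cont]) (use y' in auto)
  then have "closed ({y..\<beta>} \<inter> u -` {0..})" by (rule continuous_closed_preimage) auto
  moreover have "Z = {y..\<beta>} \<inter> u -` {0..}" by (auto simp: Z_def)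
  ultimately have "compact Z" by (metis Int_lower1 compact_Icc compact_Int_closed inf.absorb_iff2)
  moreover have "\<beta> \<in> Z" using bdry y' by (simp add: Z_def)
  ultimately obtain b where b: "b \<in> Z" "\<And>z. z \<in> Z \<Longrightarrow> b \<le> z"
    using compact_attains_inf[of Z] by blast
  have yb: "y < b" using b(1) uy by (auto simp: Z_def less_le)
  have F0: "F z = 0" if z: "y < z" "z < b" for z
  proof -
    have "u w \<le> 0" if "w \<in> {y..z}" for w
      using b(2)[of w] that z b(1) by (force simp: Z_def not_le)
    then have "h w = 0" if "w \<in> {y..z}" for w
      using h0[of w] that y' z b(1) by (auto simp: Z_def)
    then have "integral {y..z} h = integral {y..z} (\<lambda>_. 0)"
      by (rule Henstock_Kurzweil_Integration.integral_cong)
    then have "integral {y..z} h = 0" by simp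
    then show ?thesis
      using integral_split[OF hint, of y z] \<open>F y = 0\<close> z y' b(1) by (auto simp: F_def Z_def)
  qed
  have "continuous_on {y..b} u"
    by (rule continuous_on_subset[OF cont]) (use y' b(1) in \<open>auto simp: Z_def\<close>)
  then obtain \<xi> where "y < \<xi>" "\<xi> < b" "u b - u y = F \<xi> * (b - y)"
    using mvt[of y b u "\<lambda>x. (*) (F x)"] yb y' b(1) der_at
    by (auto simp: has_field_derivative_def Z_def)
  then show False using F0 uy b(1) by (auto simp: Z_def)
qed

text \<open>A zero of the nonnegative \<open>U\<close> is a minimum, hence a double zero. On a step
  of length \<open>d\<close> after it, the maximum \<open>M\<close> of \<open>U\<close> satisfies
  \<open>M \<le> d * I * M\<close> with \<open>d * I < 1\<close>, so it is 0; finitely many steps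
  reach \<open>b\<close>. Propagation to the right is enough because the intended \<open>U\<close>
  is periodic.\<close>

lemma zero_propagates:
  fixes U V h K :: "real \<Rightarrow> real"
  assumes der: "\<And>x. (U has_real_derivative V x) (at x)"
    and V: "\<And>x y. x \<le> y \<Longrightarrow> V y - V x = - integral {x..y} h"
    and hint: "\<And>x y. h integrable_on {x..y}" and Kint: "K integrable_on {a..b}"
    and U0: "\<And>x. 0 \<le> U x" and K0: "\<And>x. x \<in> {a..b} \<Longrightarrow> 0 \<le> K x"
    and hK: "\<And>x. x \<in> {a..b} \<Longrightarrow> \<bar>h x\<bar> \<le> K x * U x"
    and t0: "t0 \<in> {a..b}" "U t0 = 0"
  shows "U b = 0"
proof -
  define I where "I = integral {a..b} K"
  have I0: "0 \<le> I" unfolding I_def using Kint K0 by (rule integral_nonneg)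
  define d where "d = 1 / (2 * (I + 1))"
  have d: "0 < d" "d * I < 1" using I0 by (auto simp: d_def field_simps)
  have V0: "V x = 0" if "U x = 0" for x
    by (rule DERIV_local_min[OF der zero_less_one]) (use U0 that in auto)
  have contU: "continuous_on S U" for S
    by (rule DERIV_continuous_on[of _ U V]) (rule has_field_derivative_at_within[OF der])
  have step: "U y = 0" if x: "x \<in> {a..b}" "U x = 0" and y: "x \<le> y" "y \<le> x + d" "y \<le> b" for x y
  proof -
    obtain z where z: "z \<in> {x..y}" and zmax: "\<And>w. w \<in> {x..y} \<Longrightarrow> U w \<le> U z"
      using continuous_attains_sup[of "{x..y}" U] y contU by auto
    have Vle: "V w \<le> U z * I" if w: "w \<in> {x..y}" for w
    proof -
      have sub: "{x..w} \<subseteq> {a..b}" using x y w by auto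
      have Kw: "K integrable_on {x..w}" by (rule integrable_on_subinterval[OF Kint sub])
      have "norm (integral {x..w} h) \<le> integral {x..w} (\<lambda>r. U z * K r)"
      proof (rule integral_norm_bound_integral)
        show "norm (h r) \<le> U z * K r" if r: "r \<in> {x..w}" for r
        proof -
          have "\<bar>h r\<bar> \<le> K r * U r" using hK r sub by auto
          also have "\<dots> \<le> K r * U z" using zmax[of r] K0[of r] r w sub by (intro mult_left_mono) auto
          finally show ?thesis by (simp add: mult.commute)
        qed
      qed (use hint Kw in \<open>auto intro: integrable_on_mult_right\<close>)
      also have "\<dots> = U z * integral {x..w} K" by simp
      also have "\<dots> \<le> U z * I"
        unfolding I_def using U0 K0 sub by (intro mult_left_mono integral_subset_le Kw Kint) auto
      finally show ?thesis using V[of x w] V0[OF x(2)] w by simp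
    qed
    have "U z \<le> U x + U z * I * (z - x)"
      by (rule increment_le[where S=UNIV]) (use der Vle z in auto)
    also have "U z * I * (z - x) \<le> U z * I * d"
      using z y U0 I0 by (intro mult_left_mono) auto
    finally have "U z * (1 - d * I) \<le> 0" using x by (simp add: algebra_simps)
    then have "U z \<le> 0" using d by (simp add: mult_le_0_iff)
    then show ?thesis using zmax[of y] U0[of y] y by auto
  qed
  have iter: "U (min b (t0 + real n * d)) = 0" for n
  proof (induction n)
    case 0
    then show ?case using t0 by (simp add: min_absorb2)
  next
    case (Suc n)
    have "a \<le> t0 + real n * d" using t0 d by (simp add: add_increasing2)
    then show ?case
      by (intro step[OF _ Suc]) (use t0 d in \<open>auto simp: algebra_simps min_def\<close>)
  qed
  obtain n :: nat where "(b - t0) / d \<le> real n" using real_arch_simple by blast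
  then have "b \<le> t0 + real n * d" using d by (simp add: field_simps)
  then show ?thesis using iter[of n] by (simp add: min_absorb1)
qed

section \<open>Indefinite integrals: absolute continuity, differentiation, periodic
  increments\<close>

text \<open>Cutting \<open>\<bar>h\<bar>\<close> at height \<open>n\<close> leaves a remainder
  \<open>r n\<close> whose integral is small by dominated convergence, uniformly over all families
  of disjoint intervals; the bounded part contributes at most \<open>n\<close> times the total
  length.\<close>

lemma integral_absolutely_continuous:
  fixes h F :: "real \<Rightarrow> real"
  assumes h: "h absolutely_integrable_on {a..b}"
    and F: "\<And>x y. \<lbrakk>a \<le> x; x \<le> y; y \<le> b\<rbrakk> \<Longrightarrow> \<bar>F y - F x\<bar> \<le> \<bar>integral {x..y} h\<bar>"
  shows "absolutely_continuous_on_Icc a b F"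
  unfolding absolutely_continuous_on_Icc_def
proof (intro allI impI)
  fix \<epsilon> :: real assume "0 < \<epsilon>"
  define r where "r n x = \<bar>h x\<bar> - min \<bar>h x\<bar> (real n)" for n x
  have hm: "h \<in> borel_measurable (lebesgue_on {a..b})"
    using h by (simp add: absolutely_integrable_measurable)
  have hi: "h integrable_on {a..b}" and hai: "(\<lambda>x. \<bar>h x\<bar>) integrable_on {a..b}"
    using h by (auto simp: absolutely_integrable_on_def)
  have rint: "r n absolutely_integrable_on {a..b}" for n
  proof (rule measurable_bounded_by_integrable_imp_absolutely_integrable[OF _ _ hai])
    show "r n \<in> borel_measurable (lebesgue_on {a..b})" unfolding r_def[abs_def] using hm by measurable
  qed (auto simp: r_def)
  have "(\<lambda>n. integral {a..b} (r n)) \<longlonglongrightarrow> integral {a..b} (\<lambda>_. 0)"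
  proof (rule dominated_convergence[OF _ hai])
    show "r n integrable_on {a..b}" for n using rint by (auto simp: absolutely_integrable_on_def)
    show "(\<lambda>n. r n x) \<longlonglongrightarrow> 0" for x
    proof (rule tendsto_eventually)
      obtain N :: nat where "\<bar>h x\<bar> \<le> real N" using real_arch_simple by blast
      then show "\<forall>\<^sub>F n in sequentially. r n x = 0"
        unfolding r_def by (intro eventually_sequentiallyI[of N]) auto
    qed
  qed (auto simp: r_def)
  then have "\<forall>\<^sub>F n in sequentially. integral {a..b} (r n) < \<epsilon> / 2"
    using \<open>0 < \<epsilon>\<close> by (intro order_tendstoD) auto
  then obtain n where n: "integral {a..b} (r n) < \<epsilon> / 2" by (auto simp: eventually_sequentially)
  show "\<exists>\<delta>>0. \<forall>(m::nat) p q. (\<forall>k<m. a \<le> p k \<and> p k \<le> q k \<and> q k \<le> b) \<longrightarrow>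
      disjoint_family_on (\<lambda>k. {p k<..<q k}) {..<m} \<longrightarrow> (\<Sum>k<m. q k - p k) < \<delta> \<longrightarrow>
      (\<Sum>k<m. \<bar>F (q k) - F (p k)\<bar>) < \<epsilon>"
  proof (intro exI[of _ "\<epsilon> / (2 * (real n + 1))"] conjI allI impI)
    fix m :: nat and p q
    assume pq: "\<forall>k<m. a \<le> p k \<and> p k \<le> q k \<and> q k \<le> b"
      and disj: "disjoint_family_on (\<lambda>k. {p k<..<q k}) {..<m}"
      and sum: "(\<Sum>k<m. q k - p k) < \<epsilon> / (2 * (real n + 1))"
    define ind where "ind k x = (indicator {p k<..<q k} x :: real)" for k x
    have rsub: "r n integrable_on {c..d}" if "a \<le> c" "d \<le> b" for c d
      using rint[of n] that by (auto simp: absolutely_integrable_on_def intro: integrable_on_subinterval)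
    have hsub: "h integrable_on {c..d}" if "a \<le> c" "d \<le> b" for c d
      using hi that by (auto intro: integrable_on_subinterval)
    \<comment> \<open>Disjointness is given for the open intervals only, hence open indicators; the
      two end points are a negligible change.\<close>
    have indint: "((\<lambda>x. r n x * ind k x) has_integral integral {p k..q k} (r n)) {a..b}" if "k < m" for k
    proof -
      have "(r n has_integral integral {p k..q k} (r n)) {p k..q k}"
        using pq that rsub by (intro integrable_integral) auto
      then have "((\<lambda>x. r n x * ind k x) has_integral integral {p k..q k} (r n)) {p k..q k}"
        by (rule has_integral_spike[where S="{p k, q k}", rotated 2]) (auto simp: ind_def)
      then show ?thesis
        by (rule has_integral_on_superset) (use pq that in \<open>auto simp: ind_def\<close>)
    qed
    have "(\<Sum>k<m. \<bar>F (q k) - F (p k)\<bar>) \<le> (\<Sum>k<m. integral {p k..q k} (r n) + real n * (q k - p k))"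
    proof (rule sum_mono)
      fix k assume "k \<in> {..<m}"
      then have k: "a \<le> p k" "p k \<le> q k" "q k \<le> b" using pq by auto
      have "norm (integral {p k..q k} h) \<le> integral {p k..q k} (\<lambda>x. r n x + real n)"
        using k by (intro integral_norm_bound_integral hsub integrable_add rsub) (auto simp: r_def)
      also have "\<dots> = integral {p k..q k} (r n) + real n * (q k - p k)"
        using k by (subst Henstock_Kurzweil_Integration.integral_add) (auto intro!: rsub)
      finally show "\<bar>F (q k) - F (p k)\<bar> \<le> integral {p k..q k} (r n) + real n * (q k - p k)"
        using F[OF k] by simp
    qed
    also have "\<dots> = (\<Sum>k<m. integral {p k..q k} (r n)) + real n * (\<Sum>k<m. q k - p k)"
      by (simp add: sum.distrib sum_distrib_left)
    also have "(\<Sum>k<m. integral {p k..q k} (r n)) \<le> integral {a..b} (r n)"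
    proof (rule has_integral_le)
      show "((\<lambda>x. \<Sum>k<m. r n x * ind k x) has_integral (\<Sum>k<m. integral {p k..q k} (r n))) {a..b}"
        using indint by (intro has_integral_sum) auto
      show "(r n has_integral integral {a..b} (r n)) {a..b}"
        by (intro integrable_integral rsub) auto
      fix x
      have "(\<Sum>k<m. ind k x) = indicator (\<Union>k<m. {p k<..<q k}) x"
        unfolding ind_def using disj by (intro indicator_UN_disjoint[symmetric]) auto
      also have "\<dots> \<le> 1" by (simp add: indicator_def)
      finally have "r n x * (\<Sum>k<m. ind k x) \<le> r n x * 1"
        by (intro mult_left_mono) (auto simp: r_def)
      then show "(\<Sum>k<m. r n x * ind k x) \<le> r n x" by (simp add: sum_distrib_left)
    qed
    also have "real n * (\<Sum>k<m. q k - p k) \<le> (real n + 1) * (\<Sum>k<m. q k - p k)"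
      using pq by (intro mult_right_mono sum_nonneg) auto
    also have "(real n + 1) * (\<Sum>k<m. q k - p k) < \<epsilon> / 2"
      using sum by (simp add: field_simps)
    finally show "(\<Sum>k<m. \<bar>F (q k) - F (p k)\<bar>) < \<epsilon>" using n by simp
  qed (use \<open>0 < \<epsilon>\<close> in auto)
qed

text \<open>Lebesgue differentiation over the cubes \<open>[x, x + k]\<close> controls only right
  difference quotients. Applied to the reflected function it controls the left ones as well, off the
  reflected exceptional set.\<close>

lemma AE_derivative_of_integral:
  fixes h V :: "real \<Rightarrow> real"
  assumes hint: "\<And>x y. h integrable_on {x..y}"
    and V: "\<And>x y. x \<le> y \<Longrightarrow> V y - V x = integral {x..y} h"
  shows "AE t in lebesgue. (V has_real_derivative h t) (at t)"
proof -
  obtain N where N: "negligible N" and right: "\<And>x e. \<lbrakk>x \<notin> N; 0 < e\<rbrakk> \<Longrightarrow>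
      \<exists>d>0. \<forall>k. 0 < k \<and> k < d \<longrightarrow> norm (integral (cbox x (x + k *\<^sub>R One)) h /\<^sub>R k ^ DIM(real) - h x) < e"
    using integrable_ccontinuous_explicit[where f=h] hint by auto
  have hr: "(\<lambda>x. h (- x)) integrable_on cbox a b" for a b :: real
    using Henstock_Kurzweil_Integration.integrable_reflect_real[where f=h and a="-b" and b="-a"] hint by simp
  obtain N' where N': "negligible N'" and left: "\<And>x e. \<lbrakk>x \<notin> N'; 0 < e\<rbrakk> \<Longrightarrow>
      \<exists>d>0. \<forall>k. 0 < k \<and> k < d \<longrightarrow>
        norm (integral (cbox x (x + k *\<^sub>R One)) (\<lambda>x. h (- x)) /\<^sub>R k ^ DIM(real) - h (- x)) < e"
    using integrable_ccontinuous_explicit[where f="\<lambda>x. h (- x)", OF hr] by blast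
  have "negligible (uminus ` N')"
    by (rule negligible_differentiable_image_negligible[OF order_refl N'])
      (auto intro!: derivative_intros simp: differentiable_on_def)
  have "(V has_real_derivative h t) (at t)" if t: "t \<notin> N \<union> uminus ` N'" for t
  proof -
    have t': "t \<notin> N" "- t \<notin> N'" using t by (auto simp: image_iff)
    have "(\<lambda>k. (V (t + k) - V t) / k) \<midarrow>0\<rightarrow> h t"
    proof (rule LIM_I)
      fix e :: real assume "0 < e"
      obtain d1 where d1: "0 < d1" "\<And>k. 0 < k \<Longrightarrow> k < d1 \<Longrightarrow> \<bar>integral {t..t + k} h / k - h t\<bar> < e"
        using right[OF t'(1) \<open>0 < e\<close>] by (auto simp: divide_inverse mult.commute)
      obtain d2 where d2: "0 < d2"
        "\<And>k. 0 < k \<Longrightarrow> k < d2 \<Longrightarrow> \<bar>integral {-t..-t + k} (\<lambda>x. h (- x)) / k - h t\<bar> < e"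
        using left[OF t'(2) \<open>0 < e\<close>] by (auto simp: divide_inverse mult.commute)
      show "\<exists>d>0. \<forall>k. k \<noteq> 0 \<and> norm (k - 0) < d \<longrightarrow> norm ((V (t + k) - V t) / k - h t) < e"
      proof (intro exI[of _ "min d1 d2"] conjI allI impI)
        fix k :: real assume k: "k \<noteq> 0 \<and> norm (k - 0) < min d1 d2"
        show "norm ((V (t + k) - V t) / k - h t) < e"
        proof (cases "0 < k")
          case True
          then show ?thesis using d1(2)[of k] V[of t "t + k"] k by simp
        next
          case False
          then have "0 < - k" "- k < d2" using k by auto
          moreover have "integral {-t..-t + (- k)} (\<lambda>x. h (- x)) = integral {t + k..t} h"
            using Henstock_Kurzweil_Integration.integral_reflect_real[of t "t + k" h] by (simp add: add.commute)
          ultimately have "\<bar>integral {t + k..t} h / (- k) - h t\<bar> < e" using d2(2)[of "-k"] by simp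
          moreover have "V (t + k) - V t = - integral {t + k..t} h"
            using V[of "t + k" t] False by simp
          ultimately show ?thesis by simp
        qed
      qed (use d1(1) d2(1) in auto)
    qed
    then show ?thesis by (simp add: DERIV_def)
  qed
  moreover have "N \<union> uminus ` N' \<in> null_sets lebesgue"
    using negligible_Un[OF N \<open>negligible (uminus ` N')\<close>] unfolding negligible_iff_null_sets .
  ultimately show ?thesis by (intro AE_I'[of "N \<union> uminus ` N'"]) auto
qed

text \<open>The formula is extended from one period to \<open>n\<close> consecutive periods starting
  at \<alpha> by induction; an arbitrary interval is then moved to the right of \<alpha> by a
  multiple of \<open>T\<close>, so only natural multiples occur.\<close>

lemma increments_of_periodic:
  fixes f F :: "real \<Rightarrow> real"
  assumes T: "0 < T" and per: "\<And>x. f (x + T) = f x" "\<And>x. F (x + T) = F x"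
    and fint: "f absolutely_integrable_on {\<alpha>..\<alpha> + T}"
    and inc: "\<And>x y. \<lbrakk>\<alpha> \<le> x; x \<le> y; y \<le> \<alpha> + T\<rbrakk> \<Longrightarrow> F y - F x = integral {x..y} f"
  shows "f absolutely_integrable_on {x..y}" and "x \<le> y \<Longrightarrow> F y - F x = integral {x..y} f"
proof -
  have shift: "f (x + real n * T) = f x" "F (x + real n * T) = F x" for x n
  proof (induction n)
    case (Suc n)
    have "x + real (Suc n) * T = (x + real n * T) + T" by (simp add: algebra_simps)
    then show "f (x + real (Suc n) * T) = f x" "F (x + real (Suc n) * T) = F x"
      using Suc per by metis+
  qed simp_all
  have comp: "f \<circ> (+) (real n * T) = f" for n
    using shift(1) by (auto simp: add.commute)
  have int_iff: "f absolutely_integrable_on {c..d} \<longleftrightarrow> f absolutely_integrable_on {c + real n * T..d + real n * T}"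
    for c d n
  proof -
    have "(\<lambda>x. norm (f x)) \<circ> (+) (real n * T) = (\<lambda>x. norm (f x))"
      using comp[of n] by (auto simp: fun_eq_iff)
    then show ?thesis
      unfolding absolutely_integrable_on_def
      using integrable_on_shift_Icc_real[of f "real n * T" c d]
        integrable_on_shift_Icc_real[of "\<lambda>x. norm (f x)" "real n * T" c d] comp[of n] by simp
  qed
  have int_eq: "integral {c..d} f = integral {c + real n * T..d + real n * T} f" for c d n
    using integral_shift_Icc_real[of c d f "real n * T"] comp[of n] by simp
  have main: "f absolutely_integrable_on {\<alpha>..\<alpha> + real n * T} \<and>
      (\<forall>x y. \<alpha> \<le> x \<longrightarrow> x \<le> y \<longrightarrow> y \<le> \<alpha> + real n * T \<longrightarrow> F y - F x = integral {x..y} f)" for n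
  proof (induction n)
    case 0
    show ?case
    proof (intro conjI allI impI)
      show "f absolutely_integrable_on {\<alpha>..\<alpha> + real 0 * T}"
        using integrable_on_refl[where f=f and a=\<alpha>] integrable_on_refl[where f="\<lambda>x. \<bar>f x\<bar>" and a=\<alpha>]
        by (simp add: absolutely_integrable_on_def)
      fix x y assume "\<alpha> \<le> x" "x \<le> y" "y \<le> \<alpha> + real 0 * T"
      then have "x = y" by simp
      then show "F y - F x = integral {x..y} f" by simp
    qed
  next
    case (Suc n)
    let ?c = "\<alpha> + real n * T"
    have end_eq: "\<alpha> + real (Suc n) * T = ?c + T" by (simp add: algebra_simps)
    have c: "\<alpha> \<le> ?c" using T by simp
    have last: "f absolutely_integrable_on {?c..?c + T}"
      using fint int_iff[of \<alpha> "\<alpha> + T" n] by (simp add: algebra_simps)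
    have ai: "f absolutely_integrable_on {\<alpha>..?c + T}"
      by (rule absolutely_integrable_on_combine[where c="?c"]) (use Suc last T c in auto)
    have inc_last: "F y - F x = integral {x..y} f" if "?c \<le> x" "x \<le> y" "y \<le> ?c + T" for x y
      using inc[of "x - real n * T" "y - real n * T"] shift(2)[of "x - real n * T" n]
        shift(2)[of "y - real n * T" n] int_eq[of "x - real n * T" "y - real n * T" n] that by simp
    have "F y - F x = integral {x..y} f" if xy: "\<alpha> \<le> x" "x \<le> y" "y \<le> ?c + T" for x y
    proof (cases "?c \<le> x \<or> y \<le> ?c")
      case False
      have "f integrable_on {\<alpha>..?c + T}" using ai by (simp add: absolutely_integrable_on_def)
      then have "f integrable_on {x..y}" by (rule integrable_on_subinterval) (use xy in auto)
      then have "integral {x..y} f = integral {x..?c} f + integral {?c..y} f"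
        using False by (intro integral_split) auto
      moreover have "F ?c - F x = integral {x..?c} f" using Suc False xy by auto
      moreover have "F y - F ?c = integral {?c..y} f" using inc_last False xy by auto
      ultimately show ?thesis by simp
    qed (use Suc inc_last xy in auto)
    with ai show ?case unfolding end_eq by blast
  qed
  obtain k :: nat where "(\<alpha> - x) / T \<le> real k" using real_arch_simple by blast
  then have k: "\<alpha> \<le> x + real k * T" using T by (simp add: field_simps)
  obtain n :: nat where "(y + real k * T - \<alpha>) / T \<le> real n" using real_arch_simple by blast
  then have n: "y + real k * T \<le> \<alpha> + real n * T" using T by (simp add: field_simps)
  have "f absolutely_integrable_on {x + real k * T..y + real k * T}"
    by (rule absolutely_integrable_on_subinterval[OF conjunct1[OF main[of n]]]) (use k n in auto)
  then show "f absolutely_integrable_on {x..y}" using int_iff by blast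
  show "F y - F x = integral {x..y} f" if "x \<le> y"
  proof -
    have "F (y + real k * T) - F (x + real k * T) = integral {x + real k * T..y + real k * T} f"
      using main[of n] k n that by simp
    then show ?thesis using shift(2)[of x k] shift(2)[of y k] int_eq[of x y k] by simp
  qed
qed

section \<open>A priori estimates in lobes and gaps\<close>

text \<open>The point where the primitive reaches half of its final value. It supplies the nodes
  inside the lobes and the points \<theta> of the crash estimates.\<close>

lemma integral_pos_split:
  fixes f :: "real \<Rightarrow> real"
  assumes "f integrable_on {c..d}" "c < d" "0 < integral {c..d} f"
  obtains x where "c < x" "x < d" "0 < integral {c..x} f" "0 < integral {x..d} f"
proof -
  let ?F = "\<lambda>x. integral {c..x} f"
  have "continuous_on {c..d} ?F" by (rule indefinite_integral_continuous_1[OF assms(1)])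
  then obtain x where x: "c \<le> x" "x \<le> d" "?F x = ?F d / 2"
    using IVT'[of ?F c "?F d / 2" d] assms by auto
  have "x \<noteq> c" "x \<noteq> d" using x(3) assms(3) by auto
  moreover have "?F d = ?F x + integral {x..d} f"
    using integral_split[OF assms(1), of x d] x by simp
  ultimately show ?thesis using that[of x] x assms(3) by auto
qed

text \<open>The period is cut at the nodes \<open>t j\<close> inside the lobes, not at lobe ends:
  piece \<open>j\<close> consists of the right part \<open>[t j, \<tau> j]\<close> of one lobe, a
  gap, and the left part \<open>[\<sigma> (Suc j), t (Suc j)]\<close> of the next. Both parts carry
  positive mass, so the crash argument can be run on either side of a node. Indices start at
  0.\<close>

locale partitioned_weight =
  fixes g ap an :: "real \<Rightarrow> real" and T :: real and m :: nat and \<sigma> \<tau> t :: "nat \<Rightarrow> real"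
  assumes g_nonneg: "\<And>s. 0 \<le> s \<Longrightarrow> 0 \<le> g s"
    and g_cont: "continuous_on {0..} g"
    and g_zero: "g 0 = 0"
    and g_pos: "\<And>s. 0 < s \<Longrightarrow> 0 < g s"
    and g_lim_0: "((\<lambda>s. g s / s) \<longlongrightarrow> 0) (at_right 0)"
    and g_lim_inf: "((\<lambda>s. g s / s) \<longlongrightarrow> 0) at_top"
    and ap_nonneg: "\<And>x. 0 \<le> ap x" and an_nonneg: "\<And>x. 0 \<le> an x"
    and ap_int: "\<And>x y. ap absolutely_integrable_on {x..y}"
    and an_int: "\<And>x y. an absolutely_integrable_on {x..y}"
    and m_pos: "0 < m"
    and ord: "\<And>j. j < m \<Longrightarrow> t j < \<tau> j \<and> \<tau> j < \<sigma> (Suc j) \<and> \<sigma> (Suc j) < t (Suc j)"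
    and t_m: "t m = t 0 + T"
    and ap_right: "\<And>j. j < m \<Longrightarrow> 0 < integral {t j..\<tau> j} ap"
    and ap_left: "\<And>j. j < m \<Longrightarrow> 0 < integral {\<sigma> (Suc j)..t (Suc j)} ap"
    and an_mid: "\<And>j. j < m \<Longrightarrow> 0 < integral {\<tau> j..\<sigma> (Suc j)} an"
begin

lemma ap_integrable: "ap integrable_on {x..y}" and an_integrable: "an integrable_on {x..y}"
  using ap_int[of x y] an_int[of x y] by (auto simp: absolutely_integrable_on_def)

lemma t_step: "j < m \<Longrightarrow> t j < t (Suc j)"
  using ord[of j] by linarith

lemma t_mono: "i \<le> j \<Longrightarrow> j \<le> m \<Longrightarrow> t i \<le> t j"
proof (induction j)
  case (Suc j)
  then show ?case using t_step[of j] by (cases "i = Suc j") auto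
qed simp

lemma t_in: "j \<le> m \<Longrightarrow> t j \<in> {t 0..t m}"
  using t_mono[of 0 j] t_mono[of j m] by simp

lemma piece_subset: "j < m \<Longrightarrow> {t j..t (Suc j)} \<subseteq> {t 0..t m}"
  using t_in[of j] t_in[of "Suc j"] by auto

lemma T_pos: "0 < T"
  using t_step[OF m_pos] t_in[of "Suc 0"] m_pos t_m by auto

text \<open>Extension by 0 to negative arguments, so that the problem can be solved before
  nonnegativity is known and \<open>nonneg_of_boundary\<close> then yields it.\<close>

definition gx :: "real \<Rightarrow> real" where "gx z = g (max 0 z)"

lemma gx_nonneg: "0 \<le> gx z" and gx_zero: "z \<le> 0 \<Longrightarrow> gx z = 0" and gx_eq: "0 \<le> z \<Longrightarrow> gx z = g z"
  by (simp_all add: gx_def g_nonneg g_zero max_def)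

lemma gx_cont: "continuous_on UNIV gx"
  unfolding gx_def by (rule continuous_on_compose2[OF g_cont]) (auto intro!: continuous_intros)

lemma gx_bounded_above: "\<exists>G\<ge>0. \<forall>z\<le>K. gx z \<le> G"
proof -
  have "continuous_on {0..max 0 K} g" by (rule continuous_on_subset[OF g_cont]) auto
  then obtain y where y: "y \<in> {0..max 0 K}" "\<And>z. z \<in> {0..max 0 K} \<Longrightarrow> g z \<le> g y"
    using continuous_attains_sup[of "{0..max 0 K}" g] by auto
  then show ?thesis
    by (intro exI[of _ "g y"]) (auto simp: gx_def g_nonneg)
qed

lemma g_bounded_below:
  assumes "0 < a"
  shows "\<exists>\<delta>>0. \<forall>z\<in>{a..K}. \<delta> \<le> g z"
proof (cases "a \<le> K")
  case True
  have "continuous_on {a..K} g" by (rule continuous_on_subset[OF g_cont]) (use assms in auto)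
  then obtain y where "y \<in> {a..K}" "\<And>z. z \<in> {a..K} \<Longrightarrow> g y \<le> g z"
    using continuous_attains_inf[of "{a..K}" g] True by auto
  then show ?thesis using assms by (intro exI[of _ "g y"]) (auto intro: g_pos)
qed (auto intro: exI[of _ 1])

definition A where "A = integral {t 0..t m} ap"

lemma A_nonneg: "0 \<le> A"
  unfolding A_def by (intro integral_nonneg ap_integrable ap_nonneg)

lemma integral_ap_le:
  assumes "\<And>z. z \<in> {x..y} \<Longrightarrow> h z = l * ap z * gx (min (u z) K)" "h integrable_on {x..y}"
    and "{x..y} \<subseteq> {t 0..t m}" "0 \<le> l" and G: "0 \<le> G" "\<And>z. z \<le> K \<Longrightarrow> gx z \<le> G"
  shows "integral {x..y} h \<le> l * G * A"
proof -
  have "integral {x..y} h \<le> integral {x..y} (\<lambda>z. (l * G) * ap z)"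
  proof (rule integral_le)
    fix z assume "z \<in> {x..y}"
    then have "h z = (l * ap z) * gx (min (u z) K)" using assms by simp
    also have "\<dots> \<le> (l * ap z) * G" using assms(4) ap_nonneg[of z] by (intro mult_left_mono G) auto
    finally show "h z \<le> (l * G) * ap z" by (simp add: mult_ac)
  qed (use assms ap_integrable in \<open>auto intro: integrable_on_mult_right\<close>)
  also have "\<dots> = (l * G) * integral {x..y} ap" by simp
  also have "\<dots> \<le> (l * G) * A"
    unfolding A_def using assms
    by (intro mult_left_mono integral_subset_le ap_integrable) (auto simp: ap_nonneg)
  finally show ?thesis .
qed

text \<open>If the slope at the node were nonpositive, \<open>u\<close> would stay below
  \<open>s \<le> C * s\<close>, so the cap does not act. The split point, the chord height
  \<open>c\<close> and the minimum \<delta> of \<open>g\<close> on \<open>[c, s]\<close> depend on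
  the lobe and on \<open>s\<close> only, which makes the threshold for \<open>l\<close> uniform in
  \<open>u\<close>, \<open>p\<close> and \<open>h\<close>.\<close>

lemma crash_right:
  assumes j: "j < m" and s: "0 < s" and C: "1 \<le> C"
  shows "\<forall>\<^sub>F l in at_top. \<forall>u p h. h integrable_on {t j..\<tau> j} \<longrightarrow>
    (\<forall>x\<in>{t j..\<tau> j}. (u has_real_derivative p - integral {t j..x} h) (at x within {t j..\<tau> j})) \<longrightarrow>
    (\<forall>x\<in>{t j..\<tau> j}. h x = l * ap x * gx (min (u x) (C * s))) \<longrightarrow>
    u (t j) = s \<longrightarrow> 0 \<le> u (\<tau> j) \<longrightarrow> 0 < p"
proof -
  obtain \<theta> where \<theta>: "t j < \<theta>" "\<theta> < \<tau> j" "0 < integral {t j..\<theta>} ap"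
    using integral_pos_split[OF ap_integrable _ ap_right[OF j]] ord[OF j] by blast
  define c where "c = s * ((\<tau> j - \<theta>) / (\<tau> j - t j))"
  have c: "0 < c" using \<theta> s by (simp add: c_def)
  obtain \<delta> where \<delta>: "0 < \<delta>" "\<And>z. z \<in> {c..s} \<Longrightarrow> \<delta> \<le> g z"
    using g_bounded_below[OF c] by blast
  let ?k = "\<delta> * integral {t j..\<theta>} ap * (\<tau> j - \<theta>)"
  have k: "0 < ?k" using \<theta> \<delta> by simp
  show ?thesis
  proof (rule eventually_at_top_linorderI[of "max 1 (s / ?k + 1)"], intro allI impI)
    fix l u p h
    assume l: "max 1 (s / ?k + 1) \<le> l" and hint: "h integrable_on {t j..\<tau> j}"
      and der: "\<forall>x\<in>{t j..\<tau> j}. (u has_real_derivative p - integral {t j..x} h) (at x within {t j..\<tau> j})"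
      and h: "\<forall>x\<in>{t j..\<tau> j}. h x = l * ap x * gx (min (u x) (C * s))"
      and u: "u (t j) = s" "0 \<le> u (\<tau> j)"
    show "0 < p"
    proof (rule ccontr)
      assume "\<not> 0 < p"
      show False
      proof (rule concave_crash_right[where \<alpha>="t j" and \<theta>=\<theta> and \<tau>="\<tau> j" and u=u and p=p and h=h
            and s=s and \<delta>="l * \<delta>" and N=ap])
        show "0 \<le> h x" if "x \<in> {t j..\<tau> j}" for x
          using h that l by (simp add: ap_nonneg gx_nonneg)
        show "l * \<delta> * ap x \<le> h x"
          if x: "x \<in> {t j..\<theta>}" "s * ((\<tau> j - \<theta>) / (\<tau> j - t j)) \<le> u x" "u x \<le> s" for x
        proof -
          have "u x \<le> C * s" using x(3) s C by (smt (verit) mult_le_cancel_right1)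
          then have "gx (min (u x) (C * s)) = g (u x)" using x c by (simp add: gx_eq c_def)
          moreover have "\<delta> \<le> g (u x)" using x by (intro \<delta>) (auto simp: c_def)
          moreover have "h x = l * ap x * gx (min (u x) (C * s))" using h x \<theta> by auto
          ultimately show ?thesis
            using l mult_left_mono[of \<delta> "g (u x)" "l * ap x"] ap_nonneg[of x] by (simp add: mult_ac)
        qed
        have "s / ?k < l" using l by linarith
        then have "s < l * ?k" using k by (simp only: pos_divide_less_eq)
        then show "s < l * \<delta> * integral {t j..\<theta>} ap * (\<tau> j - \<theta>)" by (simp add: mult_ac)
      qed (use \<theta> der hint u s \<open>\<not> 0 < p\<close> ap_integrable in auto)
    qed
  qed
qed

lemma crash_left:
  assumes j: "j < m" and s: "0 < s" and C: "1 \<le> C"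
  shows "\<forall>\<^sub>F l in at_top. \<forall>u q h. h integrable_on {\<sigma> (Suc j)..t (Suc j)} \<longrightarrow>
    (\<forall>x\<in>{\<sigma> (Suc j)..t (Suc j)}.
      (u has_real_derivative q + integral {x..t (Suc j)} h) (at x within {\<sigma> (Suc j)..t (Suc j)})) \<longrightarrow>
    (\<forall>x\<in>{\<sigma> (Suc j)..t (Suc j)}. h x = l * ap x * gx (min (u x) (C * s))) \<longrightarrow>
    u (t (Suc j)) = s \<longrightarrow> 0 \<le> u (\<sigma> (Suc j)) \<longrightarrow> q < 0"
proof -
  let ?\<sigma> = "\<sigma> (Suc j)" and ?\<beta> = "t (Suc j)"
  obtain \<theta> where \<theta>: "?\<sigma> < \<theta>" "\<theta> < ?\<beta>" "0 < integral {\<theta>..?\<beta>} ap"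
    using integral_pos_split[OF ap_integrable _ ap_left[OF j]] ord[OF j] by blast
  define c where "c = s * ((\<theta> - ?\<sigma>) / (?\<beta> - ?\<sigma>))"
  have c: "0 < c" using \<theta> s by (simp add: c_def)
  obtain \<delta> where \<delta>: "0 < \<delta>" "\<And>z. z \<in> {c..s} \<Longrightarrow> \<delta> \<le> g z"
    using g_bounded_below[OF c] by blast
  let ?k = "\<delta> * integral {\<theta>..?\<beta>} ap * (\<theta> - ?\<sigma>)"
  have k: "0 < ?k" using \<theta> \<delta> by simp
  show ?thesis
  proof (rule eventually_at_top_linorderI[of "max 1 (s / ?k + 1)"], intro allI impI)
    fix l u q h
    assume l: "max 1 (s / ?k + 1) \<le> l" and hint: "h integrable_on {?\<sigma>..?\<beta>}"
      and der: "\<forall>x\<in>{?\<sigma>..?\<beta>}. (u has_real_derivative q + integral {x..?\<beta>} h) (at x within {?\<sigma>..?\<beta>})"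
      and h: "\<forall>x\<in>{?\<sigma>..?\<beta>}. h x = l * ap x * gx (min (u x) (C * s))"
      and u: "u ?\<beta> = s" "0 \<le> u ?\<sigma>"
    show "q < 0"
    proof (rule ccontr)
      assume "\<not> q < 0"
      show False
      proof (rule concave_crash_left[where \<sigma>="?\<sigma>" and \<theta>=\<theta> and \<beta>="?\<beta>" and u=u and q=q and h=h
            and s=s and \<delta>="l * \<delta>" and N=ap])
        show "0 \<le> h x" if "x \<in> {?\<sigma>..?\<beta>}" for x
          using h that l by (simp add: ap_nonneg gx_nonneg)
        show "l * \<delta> * ap x \<le> h x"
          if x: "x \<in> {\<theta>..?\<beta>}" "s * ((\<theta> - ?\<sigma>) / (?\<beta> - ?\<sigma>)) \<le> u x" "u x \<le> s" for x
        proof -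
          have "u x \<le> C * s" using x(3) s C by (smt (verit) mult_le_cancel_right1)
          then have "gx (min (u x) (C * s)) = g (u x)" using x c by (simp add: gx_eq c_def)
          moreover have "\<delta> \<le> g (u x)" using x by (intro \<delta>) (auto simp: c_def)
          moreover have "h x = l * ap x * gx (min (u x) (C * s))" using h x \<theta> by auto
          ultimately show ?thesis
            using l mult_left_mono[of \<delta> "g (u x)" "l * ap x"] ap_nonneg[of x] by (simp add: mult_ac)
        qed
        have "s / ?k < l" using l by linarith
        then have "s < l * ?k" using k by (simp only: pos_divide_less_eq)
        then show "s < l * \<delta> * integral {\<theta>..?\<beta>} ap * (\<theta> - ?\<sigma>)" by (simp add: mult_ac)
      qed (use \<theta> der hint u s \<open>\<not> q < 0\<close> ap_integrable in auto)
    qed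
  qed
qed

text \<open>A solution of the truncated equation on one piece, with \<open>h\<close> standing for
  \<open>- u''\<close>, \<open>p\<close> for the slope at the left node, and a separate cap in each
  of its three parts. The caps differ because each lobe is truncated in proportion to its own nodal
  value.\<close>

definition piece ::
    "real \<Rightarrow> real \<Rightarrow> nat \<Rightarrow> real \<Rightarrow> real \<Rightarrow> real \<Rightarrow> (real \<Rightarrow> real) \<Rightarrow> real \<Rightarrow> (real \<Rightarrow> real) \<Rightarrow> bool"
  where "piece l \<mu> j K1 K2 K3 u p h \<longleftrightarrow> h integrable_on {t j..t (Suc j)} \<and>
    (\<forall>x\<in>{t j..t (Suc j)}. (u has_real_derivative p - integral {t j..x} h) (at x within {t j..t (Suc j)})) \<and>
    (\<forall>x\<in>{t j..\<tau> j}. h x = l * ap x * gx (min (u x) K1)) \<and>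
    (\<forall>x\<in>{\<tau> j<..<\<sigma> (Suc j)}. h x = - (\<mu> * an x * gx (min (u x) K2))) \<and>
    (\<forall>x\<in>{\<sigma> (Suc j)..t (Suc j)}. h x = l * ap x * gx (min (u x) K3))"

lemma piece_derivative_end:
  assumes "piece l \<mu> j K1 K2 K3 u p h" "x \<in> {t j..t (Suc j)}"
  shows "(u has_real_derivative (p - integral {t j..t (Suc j)} h) + integral {x..t (Suc j)} h)
    (at x within {t j..t (Suc j)})"
proof -
  have "integral {t j..t (Suc j)} h = integral {t j..x} h + integral {x..t (Suc j)} h"
    using assms by (intro integral_split[of h "t j" "t (Suc j)"]) (auto simp: piece_def)
  then show ?thesis using assms by (auto simp: piece_def)
qed

text \<open>Convex escape in contrapositive form, read from the left node and from the right node.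
  The cap \<open>K\<close> of the far lobe depends on the unknown neighbouring nodal value and is
  therefore quantified after \<mu>; the bound \<open>G\<close> of \<open>gx\<close> up to
  \<open>K2\<close> serves for all of them. In the near lobe the sharper bound \<open>G1\<close>
  keeps the loss of slope below \<open>s / (2 * T)\<close>.\<close>

lemma escape:
  assumes j: "j < m" and s: "0 < s" "s \<le> K2" and l: "0 < l" and K1: "0 \<le> K1" "K1 \<le> K2"
    and G1: "\<And>y. y \<in> {0..K1} \<Longrightarrow> g y \<le> G1" "l * G1 * A \<le> s / (2 * T)"
  shows "\<forall>\<^sub>F \<mu> in at_top. \<forall>u p h K. K \<le> K2 \<longrightarrow>
    (piece l \<mu> j K1 K2 K u p h \<longrightarrow> u (t j) = s \<longrightarrow> u (t (Suc j)) \<le> R \<longrightarrow> p < 0) \<and>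
    (piece l \<mu> j K K2 K1 u p h \<longrightarrow> u (t (Suc j)) = s \<longrightarrow> u (t j) \<le> R \<longrightarrow>
      0 < p - integral {t j..t (Suc j)} h)"
proof -
  let ?\<alpha> = "t j" and ?\<beta> = "t (Suc j)" and ?\<tau> = "\<tau> j" and ?\<sigma> = "\<sigma> (Suc j)"
  note o = ord[OF j]
  obtain \<delta> where \<delta>: "0 < \<delta>" "\<And>z. z \<in> {s / 2..K2} \<Longrightarrow> \<delta> \<le> g z"
    using g_bounded_below[of "s / 2" K2] s by auto
  obtain G where G: "0 \<le> G" "\<And>z. z \<le> K2 \<Longrightarrow> gx z \<le> G" using gx_bounded_above by blast
  have G1_nonneg: "0 \<le> G1" using G1(1)[of 0] K1 by (simp add: g_zero)
  have G1': "gx z \<le> G1" if "z \<le> K1" for z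
    using G1(1)[of "max 0 z"] K1 that by (simp add: gx_def)
  define I where "I = integral {?\<tau>..?\<sigma>} an"
  have I: "0 < I" using an_mid[OF j] by (simp add: I_def)
  \<comment> \<open>One threshold for both directions; the absolute values make the summands
    nonnegative, so \<open>Q\<close> dominates either requirement.\<close>
  define Q where "Q = l * G * A + s / (2 * T) + (\<bar>R\<bar> / (?\<beta> - ?\<sigma>) + \<bar>R\<bar> / (?\<tau> - ?\<alpha>))"
  have QR: "l * G * A + s / (2 * T) + R / (?\<beta> - ?\<sigma>) \<le> Q" "l * G * A + s / (2 * T) + R / (?\<tau> - ?\<alpha>) \<le> Q"
  proof -
    have "R / (?\<beta> - ?\<sigma>) \<le> \<bar>R\<bar> / (?\<beta> - ?\<sigma>)" "R / (?\<tau> - ?\<alpha>) \<le> \<bar>R\<bar> / (?\<tau> - ?\<alpha>)"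
      "0 \<le> \<bar>R\<bar> / (?\<beta> - ?\<sigma>)" "0 \<le> \<bar>R\<bar> / (?\<tau> - ?\<alpha>)"
      using o by (auto intro!: divide_right_mono)
    then show "l * G * A + s / (2 * T) + R / (?\<beta> - ?\<sigma>) \<le> Q" "l * G * A + s / (2 * T) + R / (?\<tau> - ?\<alpha>) \<le> Q"
      by (auto simp: Q_def)
  qed
  have sub: "{?\<alpha>..?\<beta>} \<subseteq> {t 0..t m}" by (rule piece_subset[OF j])
  have tb: "t 0 \<le> ?\<alpha>" "?\<beta> \<le> t m" using sub o by auto
  then have len: "?\<beta> - ?\<alpha> \<le> T" using t_m by simp
  show ?thesis
  proof (rule eventually_at_top_linorderI[of "max 1 (Q / (\<delta> * I))"], intro allI impI conjI)
    fix \<mu> u p h K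
    assume \<mu>: "max 1 (Q / (\<delta> * I)) \<le> \<mu>" and K: "K \<le> K2"
    have large: "Q \<le> (\<mu> * \<delta>) * I" using \<mu> \<delta>(1) I by (simp add: field_simps)
    have neg: "h x \<le> 0" "s / 2 \<le> u x \<Longrightarrow> h x \<le> - (\<mu> * \<delta> * an x)"
      if "x \<in> {?\<tau><..<?\<sigma>}" "\<forall>x\<in>{?\<tau><..<?\<sigma>}. h x = - (\<mu> * an x * gx (min (u x) K2))" for x
    proof -
      have hx: "h x = - (\<mu> * an x * gx (min (u x) K2))" using that by blast
      have \<mu>an: "0 \<le> \<mu> * an x" using \<mu> an_nonneg[of x] by simp
      show "h x \<le> 0" unfolding hx using \<mu>an gx_nonneg by simp
      show "h x \<le> - (\<mu> * \<delta> * an x)" if "s / 2 \<le> u x"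
      proof -
        have "\<delta> \<le> gx (min (u x) K2)" using \<delta>(2)[of "min (u x) K2"] that s by (simp add: gx_eq)
        then show ?thesis using mult_left_mono[OF _ \<mu>an] by (fastforce simp: hx mult_ac)
      qed
    qed
    have sub': "h integrable_on {c..d}"
      if "h integrable_on {?\<alpha>..?\<beta>}" "?\<alpha> \<le> c" "d \<le> ?\<beta>" for c d
      using that by (auto intro: integrable_on_subinterval[OF that(1)])
    show "p < 0" if P: "piece l \<mu> j K1 K2 K u p h" and us: "u ?\<alpha> = s" and uR: "u ?\<beta> \<le> R"
    proof (rule ccontr)
      assume "\<not> p < 0"
      have hint: "h integrable_on {?\<alpha>..?\<beta>}" using P by (simp add: piece_def)
      have "R < u ?\<beta>"
      proof (rule convex_escape_right[where u=u and R=R and \<beta>="?\<beta>" and \<alpha>="?\<alpha>" and \<tau>="?\<tau>" and \<sigma>="?\<sigma>" and T=T and p=p and h=h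
            and s=s and \<delta>="\<mu> * \<delta>" and N=an and B="l * G * A"])
        show "integral {?\<alpha>..x} h \<le> s / (2 * T)" if x: "x \<in> {?\<alpha>..?\<tau>}" for x
        proof -
          have "integral {?\<alpha>..x} h \<le> l * G1 * A"
            by (rule integral_ap_le[where u=u and K=K1])
              (use P x o l G1_nonneg G1' K1 tb sub'[OF hint] in \<open>auto simp: piece_def\<close>)
          with G1(2) show ?thesis by simp
        qed
        show "integral {?\<sigma>..x} h \<le> l * G * A" if x: "x \<in> {?\<sigma>..?\<beta>}" for x
          by (rule integral_ap_le[where u=u and K=K])
            (use P x o l G K tb sub'[OF hint] in \<open>auto simp: piece_def\<close>)
        show "l * G * A + s / (2 * T) + R / (?\<beta> - ?\<sigma>) \<le> \<mu> * \<delta> * integral {?\<tau>..?\<sigma>} an"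
          using QR(1) large by (simp add: I_def)
      qed (use P o len us s \<open>\<not> p < 0\<close> an_integrable neg in \<open>auto simp: piece_def\<close>)
      with uR show False by simp
    qed
    show "0 < p - integral {?\<alpha>..?\<beta>} h"
      if P: "piece l \<mu> j K K2 K1 u p h" and us: "u ?\<beta> = s" and uR: "u ?\<alpha> \<le> R"
    proof (rule ccontr)
      assume "\<not> 0 < p - integral {?\<alpha>..?\<beta>} h"
      have hint: "h integrable_on {?\<alpha>..?\<beta>}" using P by (simp add: piece_def)
      have "R < u ?\<alpha>"
      proof (rule convex_escape_left[where u=u and R=R and \<beta>="?\<beta>" and \<alpha>="?\<alpha>" and \<tau>="?\<tau>" and \<sigma>="?\<sigma>" and T=T and h=h
            and q="p - integral {?\<alpha>..?\<beta>} h" and s=s and \<delta>="\<mu> * \<delta>" and N=an and B="l * G * A"])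
        show "integral {x..?\<beta>} h \<le> s / (2 * T)" if x: "x \<in> {?\<sigma>..?\<beta>}" for x
        proof -
          have "integral {x..?\<beta>} h \<le> l * G1 * A"
            by (rule integral_ap_le[where u=u and K=K1])
              (use P x o l G1_nonneg G1' K1 tb sub'[OF hint] in \<open>auto simp: piece_def\<close>)
          with G1(2) show ?thesis by simp
        qed
        show "integral {x..?\<tau>} h \<le> l * G * A" if x: "x \<in> {?\<alpha>..?\<tau>}" for x
          by (rule integral_ap_le[where u=u and K=K])
            (use P x o l G K tb sub'[OF hint] in \<open>auto simp: piece_def\<close>)
        show "l * G * A + s / (2 * T) + R / (?\<tau> - ?\<alpha>) \<le> \<mu> * \<delta> * integral {?\<tau>..?\<sigma>} an"
          using QR(2) large by (simp add: I_def)
        show "(u has_real_derivative p - integral {?\<alpha>..?\<beta>} h + integral {x..?\<beta>} h) (at x within {?\<alpha>..?\<beta>})"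
          if "x \<in> {?\<alpha>..?\<beta>}" for x by (rule piece_derivative_end[OF P that])
      qed (use P o len us s \<open>\<not> 0 < p - integral {?\<alpha>..?\<beta>} h\<close> an_integrable neg in \<open>auto simp: piece_def\<close>)
      with uR show False by simp
    qed
  qed
qed

end

section \<open>The truncated problem\<close>

lemma cancel_rate:
  fixes l C s A B k :: real
  assumes "l \<noteq> 0" "C \<noteq> 0"
  shows "l * (1 / (k * l * C * B) * (C * s)) * A = s / k * (A / B)"
  using assms by simp

context partitioned_weight
begin

text \<open>For small \<open>s\<close> the limit at 0 gives
  \<open>g y \<le> \<eta> * y \<le> \<eta> * (C * s)\<close> on the truncated range, and \<eta> is
  chosen so that the resulting mass is \<open>s / (2 * T)\<close> times \<open>A / (A + 1)\<close>.
  This is the smallness hypothesis of \<open>escape\<close> for \<open>r0\<close> and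
  \<open>r1\<close>.\<close>

lemma low_small:
  assumes l: "0 < l" and C: "1 \<le> C"
  shows "\<exists>\<epsilon>>0. \<forall>s. 0 < s \<longrightarrow> s < \<epsilon> \<longrightarrow> (\<exists>G. (\<forall>y\<in>{0..C * s}. g y \<le> G) \<and> l * G * A \<le> s / (2 * T))"
proof -
  define \<eta> where "\<eta> = 1 / (2 * T * l * C * (A + 1))"
  have \<eta>: "0 < \<eta>" using T_pos l C A_nonneg by (simp add: \<eta>_def)
  have "\<forall>\<^sub>F y in at_right 0. g y / y < \<eta>" using order_tendstoD(2)[OF g_lim_0 \<eta>] .
  then obtain b where b: "0 < b" "\<And>y. 0 < y \<Longrightarrow> y < b \<Longrightarrow> g y / y < \<eta>"
    by (auto simp: eventually_at_right_field)
  show ?thesis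
  proof (rule exI[of _ "b / C"], intro conjI allI impI)
    fix s assume s: "0 < s" "s < b / C"
    show "\<exists>G. (\<forall>y\<in>{0..C * s}. g y \<le> G) \<and> l * G * A \<le> s / (2 * T)"
    proof (intro exI[of _ "\<eta> * (C * s)"] conjI ballI)
      fix y assume y: "y \<in> {0..C * s}"
      have "C * s < b" using s C by (simp add: field_simps)
      show "g y \<le> \<eta> * (C * s)"
      proof (cases "y = 0")
        case False
        then have "g y \<le> \<eta> * y" using b(2)[of y] y \<open>C * s < b\<close> by (simp add: field_simps)
        also have "\<dots> \<le> \<eta> * (C * s)" using y \<eta> by (intro mult_left_mono) auto
        finally show ?thesis .
      qed (use s C \<eta> g_zero in auto)
    next
      have "l * (\<eta> * (C * s)) * A = s / (2 * T) * (A / (A + 1))"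
        using l C unfolding \<eta>_def by (intro cancel_rate) auto
      also have "\<dots> \<le> s / (2 * T) * 1"
        using T_pos s A_nonneg by (intro mult_left_mono) (auto simp: field_simps)
      finally show "l * (\<eta> * (C * s)) * A \<le> s / (2 * T)" by simp
    qed
  qed (use b C in auto)
qed

text \<open>The counterpart for \<open>R1\<close>, from sublinearity at infinity. On a bounded range
  \<open>g\<close> is only bounded by some \<open>M\<close>, so the allowance
  \<open>s / (2 * T)\<close> is shared equally between \<open>M\<close> and the linear part; hence
  the 4 in \<eta>.\<close>

lemma low_large:
  assumes l: "0 < l" and C: "1 \<le> C"
  shows "\<exists>S0. \<forall>s. S0 \<le> s \<longrightarrow> (\<exists>G. (\<forall>y\<in>{0..C * s}. g y \<le> G) \<and> l * G * A \<le> s / (2 * T))"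
proof -
  define \<eta> where "\<eta> = 1 / (4 * T * l * C * (A + 1))"
  have \<eta>: "0 < \<eta>" using T_pos l C A_nonneg by (simp add: \<eta>_def)
  have "\<forall>\<^sub>F y in at_top. g y / y < \<eta>" using order_tendstoD(2)[OF g_lim_inf \<eta>] .
  then obtain N where N: "\<And>y. N \<le> y \<Longrightarrow> g y / y < \<eta>"
    by (auto simp: eventually_at_top_linorder)
  obtain M where M: "0 \<le> M" "\<And>y. y \<le> max 1 N \<Longrightarrow> gx y \<le> M" using gx_bounded_above by blast
  show ?thesis
  \<comment> \<open>Large enough that \<open>l * M * A \<le> s / (4 * T)\<close>; the added 1 makes
    \<open>s\<close> positive.\<close>
  proof (rule exI[of _ "4 * T * l * A * M + 1"], intro allI impI)
    fix s assume s: "4 * T * l * A * M + 1 \<le> s"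
    have s0: "0 < s" using s T_pos l A_nonneg M by (smt (verit) mult_nonneg_nonneg)
    show "\<exists>G. (\<forall>y\<in>{0..C * s}. g y \<le> G) \<and> l * G * A \<le> s / (2 * T)"
    proof (intro exI[of _ "M + \<eta> * (C * s)"] conjI ballI)
      fix y assume y: "y \<in> {0..C * s}"
      have nn: "0 \<le> \<eta> * (C * s)" using \<eta> C s0 by simp
      show "g y \<le> M + \<eta> * (C * s)"
      proof (cases "y \<le> max 1 N")
        case True
        then show ?thesis using M(2)[of y] y nn by (simp add: gx_eq)
      next
        case False
        then have "N \<le> y" "0 < y" by auto
        then have "g y \<le> \<eta> * y" using N[of y] by (simp add: pos_divide_less_eq)
        also have "\<dots> \<le> \<eta> * (C * s)" using y \<eta> by (intro mult_left_mono) auto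
        finally show ?thesis using M by simp
      qed
    next
      have "l * (\<eta> * (C * s)) * A = s / (4 * T) * (A / (A + 1))"
        using l C unfolding \<eta>_def by (intro cancel_rate) auto
      also have "\<dots> \<le> s / (4 * T) * 1"
        using T_pos s0 A_nonneg by (intro mult_left_mono) (auto simp: field_simps)
      finally have 1: "l * (\<eta> * (C * s)) * A \<le> s / (4 * T)" by simp
      have "l * M * A \<le> s / (4 * T)" using s T_pos by (simp add: field_simps)
      then have "l * (M + \<eta> * (C * s)) * A \<le> s / (4 * T) + s / (4 * T)" using 1 by (simp add: algebra_simps)
      then show "l * (M + \<eta> * (C * s)) * A \<le> s / (2 * T)" by (simp add: field_simps)
    qed
  qed
qed

section \<open>Lobes, gaps and the signed weight\<close>

definition in_gap :: "real \<Rightarrow> bool"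
  where "in_gap x \<longleftrightarrow> (\<exists>j<m. \<tau> j < x \<and> x < \<sigma> (Suc j))"

text \<open>The number of right ends \<open>\<tau> j\<close> to the left of \<open>x\<close>: outside the gaps, this is the cyclic index of the
  lobe containing \<open>x\<close>.\<close>

definition node :: "real \<Rightarrow> nat"
  where "node x = (\<Sum>j<m. if \<tau> j < x then 1 else 0) mod m"

text \<open>The weight \<open>a\<close> has its sign in lobes and gaps only almost everywhere. This
  version has it at every point, so that concavity and convexity can be used without exceptional
  sets; it is exchanged for the true weight in \<open>orbit_extends\<close>.\<close>

definition q :: "real \<Rightarrow> real \<Rightarrow> real \<Rightarrow> real"
  where "q l \<mu> x = (if in_gap x then - (\<mu> * an x) else l * ap x)"

lemma node_lt: "node x < m"
  using m_pos by (simp add: node_def)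

lemma tau_lt: "i < j \<Longrightarrow> j \<le> m \<Longrightarrow> \<tau> i < t j \<and> \<sigma> (Suc i) < t j"
  using ord[of i] t_mono[of "Suc i" j] by force

lemma lt_tau: "j < m \<Longrightarrow> i \<le> j \<Longrightarrow> t i < \<tau> j"
  using ord[of j] t_mono[of i j] by force

lemma node_right:
  assumes j: "j < m" and x: "x \<in> {t j..\<tau> j}"
  shows "\<not> in_gap x" "node x = j"
proof -
  have 1: "\<tau> i < x" "\<sigma> (Suc i) < x" if "i < j" for i using tau_lt[OF that] j x by force+
  have 2: "x \<le> \<tau> i" if "j \<le> i" "i < m" for i
  proof (cases "i = j")
    case False
    then have "\<tau> j < t i" using that tau_lt[of j i] by simp
    then show ?thesis using x lt_tau[of i i] that by force
  qed (use x in simp)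
  show "\<not> in_gap x"
  proof
    assume "in_gap x"
    then obtain i where "i < m" "\<tau> i < x" "x < \<sigma> (Suc i)" by (auto simp: in_gap_def)
    then show False using 1[of i] 2[of i] by linarith
  qed
  have "(\<Sum>i<m. if \<tau> i < x then 1 else (0::nat)) = (\<Sum>i<j. 1)"
  proof (rule sum.mono_neutral_cong_right)
    show "\<forall>i\<in>{..<m} - {..<j}. (if \<tau> i < x then 1 else (0::nat)) = 0"
    proof
      fix i assume "i \<in> {..<m} - {..<j}"
      then show "(if \<tau> i < x then 1 else (0::nat)) = 0" using 2[of i] by simp
    qed
  qed (use 1 j in auto)
  then show "node x = j" using j by (simp add: node_def)
qed

text \<open>For \<open>j = m - 1\<close> all \<open>m\<close> right ends have been passed, and
  reduction modulo \<open>m\<close> returns lobe 0.\<close>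

lemma node_left:
  assumes j: "j < m" and x: "x \<in> {\<sigma> (Suc j)..t (Suc j)}"
  shows "\<not> in_gap x" "node x = Suc j mod m"
proof -
  have 1: "\<tau> i < x \<and> \<sigma> (Suc i) \<le> x" if "i \<le> j" for i
  proof (cases "i = j")
    case False
    then have "\<tau> i < t j" "\<sigma> (Suc i) < t j" using tau_lt[of i j] that j by auto
    then show ?thesis using x ord[OF j] by force
  qed (use x ord[OF j] in force)
  have 2: "x \<le> \<tau> i" if "j < i" "i < m" for i
    using lt_tau[of i "Suc j"] that x by force
  show "\<not> in_gap x"
  proof
    assume "in_gap x"
    then obtain i where "i < m" "\<tau> i < x" "x < \<sigma> (Suc i)" by (auto simp: in_gap_def)
    then show False using 1[of i] 2[of i] by linarith
  qed
  have "(\<Sum>i<m. if \<tau> i < x then 1 else (0::nat)) = (\<Sum>i<Suc j. 1)"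
  proof (rule sum.mono_neutral_cong_right)
    show "\<forall>i\<in>{..<m} - {..<Suc j}. (if \<tau> i < x then 1 else (0::nat)) = 0"
    proof
      fix i assume "i \<in> {..<m} - {..<Suc j}"
      then show "(if \<tau> i < x then 1 else (0::nat)) = 0" using 2[of i] by simp
    qed
  qed (use 1 j in auto)
  then show "node x = Suc j mod m" by (simp add: node_def)
qed

lemma in_gapI: "j < m \<Longrightarrow> x \<in> {\<tau> j<..<\<sigma> (Suc j)} \<Longrightarrow> in_gap x"
  by (auto simp: in_gap_def)

lemma q_integrable: "q l \<mu> absolutely_integrable_on {x..y}"
proof -
  have pr: "Measurable.pred borel in_gap"
    unfolding in_gap_def[abs_def] by measurable
  have 1: "(\<lambda>x. (if in_gap x then 0 else l) * ap x) absolutely_integrable_on {x..y}"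
    using pr by (intro absolutely_integrable_bounded_measurable_product_real ap_int
        measurable_restrict_space1 measurable_completion)
      (auto intro!: boundedI[of _ "\<bar>l\<bar>"])
  have 2: "(\<lambda>x. (if in_gap x then - \<mu> else 0) * an x) absolutely_integrable_on {x..y}"
    using pr by (intro absolutely_integrable_bounded_measurable_product_real an_int
        measurable_restrict_space1 measurable_completion)
      (auto intro!: boundedI[of _ "\<bar>\<mu>\<bar>"])
  have "q l \<mu> = (\<lambda>x. (if in_gap x then 0 else l) * ap x + (if in_gap x then - \<mu> else 0) * an x)"
    by (auto simp: q_def)
  with set_integral_add(1)[OF 1 2] show ?thesis by simp
qed

text \<open>The caps bound the nonlinearity by \<open>\<bar>q l \<mu> x\<bar> * G\<close> uniformly
  over the box, which is the domination asked for by \<open>broken_solution\<close>. They move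
  continuously with the nodal values, so they do not disturb the fixed point argument.\<close>

lemma truncated_solution:
  assumes C: "1 \<le> C" and box: "\<And>i. i < m \<Longrightarrow> 0 \<le> lo i \<and> lo i \<le> hi i \<and> hi i \<le> R" and e: "\<And>i. i < m \<Longrightarrow> e i \<noteq> 0"
  obtains u s p h where "s \<in> box_upto m lo hi" "h integrable_on {t 0..t m}"
    "\<And>j. j < m \<Longrightarrow> u (t j) = s j" "\<And>j. j < m \<Longrightarrow> u (t (Suc j)) = s (Suc j mod m)"
    "\<And>j. j < m \<Longrightarrow> piece l \<mu> j (C * s j) (C * R) (C * s (Suc j mod m)) u (p j) h"
    "\<And>x. h x = q l \<mu> x * gx (min (u x) (if in_gap x then C * R else C * s (node x)))"
    "\<And>j i D. \<lbrakk>j < m; i = Suc j mod m; D = p i - (p j - integral {t j..t (Suc j)} h)\<rbrakk>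
      \<Longrightarrow> D = 0 \<or> s i = lo i \<and> e i * D < 0 \<or> s i = hi i \<and> e i * D > 0"
proof -
  define cap where "cap s x = (if in_gap x then C * R else C * s (node x))" for s :: "nat \<Rightarrow> real" and x
  define f where "f s y x = q l \<mu> x * gx (min y (cap s x))" for s y x
  have cap_le: "cap s x \<le> C * R" if "s \<in> box_upto m lo hi" for s x
  proof -
    have "s (node x) \<le> R" using that box[OF node_lt[of x]] node_lt[of x] by (force simp: box_upto_def)
    then show ?thesis using C by (simp add: cap_def)
  qed
  obtain G where G: "0 \<le> G" "\<And>z. z \<le> C * R \<Longrightarrow> gx z \<le> G" using gx_bounded_above by blast
  have gxG: "\<bar>gx (min y (cap s x))\<bar> \<le> G" if "s \<in> box_upto m lo hi" for s y x
    using G(2)[of "min y (cap s x)"] cap_le[OF that, of x] gx_nonneg[of "min y (cap s x)"] by simp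
  have gxm: "gx \<in> borel_measurable borel" by (rule borel_measurable_continuous_onI[OF gx_cont])
  have capm: "cap s \<in> borel_measurable borel" for s
  proof -
    have [measurable]: "node \<in> measurable borel (count_space UNIV)" unfolding node_def[abs_def] by measurable
    have [measurable]: "Measurable.pred borel in_gap" unfolding in_gap_def[abs_def] by measurable
    show ?thesis unfolding cap_def[abs_def] by measurable
  qed
  have gxcont: "isCont gx z" for z
    using gx_cont by (simp add: continuous_on_eq_continuous_at)
  obtain u s p where sB: "s \<in> box_upto m lo hi" and "continuous_on {t 0..t m} u"
    and fi: "(\<lambda>x. f s (u x) x) absolutely_integrable_on {t 0..t m}"
    and us: "\<And>j. j < m \<Longrightarrow> u (t j) = s j" "\<And>j. j < m \<Longrightarrow> u (t (Suc j)) = s (Suc j mod m)"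
    and der: "\<And>j x. \<lbrakk>j < m; x \<in> {t j..t (Suc j)}\<rbrakk> \<Longrightarrow>
      (u has_real_derivative p j - integral {t j..x} (\<lambda>x. f s (u x) x)) (at x within {t j..t (Suc j)})"
    and kink: "\<And>j i D. \<lbrakk>j < m; i = Suc j mod m;
        D = p i - (p j - integral {t j..t (Suc j)} (\<lambda>x. f s (u x) x))\<rbrakk>
      \<Longrightarrow> D = 0 \<or> s i = lo i \<and> e i * D < 0 \<or> s i = hi i \<and> e i * D > 0"
  proof (rule broken_solution[of m t lo hi e "\<lambda>x. \<bar>q l \<mu> x\<bar> * G" f])
    show "(\<lambda>x. \<bar>q l \<mu> x\<bar> * G) integrable_on {t 0..t m}"
      using q_integrable[of "t 0" "t m" l \<mu>]
      by (intro integrable_on_mult_left) (simp add: absolutely_integrable_on_def)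
    show "(\<lambda>x. f s (v x) x) absolutely_integrable_on {t 0..t m}"
      if [measurable]: "v \<in> borel_measurable borel" and s: "s \<in> box_upto m lo hi" for v s
    proof -
      have "(\<lambda>x. gx (min (v x) (cap s x)) * q l \<mu> x) absolutely_integrable_on {t 0..t m}"
      proof (rule absolutely_integrable_bounded_measurable_product_real[OF _ _ _ q_integrable])
        note [measurable] = capm[of s] gxm
        show "(\<lambda>x. gx (min (v x) (cap s x))) \<in> borel_measurable (lebesgue_on {t 0..t m})"
          by (intro measurable_restrict_space1 measurable_completion) simp
        show "bounded ((\<lambda>x. gx (min (v x) (cap s x))) ` {t 0..t m})"
          using gxG[OF s] by (auto intro!: boundedI[of _ G])
      qed auto
      then show ?thesis by (simp add: f_def mult.commute)
    qed
    show "\<bar>f s y x\<bar> \<le> \<bar>q l \<mu> x\<bar> * G" if "s \<in> box_upto m lo hi" for s y x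
      using gxG[OF that] by (auto simp: f_def abs_mult intro: mult_left_mono)
    show "(\<lambda>k. f (X k) (Y k) x) \<longlonglongrightarrow> f s y x"
      if "\<And>i. i < m \<Longrightarrow> (\<lambda>k. X k i) \<longlonglongrightarrow> s i" "Y \<longlonglongrightarrow> y" for X Y x s y
    proof -
      have "(\<lambda>k. cap (X k) x) \<longlonglongrightarrow> cap s x"
        using that(1)[OF node_lt] by (auto simp: cap_def intro!: tendsto_intros)
      then show ?thesis
        unfolding f_def
        by (intro tendsto_mult tendsto_const isCont_tendsto_compose[OF gxcont] tendsto_min that(2))
    qed
  qed (use m_pos t_step box e in auto)
  show ?thesis
  proof (rule that[of s "\<lambda>x. f s (u x) x" u p])
    show "(\<lambda>x. f s (u x) x) integrable_on {t 0..t m}" using fi by (simp add: absolutely_integrable_on_def)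
    then have "(\<lambda>x. f s (u x) x) integrable_on {t j..t (Suc j)}" if "j < m" for j
      by (rule integrable_on_subinterval) (rule piece_subset[OF that])
    then show "piece l \<mu> j (C * s j) (C * R) (C * s (Suc j mod m)) u (p j) (\<lambda>x. f s (u x) x)" if "j < m" for j
      using that der node_right[OF that] node_left[OF that] in_gapI[OF that]
      by (auto simp: piece_def f_def q_def cap_def)
    show "f s (u x) x = q l \<mu> x * gx (min (u x) (if in_gap x then C * R else C * s (node x)))" for x
      by (simp add: f_def cap_def)
  qed (use sB us kink in auto)
qed

lemma piece_nonneg:
  assumes P: "piece l \<mu> j K1 K2 K3 u p h" and "0 \<le> u (t j)" "0 \<le> u (t (Suc j))" and j: "j < m"
    and x: "x \<in> {t j..t (Suc j)}"
  shows "0 \<le> u x"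
proof (rule nonneg_of_boundary[where u=u and \<alpha>="t j" and \<beta>="t (Suc j)" and p=p and h=h])
  fix x assume x: "x \<in> {t j..t (Suc j)}" "u x \<le> 0"
  then have "gx (min (u x) K) = 0" for K by (intro gx_zero) auto
  moreover have "x \<in> {t j..\<tau> j} \<or> x \<in> {\<tau> j<..<\<sigma> (Suc j)} \<or> x \<in> {\<sigma> (Suc j)..t (Suc j)}" using x by auto
  ultimately show "h x = 0" using P unfolding piece_def by fastforce
qed (use assms in \<open>auto simp: piece_def\<close>)

lemma piece_tangent_right:
  assumes P: "piece l \<mu> j K1 K2 K3 u p h" and j: "j < m" and l: "0 \<le> l" and x: "x \<in> {t j..\<tau> j}"
  shows "u x \<le> u (t j) + p * (x - t j)"
proof (rule increment_le[where F="\<lambda>x. p - integral {t j..x} h" and S="{t j..t (Suc j)}"])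
  show "p - integral {t j..y} h \<le> p" if y: "y \<in> {t j..x}" for y
  proof -
    have "h integrable_on {t j..y}"
      using P x y ord[OF j] by (auto simp: piece_def intro: integrable_on_subinterval)
    then have "0 \<le> integral {t j..y} h"
      using P x y l by (intro integral_nonneg) (auto simp: piece_def ap_nonneg gx_nonneg)
    then show ?thesis by simp
  qed
qed (use P x ord[OF j] in \<open>auto simp: piece_def\<close>)

lemma piece_tangent_left:
  assumes P: "piece l \<mu> j K1 K2 K3 u p h" and j: "j < m" and l: "0 \<le> l" and x: "x \<in> {\<sigma> (Suc j)..t (Suc j)}"
  shows "u x + (p - integral {t j..t (Suc j)} h) * (t (Suc j) - x) \<le> u (t (Suc j))"
proof (rule increment_ge[where F="\<lambda>x. (p - integral {t j..t (Suc j)} h) + integral {x..t (Suc j)} h"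
      and S="{t j..t (Suc j)}"])
  show "p - integral {t j..t (Suc j)} h \<le> (p - integral {t j..t (Suc j)} h) + integral {y..t (Suc j)} h"
    if y: "y \<in> {x..t (Suc j)}" for y
  proof -
    have "h integrable_on {y..t (Suc j)}"
      using P x y ord[OF j] by (auto simp: piece_def intro: integrable_on_subinterval)
    then have "0 \<le> integral {y..t (Suc j)} h"
      using P x y l by (intro integral_nonneg) (auto simp: piece_def ap_nonneg gx_nonneg)
    then show ?thesis by simp
  qed
qed (use piece_derivative_end[OF P] x ord[OF j] in auto)

text \<open>Convexity in the gap: according to the sign of the slope at \<open>x\<close>,
  \<open>u\<close> is monotone from \<open>x\<close> to the right end or from the left end to
  \<open>x\<close>.\<close>

lemma piece_gap_le:
  assumes P: "piece l \<mu> j K1 K2 K3 u p h" and j: "j < m" and \<mu>: "0 \<le> \<mu>" and x: "x \<in> {\<tau> j..\<sigma> (Suc j)}"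
  shows "u x \<le> max (u (\<tau> j)) (u (\<sigma> (Suc j)))"
proof -
  define F where "F x = p - integral {t j..x} h" for x
  note o = ord[OF j]
  have hi: "h integrable_on {t j..t (Suc j)}" using P by (simp add: piece_def)
  have der: "(u has_real_derivative F y) (at y within {t j..t (Suc j)})" if "y \<in> {t j..t (Suc j)}" for y
    using P that by (simp add: piece_def F_def)
  have mono: "F y \<le> F z" if "\<tau> j \<le> y" "y \<le> z" "z \<le> \<sigma> (Suc j)" for y z
  proof -
    have "integral {y..z} h \<le> integral {y..z} (\<lambda>_. 0)"
    proof (rule integral_le_interior)
      show "h integrable_on {y..z}" using hi that o by (auto intro: integrable_on_subinterval)
      show "h w \<le> 0" if "w \<in> {y<..<z}" for w
        using P that \<open>\<tau> j \<le> y\<close> \<open>z \<le> \<sigma> (Suc j)\<close> \<mu> by (auto simp: piece_def an_nonneg gx_nonneg)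
    qed (intro integrable_continuous_real continuous_on_const)
    then show ?thesis using integral_split[OF hi, of y z] that o by (simp add: F_def)
  qed
  show ?thesis
  proof (cases "0 \<le> F x")
    case True
    have "u x + 0 * (\<sigma> (Suc j) - x) \<le> u (\<sigma> (Suc j))"
    proof (rule increment_ge[where F=F and S="{t j..t (Suc j)}"])
      show "0 \<le> F y" if "y \<in> {x..\<sigma> (Suc j)}" for y using mono[of x y] True that x by auto
    qed (use x o der in auto)
    then show ?thesis by simp
  next
    case False
    have "u x \<le> u (\<tau> j) + 0 * (x - \<tau> j)"
    proof (rule increment_le[where F=F and S="{t j..t (Suc j)}"])
      show "F y \<le> 0" if "y \<in> {\<tau> j..x}" for y using mono[of y x] False that x by auto
    qed (use x o der in auto)
    then show ?thesis by simp
  qed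
qed

section \<open>Excluding kinks\<close>

text \<open>The left half of lobe \<open>j\<close> lies in the piece that ends at \<open>t j\<close>; for \<open>j = 0\<close> it is the translate by the
  period, next to \<open>t m\<close>.\<close>

definition half_lobes :: "nat \<Rightarrow> real set"
  where "half_lobes j = {t j..\<tau> j} \<union> (\<Union>i\<in>{i. i < m \<and> Suc i mod m = j}. {\<sigma> (Suc i)..t (Suc i)})"

text \<open>The first-order system u' = v, v' = -h in integrated form. Increments can be added
  across nodes and periods, and are insensitive to changes of the weight on null sets.\<close>

definition periodic_orbit :: "real \<Rightarrow> real \<Rightarrow> (real \<Rightarrow> real) \<Rightarrow> (real \<Rightarrow> real) \<Rightarrow> (real \<Rightarrow> real) \<Rightarrow> bool"
  where "periodic_orbit l \<mu> u v h \<longleftrightarrow>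
    h integrable_on {t 0..t m} \<and> continuous_on {t 0..t m} v \<and>
    (\<forall>x\<in>{t 0..t m}. 0 \<le> u x \<and> h x = q l \<mu> x * g (u x)) \<and>
    (\<forall>x y. t 0 \<le> x \<longrightarrow> x \<le> y \<longrightarrow> y \<le> t m \<longrightarrow>
      u y - u x = integral {x..y} v \<and> v y - v x = - integral {x..y} h) \<and>
    u (t m) = u (t 0) \<and> v (t m) = v (t 0)"

lemma in_piece:
  assumes "x \<in> {t 0..t m}"
  obtains j where "j < m" "x \<in> {t j..t (Suc j)}"
proof -
  have "\<exists>j<k. x \<in> {t j..t (Suc j)}" if "k \<le> m" "0 < k" "x \<in> {t 0..t k}" for k
    using that
  proof (induction k)
    case (Suc k)
    show ?case
    proof (cases "x \<le> t k \<and> 0 < k")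
      case True
      then show ?thesis using Suc by (auto simp: less_Suc_eq)
    next
      case False
      then have "x \<in> {t k..t (Suc k)}" using Suc.prems by (cases "k = 0") auto
      then show ?thesis by blast
    qed
  qed simp
  then show ?thesis using assms m_pos that by blast
qed

lemma predecessor:
  assumes "j < m"
  obtains i where "i < m" "Suc i mod m = j"
proof (cases j)
  case 0
  then show ?thesis using m_pos by (intro that[of "m - 1"]) auto
next
  case (Suc i)
  then show ?thesis using assms by (intro that[of i]) auto
qed

text \<open>Without a kink both parts of a lobe lie below one common tangent at the node, of slope
  \<open>k\<close> say. Nonnegativity of \<open>u\<close> at the two lobe ends confines
  \<open>k\<close>, and then the tangent stays below \<open>C * s j\<close> on the lobe; in the gaps
  convexity gives \<open>C * R\<close>. All caps are therefore inactive and \<open>u\<close> solves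
  the original equation.\<close>

lemma unkinked_solution:
  assumes C: "1 \<le> C" and "0 \<le> l" "0 \<le> \<mu>"
    and ratio: "\<And>i j. \<lbrakk>i < m; j < m\<rbrakk> \<Longrightarrow> \<tau> j - t j \<le> (C - 1) * (t (Suc i) - \<sigma> (Suc i)) \<and>
      t (Suc i) - \<sigma> (Suc i) \<le> (C - 1) * (\<tau> j - t j)"
    and s: "\<And>j. j < m \<Longrightarrow> 0 \<le> s j \<and> s j \<le> R"
    and hint: "h integrable_on {t 0..t m}"
    and us: "\<And>j. j < m \<Longrightarrow> u (t j) = s j" "\<And>j. j < m \<Longrightarrow> u (t (Suc j)) = s (Suc j mod m)"
    and P: "\<And>j. j < m \<Longrightarrow> piece l \<mu> j (C * s j) (C * R) (C * s (Suc j mod m)) u (p j) h"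
    and h: "\<And>x. h x = q l \<mu> x * gx (min (u x) (if in_gap x then C * R else C * s (node x)))"
    and nokink: "\<And>j. j < m \<Longrightarrow> p (Suc j mod m) = p j - integral {t j..t (Suc j)} h"
  shows "periodic_orbit l \<mu> u (\<lambda>x. p 0 - integral {t 0..x} h) h"
    and "\<And>j x. \<lbrakk>j < m; x \<in> half_lobes j\<rbrakk> \<Longrightarrow> u x \<le> C * s j"
    and "\<And>x. x \<in> {t 0..t m} \<Longrightarrow> u x \<le> C * R"
proof -
  define v where "v x = p 0 - integral {t 0..x} h" for x
  have nn_piece: "0 \<le> u x" if "j < m" "x \<in> {t j..t (Suc j)}" for j x
  proof (rule piece_nonneg[OF P[OF that(1)] _ _ that])
    have "Suc j mod m < m" using m_pos by simp
    then show "0 \<le> u (t j)" "0 \<le> u (t (Suc j))" using us[OF that(1)] s that(1) by simp_all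
  qed
  have u_nonneg: "0 \<le> u x" if "x \<in> {t 0..t m}" for x
    using in_piece[OF that] nn_piece by blast
  have bounds: "u x \<le> C * s j"
    if ij: "i < m" "j < m" "Suc i mod m = j" and x: "x \<in> {t j..\<tau> j} \<or> x \<in> {\<sigma> (Suc i)..t (Suc i)}" for i j x
  proof -
    define k where "k = p j"
    define a b where "a = t (Suc i) - \<sigma> (Suc i)" and "b = \<tau> j - t j"
    have ab: "0 < a" "0 < b" using ord ij by (auto simp: a_def b_def)
    have qi: "p i - integral {t i..t (Suc i)} h = k" using nokink[of i] ij by (simp add: k_def)
    have right: "u y \<le> s j + k * (y - t j)" if "y \<in> {t j..\<tau> j}" for y
      using piece_tangent_right[OF P[OF ij(2)] ij(2) \<open>0 \<le> l\<close> that] us(1)[OF ij(2)] by (simp add: k_def)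
    have left: "u y \<le> s j - k * (t (Suc i) - y)" if "y \<in> {\<sigma> (Suc i)..t (Suc i)}" for y
      using piece_tangent_left[OF P[OF ij(1)] ij(1) \<open>0 \<le> l\<close> that] us(2)[OF ij(1)] ij(3) by (simp add: qi)
    note oi = ord[OF ij(1)] and oj = ord[OF ij(2)]
    have "0 \<le> u (\<tau> j)" by (rule nn_piece[OF ij(2)]) (use oj in auto)
    moreover have "0 \<le> u (\<sigma> (Suc i))" by (rule nn_piece[OF ij(1)]) (use oi in auto)
    moreover have "u (\<tau> j) \<le> s j + k * b" unfolding b_def by (rule right) (use oj in auto)
    moreover have "u (\<sigma> (Suc i)) \<le> s j - k * a" unfolding a_def by (rule left) (use oi in auto)
    ultimately have k1: "0 \<le> s j + k * b" and k2: "0 \<le> s j - k * a" by linarith+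
    have sj: "0 \<le> s j" using s[OF ij(2)] by simp
    have rt: "b \<le> (C - 1) * a" "a \<le> (C - 1) * b" using ratio[OF ij(1,2)] by (auto simp: a_def b_def)
    \<comment> \<open>A rising tangent is restrained by nonnegativity at the left end of the lobe
      but is largest on the right part, and conversely; this is why \<open>ratio\<close> compares
      the lengths of opposite parts.\<close>
    have key: "\<bar>k\<bar> * z \<le> (C - 1) * s j"
      if "0 \<le> z" "0 \<le> k \<and> z \<le> b \<or> k \<le> 0 \<and> z \<le> a" for z
    proof -
      have *: "\<bar>k\<bar> * z \<le> (C - 1) * (\<bar>k\<bar> * w)" if "z \<le> (C - 1) * w" for w
        using mult_left_mono[OF that, of "\<bar>k\<bar>"] by (simp add: mult_ac)
      show ?thesis
        using that(2)
      proof
        assume kz: "0 \<le> k \<and> z \<le> b"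
        then have "\<bar>k\<bar> * z \<le> (C - 1) * (\<bar>k\<bar> * a)" using rt by (intro *) auto
        also have "\<dots> \<le> (C - 1) * s j" using k2 kz C by (intro mult_left_mono) auto
        finally show ?thesis .
      next
        assume kz: "k \<le> 0 \<and> z \<le> a"
        then have "\<bar>k\<bar> * z \<le> (C - 1) * (\<bar>k\<bar> * b)" using rt by (intro *) auto
        also have "\<dots> \<le> (C - 1) * s j" using k1 kz C by (intro mult_left_mono) auto
        finally show ?thesis .
      qed
    qed
    have C1: "0 \<le> (C - 1) * s j" using C sj by simp
    from x show ?thesis
    proof
      assume x: "x \<in> {t j..\<tau> j}"
      have "k * (x - t j) \<le> (C - 1) * s j"
      proof (cases "0 \<le> k")
        case True
        then show ?thesis using key[of "x - t j"] x by (simp add: b_def)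
      next
        case False
        then have "k * (x - t j) \<le> 0" using x by (intro mult_nonpos_nonneg) auto
        with C1 show ?thesis by linarith
      qed
      then show ?thesis using right[OF x] by (simp add: algebra_simps)
    next
      assume x: "x \<in> {\<sigma> (Suc i)..t (Suc i)}"
      have "- k * (t (Suc i) - x) \<le> (C - 1) * s j"
      proof (cases "k \<le> 0")
        case True
        then show ?thesis using key[of "t (Suc i) - x"] x by (simp add: a_def)
      next
        case False
        then have "- k * (t (Suc i) - x) \<le> 0" using x by (intro mult_nonpos_nonneg) auto
        with C1 show ?thesis by linarith
      qed
      then show ?thesis using left[OF x] by (simp add: algebra_simps)
    qed
  qed
  show lobes: "u x \<le> C * s j" if j: "j < m" and x: "x \<in> half_lobes j" for j x
    using x unfolding half_lobes_def
  proof (elim UnE UN_E)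
    assume "x \<in> {t j..\<tau> j}"
    then show ?thesis using predecessor[OF j] bounds[of _ j x] j by metis
  next
    fix i assume "i \<in> {i. i < m \<and> Suc i mod m = j}" "x \<in> {\<sigma> (Suc i)..t (Suc i)}"
    then show ?thesis using bounds[of i j x] j by auto
  qed
  have right_le: "u x \<le> C * s j" if "j < m" "x \<in> {t j..\<tau> j}" for j x
    using lobes[of j x] that by (auto simp: half_lobes_def)
  have left_le: "u x \<le> C * s (Suc i mod m)" if "i < m" "x \<in> {\<sigma> (Suc i)..t (Suc i)}" for i x
    using lobes[of "Suc i mod m" x] that m_pos by (auto simp: half_lobes_def)
  have CR: "C * s j \<le> C * R" if "j < m" for j using s[OF that] C by simp
  have gap_le: "u x \<le> C * R" if j: "j < m" and x: "x \<in> {\<tau> j..\<sigma> (Suc j)}" for j x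
  proof -
    have "u (\<tau> j) \<le> C * R" using right_le[OF j, of "\<tau> j"] ord[OF j] CR[OF j] by auto
    moreover have "u (\<sigma> (Suc j)) \<le> C * R"
      using left_le[OF j, of "\<sigma> (Suc j)"] ord[OF j] CR[of "Suc j mod m"] m_pos by auto
    ultimately show ?thesis using piece_gap_le[OF P[OF j] j \<open>0 \<le> \<mu>\<close> x] by simp
  qed
  have cases: "x \<in> {t j..\<tau> j} \<or> x \<in> {\<tau> j<..<\<sigma> (Suc j)} \<or> x \<in> {\<sigma> (Suc j)..t (Suc j)}"
    if "x \<in> {t j..t (Suc j)}" for j x using that by auto
  show "u x \<le> C * R" if x: "x \<in> {t 0..t m}" for x
  proof -
    obtain j where j: "j < m" "x \<in> {t j..t (Suc j)}" using in_piece[OF x] .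
    have "Suc j mod m < m" using m_pos by simp
    then show ?thesis
      using cases[OF j(2)] gap_le[OF j(1), of x] right_le[OF j(1), of x] left_le[OF j(1), of x]
        CR[OF j(1)] CR[of "Suc j mod m"] by fastforce
  qed
  have h_eq: "h x = q l \<mu> x * g (u x)" if x: "x \<in> {t 0..t m}" for x
  proof -
    obtain j where j: "j < m" "x \<in> {t j..t (Suc j)}" using in_piece[OF x] .
    have "min (u x) (if in_gap x then C * R else C * s (node x)) = u x"
      using cases[OF j(2)]
    proof (elim disjE)
      assume "x \<in> {t j..\<tau> j}"
      then show ?thesis using node_right[OF j(1)] right_le[OF j(1)] by simp
    next
      assume "x \<in> {\<tau> j<..<\<sigma> (Suc j)}"
      then show ?thesis using in_gapI[OF j(1)] gap_le[OF j(1), of x] by simp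
    next
      assume "x \<in> {\<sigma> (Suc j)..t (Suc j)}"
      then show ?thesis using node_left[OF j(1)] left_le[OF j(1)] by simp
    qed
    then show ?thesis using h[of x] u_nonneg[OF x] by (simp add: gx_eq)
  qed
  have p_eq: "p j = v (t j)" if "j < m" for j
    using that
  proof (induction j)
    case (Suc j)
    have "p (Suc j) = p j - integral {t j..t (Suc j)} h" using nokink[of j] Suc.prems by simp
    moreover have "integral {t 0..t (Suc j)} h = integral {t 0..t j} h + integral {t j..t (Suc j)} h"
      using t_in[of j] t_in[of "Suc j"] t_step[of j] Suc.prems by (intro integral_split[OF hint]) auto
    ultimately show ?case using Suc by (simp add: v_def)
  qed (simp add: v_def)
  have v_inc: "v y - v x = - integral {x..y} h" if "t 0 \<le> x" "x \<le> y" "y \<le> t m" for x y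
    using integral_split[OF hint that] by (simp add: v_def)
  have v_cont: "continuous_on {t 0..t m} v"
    unfolding v_def by (intro continuous_intros indefinite_integral_continuous_1 hint)
  have v_int: "v integrable_on {x..y}" if "t 0 \<le> x" "y \<le> t m" for x y
    using that by (intro integrable_continuous_real continuous_on_subset[OF v_cont]) auto
  \<comment> \<open>Differentiability of \<open>u\<close> is known on each piece separately, so the
    increments are assembled by induction over the nodes; \<open>p_eq\<close> identifies the slopes
    of every piece with the single continuous function \<open>v\<close>.\<close>
  have u_inc: "\<forall>x y. t 0 \<le> x \<longrightarrow> x \<le> y \<longrightarrow> y \<le> t k \<longrightarrow> u y - u x = integral {x..y} v" if "k \<le> m" for k
    using that
  proof (induction k)
    case 0
    have "u y - u x = integral {x..y} v" if "t 0 \<le> x" "x \<le> y" "y \<le> t 0" for x y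
    proof -
      have "x = y" using that by linarith
      then show ?thesis by simp
    qed
    then show ?case by blast
  next
    case (Suc k)
    have k: "k < m" using Suc.prems by simp
    have tk: "t 0 \<le> t k" "t k \<le> t (Suc k)" "t (Suc k) \<le> t m"
      using t_in[of k] t_in[of "Suc k"] t_step[OF k] k by auto
    have inc: "u y - u x = integral {x..y} v" if xy: "t k \<le> x" "x \<le> y" "y \<le> t (Suc k)" for x y
    proof (rule integral_unique[symmetric], rule fundamental_theorem_of_calculus[OF xy(2)])
      fix z assume z: "z \<in> {x..y}"
      have "v z = p k - integral {t k..z} h"
        using v_inc[of "t k" z] p_eq[OF k] z xy tk by simp
      moreover have "(u has_real_derivative p k - integral {t k..z} h) (at z within {t k..t (Suc k)})"
        using P[OF k] z xy by (auto simp: piece_def)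
      ultimately have "(u has_real_derivative v z) (at z within {x..y})"
        using xy by (auto intro: DERIV_subset)
      then show "(u has_vector_derivative v z) (at z within {x..y})"
        by (simp add: has_real_derivative_iff_has_vector_derivative)
    qed
    show ?case
    proof (intro allI impI)
      fix x y assume xy: "t 0 \<le> x" "x \<le> y" "y \<le> t (Suc k)"
      show "u y - u x = integral {x..y} v"
      proof (cases "t k \<le> x \<or> y \<le> t k")
        case False
        have "integral {x..y} v = integral {x..t k} v + integral {t k..y} v"
          by (rule integral_split[OF v_int[of x y]]) (use xy tk False in auto)
        moreover have "u (t k) - u x = integral {x..t k} v" using Suc xy False by auto
        moreover have "u y - u (t k) = integral {t k..y} v" using inc xy False by auto
        ultimately show ?thesis by simp
      qed (use Suc inc xy in auto)
    qed
  qed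
  have "u (t m) = u (t 0)" using us(2)[of "m - 1"] us(1)[of 0] m_pos by simp
  moreover have "v (t m) = v (t 0)"
  proof -
    have "p 0 = p (m - 1) - integral {t (m - 1)..t m} h" using nokink[of "m - 1"] m_pos by simp
    moreover have "v (t m) - v (t (m - 1)) = - integral {t (m - 1)..t m} h"
      using t_in[of "m - 1"] by (intro v_inc) auto
    ultimately show ?thesis using p_eq[of "m - 1"] p_eq[of 0] m_pos by simp
  qed
  ultimately show "periodic_orbit l \<mu> u (\<lambda>x. p 0 - integral {t 0..x} h) h"
    unfolding v_def[abs_def, symmetric] periodic_orbit_def
    using hint v_cont u_nonneg h_eq u_inc[of m] v_inc by blast
qed

lemma lobe_ratio: "\<forall>\<^sub>F C in at_top. \<forall>(i, j)\<in>{..<m} \<times> {..<m}.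
    \<tau> j - t j \<le> (C - 1) * (t (Suc i) - \<sigma> (Suc i)) \<and> t (Suc i) - \<sigma> (Suc i) \<le> (C - 1) * (\<tau> j - t j)"
proof (intro eventually_ball_finite ballI)
  have *: "\<forall>\<^sub>F C in at_top. y \<le> (C - 1) * x" if "0 < x" for x y :: real
    using eventually_ge_at_top[of "y / x + 1"]
  proof eventually_elim
    case (elim C)
    then have "y / x \<le> C - 1" by simp
    then show ?case using that by (simp add: pos_divide_le_eq)
  qed
  fix z assume "z \<in> {..<m} \<times> {..<m}"
  then obtain i j where z: "z = (i, j)" "i < m" "j < m" by auto
  have pos: "0 < \<tau> j - t j" "0 < t (Suc i) - \<sigma> (Suc i)" using ord z by auto
  show "\<forall>\<^sub>F C in at_top. case z of (i, j) \<Rightarrow> \<tau> j - t j \<le> (C - 1) * (t (Suc i) - \<sigma> (Suc i)) \<and>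
      t (Suc i) - \<sigma> (Suc i) \<le> (C - 1) * (\<tau> j - t j)"
    unfolding z(1) prod.case by (intro eventually_conj * pos)
qed simp

section \<open>Realising a prescribed string\<close>

text \<open>Upper bounds are non-strict but leave room (\<open>r / 2\<close>,
  \<open>\<rho> / 2\<close>, \<open>R - 1\<close>), so that suprema over lobes remain strictly below
  the required levels; the lower bounds are already witnessed by the node.\<close>

definition tracks :: "real \<Rightarrow> real \<Rightarrow> real \<Rightarrow> (nat \<Rightarrow> nat) \<Rightarrow> (real \<Rightarrow> real) \<Rightarrow> bool"
  where "tracks r \<rho> R S u \<longleftrightarrow> (\<forall>j<m.
    (S j = 0 \<longrightarrow> (\<forall>x\<in>half_lobes j. u x \<le> r / 2)) \<and>
    (S j = 1 \<longrightarrow> r < u (t j) \<and> (\<forall>x\<in>half_lobes j. u x \<le> \<rho> / 2)) \<and>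
    (S j = 2 \<longrightarrow> \<rho> < u (t j) \<and> (\<forall>x\<in>half_lobes j. u x \<le> R - 1)))"

text \<open>Every estimate is an eventual statement at finitely many levels, and the levels are
  known before the parameter grows: \<open>\<rho>1\<close>, \<open>\<rho>2\<close> before
  \<open>l\<close>, and \<open>r0\<close>, \<open>r1\<close>, \<open>R1\<close>, which depend on
  \<open>l\<close>, before \<mu>. Uniformity in \<open>S\<close> is automatic because the levels do
  not depend on the string.\<close>

theorem orbits_follow_strings:
  assumes \<rho>: "0 < \<rho>"
  shows "\<exists>l0>0. \<forall>l>l0. \<exists>r R. 0 < r \<and> r < \<rho> \<and> \<rho> < R \<and> (\<exists>\<mu>0>0. \<forall>\<mu>>\<mu>0. \<forall>S :: nat \<Rightarrow> nat.
    (\<forall>j<m. S j \<in> {0, 1, 2}) \<longrightarrow> (\<exists>u v h. periodic_orbit l \<mu> u v h \<and> tracks r \<rho> R S u))"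
proof -
  obtain C where C1: "1 \<le> C" and C2: "\<forall>(i, j)\<in>{..<m} \<times> {..<m}.
    \<tau> j - t j \<le> (C - 1) * (t (Suc i) - \<sigma> (Suc i)) \<and> t (Suc i) - \<sigma> (Suc i) \<le> (C - 1) * (\<tau> j - t j)"
    using eventually_conj[OF lobe_ratio eventually_ge_at_top[of "1::real"]]
    by (auto simp: eventually_at_top_linorder)
  have ratio: "\<tau> j - t j \<le> (C - 1) * (t (Suc i) - \<sigma> (Suc i)) \<and>
      t (Suc i) - \<sigma> (Suc i) \<le> (C - 1) * (\<tau> j - t j)" if "i < m" "j < m" for i j
    using C2 that by auto
  \<comment> \<open>\<open>C * \<rho>1 = \<rho> / 2\<close> keeps the whole lobe below \<rho> when
    the nodal value is at most \<open>\<rho>1\<close>; a nodal value of at least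
    \<open>\<rho>2\<close> exceeds \<rho> by itself.\<close>
  define \<rho>1 \<rho>2 where "\<rho>1 = \<rho> / (2 * C)" and "\<rho>2 = 2 * \<rho>"
  have \<rho>1: "0 < \<rho>1" "\<rho>1 < \<rho>" "C * \<rho>1 = \<rho> / 2" using \<rho> C1 by (auto simp: \<rho>1_def field_simps)
  have \<rho>2: "0 < \<rho>2" "\<rho> < \<rho>2" using \<rho> by (auto simp: \<rho>2_def)
  \<comment> \<open>The first clause concerns the right part of lobe \<open>j\<close>, the second
    the left part of the lobe after it. At a node they are used with its own index and with that of
    its predecessor; the same holds for \<open>escapes\<close> below.\<close>
  define crash where "crash l j s \<longleftrightarrow>
     (\<forall>u p h. h integrable_on {t j..\<tau> j} \<longrightarrow>
      (\<forall>x\<in>{t j..\<tau> j}. (u has_real_derivative p - integral {t j..x} h) (at x within {t j..\<tau> j})) \<longrightarrow>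
      (\<forall>x\<in>{t j..\<tau> j}. h x = l * ap x * gx (min (u x) (C * s))) \<longrightarrow>
      u (t j) = s \<longrightarrow> 0 \<le> u (\<tau> j) \<longrightarrow> 0 < p) \<and>
     (\<forall>u q h. h integrable_on {\<sigma> (Suc j)..t (Suc j)} \<longrightarrow>
      (\<forall>x\<in>{\<sigma> (Suc j)..t (Suc j)}.
        (u has_real_derivative q + integral {x..t (Suc j)} h) (at x within {\<sigma> (Suc j)..t (Suc j)})) \<longrightarrow>
      (\<forall>x\<in>{\<sigma> (Suc j)..t (Suc j)}. h x = l * ap x * gx (min (u x) (C * s))) \<longrightarrow>
      u (t (Suc j)) = s \<longrightarrow> 0 \<le> u (\<sigma> (Suc j)) \<longrightarrow> q < 0)" for l j s
  have "\<forall>\<^sub>F l in at_top. \<forall>j\<in>{..<m}. \<forall>s\<in>{\<rho>1, \<rho>2}. crash l j s"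
    using \<rho>1(1) \<rho>2(1) C1 unfolding crash_def
    by (intro eventually_ball_finite ballI eventually_conj crash_right crash_left) auto
  then obtain l1 where l1: "\<And>l j s. l1 \<le> l \<Longrightarrow> j < m \<Longrightarrow> s \<in> {\<rho>1, \<rho>2} \<Longrightarrow> crash l j s"
    unfolding eventually_at_top_linorder by fast
  show ?thesis
  proof (rule exI[of _ "max 1 l1"], intro conjI allI impI)
    fix l assume "max 1 l1 < l"
    then have l: "0 < l" and crash: "\<And>j s. j < m \<Longrightarrow> s \<in> {\<rho>1, \<rho>2} \<Longrightarrow> crash l j s"
      using l1 by auto
    obtain \<epsilon> where \<epsilon>: "0 < \<epsilon>"
      "\<And>s. 0 < s \<Longrightarrow> s < \<epsilon> \<Longrightarrow> \<exists>G. (\<forall>y\<in>{0..C * s}. g y \<le> G) \<and> l * G * A \<le> s / (2 * T)"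
      using low_small[OF l C1] by blast
    obtain S0 where S0:
      "\<And>s. S0 \<le> s \<Longrightarrow> \<exists>G. (\<forall>y\<in>{0..C * s}. g y \<le> G) \<and> l * G * A \<le> s / (2 * T)"
      using low_large[OF l C1] by blast
    \<comment> \<open>The level \<open>r\<close> separates symbols 0 and 1: lobes with nodal value
      at most \<open>r0\<close> stay below \<open>C * r0 = r / 2\<close>, while
      \<open>r1 > r\<close>. Likewise \<open>R\<close> exceeds the lobe bound \<open>C * R1\<close>
      by 1.\<close>
    define r1 where "r1 = min \<epsilon> \<rho>1 / 2"
    define r where "r = r1 / 2"
    define r0 where "r0 = r / (2 * C)"
    define R1 where "R1 = max S0 \<rho>2"
    define R where "R = C * R1 + 1"
    have r1: "0 < r1" "r1 < \<epsilon>" "r1 < \<rho>1" using \<epsilon>(1) \<rho>1 by (auto simp: r1_def)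
    have r: "0 < r" "r < r1" using r1 by (auto simp: r_def)
    have r0: "0 < r0" "r0 < r" "C * r0 = r / 2" using r C1 by (auto simp: r0_def field_simps)
    have R1: "S0 \<le> R1" "\<rho>2 \<le> R1" by (auto simp: R1_def)
    have CR1: "R1 \<le> C * R1" using C1 R1 \<rho>2 by simp
    have low: "\<exists>G. (\<forall>y\<in>{0..C * s}. g y \<le> G) \<and> l * G * A \<le> s / (2 * T)" if "s \<in> {r0, r1, R1}" for s
    proof -
      have "0 < s \<and> s < \<epsilon> \<or> S0 \<le> s" using that r0(1,2) r r1 R1 by auto
      then show ?thesis using \<epsilon>(2) S0 by blast
    qed
    have s_range: "0 < s" "s \<le> R1" if "s \<in> {r0, r1, R1}" for s
      using that r0(1,2) r r1 \<rho>1(1,2) \<rho>2 R1 by auto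
    define escapes where "escapes \<mu> j s \<longleftrightarrow> (\<forall>u p h K. K \<le> C * R1 \<longrightarrow>
      (piece l \<mu> j (C * s) (C * R1) K u p h \<longrightarrow> u (t j) = s \<longrightarrow> u (t (Suc j)) \<le> R1 \<longrightarrow> p < 0) \<and>
      (piece l \<mu> j K (C * R1) (C * s) u p h \<longrightarrow> u (t (Suc j)) = s \<longrightarrow> u (t j) \<le> R1 \<longrightarrow>
        0 < p - integral {t j..t (Suc j)} h))" for \<mu> j s
    have "\<forall>\<^sub>F \<mu> in at_top. escapes \<mu> j s" if j: "j < m" and s: "s \<in> {r0, r1, R1}" for j s
    proof -
      obtain G where G: "\<And>y. y \<in> {0..C * s} \<Longrightarrow> g y \<le> G" "l * G * A \<le> s / (2 * T)"
        using low[OF s] by blast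
      have "0 \<le> C * s" "C * s \<le> C * R1" using s_range[OF s] C1 by auto
      moreover have "s \<le> C * R1" using s_range[OF s] CR1 by linarith
      ultimately show ?thesis unfolding escapes_def using j s_range[OF s] l G by (intro escape) auto
    qed
    then have "\<forall>\<^sub>F \<mu> in at_top. \<forall>j\<in>{..<m}. \<forall>s\<in>{r0, r1, R1}. escapes \<mu> j s"
      by (intro eventually_ball_finite ballI) auto
    then obtain \<mu>1 where \<mu>1: "\<And>\<mu> j s. \<mu>1 \<le> \<mu> \<Longrightarrow> j < m \<Longrightarrow> s \<in> {r0, r1, R1} \<Longrightarrow> escapes \<mu> j s"
      unfolding eventually_at_top_linorder by fast
    have main: "\<exists>u v h. periodic_orbit l \<mu> u v h \<and> tracks r \<rho> R S u"
      if \<mu>: "max 1 \<mu>1 < \<mu>" and S: "\<forall>j<m. S j \<in> {0, 1, 2}" for \<mu> and S :: "nat \<Rightarrow> nat"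
    proof -
      have esc: "escapes \<mu> j s" if "j < m" "s \<in> {r0, r1, R1}" for j s using \<mu>1 \<mu> that by auto
      define lo where "lo j = (if S j = 0 then 0 else if S j = 1 then r1 else \<rho>2)" for j
      define hi where "hi j = (if S j = 0 then r0 else if S j = 1 then \<rho>1 else R1)" for j
      \<comment> \<open>The kink will turn out negative at \<open>r0\<close>, \<open>r1\<close>,
        \<open>R1\<close>, positive at \<open>\<rho>1\<close>, \<open>\<rho>2\<close> and
        nonnegative at 0. It is thus negative at the lower and positive at the upper end for symbol
        1, and the other way round (up to equality at 0) for symbols 0 and 2; with these signs both
        end alternatives of \<open>kink\<close> are contradictory.\<close>
      define e :: "nat \<Rightarrow> real" where "e j = (if S j = 1 then - 1 else 1)" for j
      have box: "0 \<le> lo i \<and> lo i \<le> hi i \<and> hi i \<le> R1" for i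
        using r0(1,2) r r1 \<rho>1(1,2) \<rho>2 R1 by (auto simp: lo_def hi_def)
      have e0: "e i \<noteq> 0" for i by (simp add: e_def)
      obtain u s p h where sB: "s \<in> box_upto m lo hi" and hint: "h integrable_on {t 0..t m}"
        and us: "\<And>j. j < m \<Longrightarrow> u (t j) = s j" "\<And>j. j < m \<Longrightarrow> u (t (Suc j)) = s (Suc j mod m)"
        and P: "\<And>j. j < m \<Longrightarrow> piece l \<mu> j (C * s j) (C * R1) (C * s (Suc j mod m)) u (p j) h"
        and h: "\<And>x. h x = q l \<mu> x * gx (min (u x) (if in_gap x then C * R1 else C * s (node x)))"
        and kink: "\<And>j i D. \<lbrakk>j < m; i = Suc j mod m; D = p i - (p j - integral {t j..t (Suc j)} h)\<rbrakk>
          \<Longrightarrow> D = 0 \<or> s i = lo i \<and> e i * D < 0 \<or> s i = hi i \<and> e i * D > 0"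
        by (rule truncated_solution[of C lo hi R1 e l \<mu>, OF C1 box e0]) (rule that, assumption+)
      have s: "0 \<le> s j \<and> s j \<le> R1" "lo j \<le> s j" "s j \<le> hi j" if "j < m" for j
        using sB box[of j] that by (force simp: box_upto_def)+
      have sucm: "Suc j mod m < m" for j using m_pos by simp
      have nn: "0 \<le> u x" if "j < m" "x \<in> {t j..t (Suc j)}" for j x
        using us[OF that(1)] s(1)[OF sucm, of j] s(1)[OF that(1)]
        by (intro piece_nonneg[OF P[OF that(1)] _ _ that]) simp_all
      have nokink: "p (Suc j mod m) = p j - integral {t j..t (Suc j)} h" if j: "j < m" for j
      proof -
        define i where "i = Suc j mod m"
        define qj where "qj = p j - integral {t j..t (Suc j)} h"
        have i: "i < m" by (simp add: i_def sucm)
        note oi = ord[OF i] and oj = ord[OF j]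
        have Pi: "piece l \<mu> i (C * s i) (C * R1) (C * s (Suc i mod m)) u (p i) h" by (rule P[OF i])
        have Pj: "piece l \<mu> j (C * s j) (C * R1) (C * s i) u (p j) h" unfolding i_def by (rule P[OF j])
        have CsR: "C * s k \<le> C * R1" if "k < m" for k using s(1)[OF that] C1 by simp
        \<comment> \<open>The neighbouring nodal values are at most \<open>R1\<close>, so neither
          adjacent gap has thrown \<open>u\<close> above \<open>R1\<close>; \<open>escapes\<close>
          then gives a strict sign for the slope on each side.\<close>
        have lowD: "p i < qj" if "s i \<in> {r0, r1, R1}"
        proof -
          have "p i < 0"
            using esc[OF i that] Pi us[OF i] s(1)[OF sucm, of i] CsR[OF sucm, of i] unfolding escapes_def by auto
          moreover have "0 < qj"
            using esc[OF j that] Pj us[OF j] s(1)[OF j] CsR[OF j] unfolding escapes_def qj_def i_def by auto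
          ultimately show ?thesis by simp
        qed
        have highD: "qj < p i" if "s i \<in> {\<rho>1, \<rho>2}"
        proof -
          have "0 < p i"
          proof (rule conjunct1[OF crash[OF i that, unfolded crash_def], rule_format])
            show "h integrable_on {t i..\<tau> i}"
              using Pi oi by (auto simp: piece_def intro: integrable_on_subinterval)
            show "(u has_real_derivative p i - integral {t i..x} h) (at x within {t i..\<tau> i})"
              if "x \<in> {t i..\<tau> i}" for x
            proof (rule DERIV_subset)
              show "(u has_real_derivative p i - integral {t i..x} h) (at x within {t i..t (Suc i)})"
                using Pi oi that by (auto simp: piece_def)
            qed (use oi in auto)
          qed (use Pi us[OF i] nn[OF i, of "\<tau> i"] oi in \<open>auto simp: piece_def\<close>)
          moreover have "qj < 0"
          proof (rule conjunct2[OF crash[OF j that, unfolded crash_def], rule_format])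
            show "h integrable_on {\<sigma> (Suc j)..t (Suc j)}"
              using Pj oj by (auto simp: piece_def intro: integrable_on_subinterval)
            show "(u has_real_derivative qj + integral {x..t (Suc j)} h) (at x within {\<sigma> (Suc j)..t (Suc j)})"
              if "x \<in> {\<sigma> (Suc j)..t (Suc j)}" for x
              unfolding qj_def using oj that by (auto intro!: DERIV_subset[OF piece_derivative_end[OF Pj]])
          qed (use Pj us[OF j] nn[OF j, of "\<sigma> (Suc j)"] oj i_def in \<open>auto simp: piece_def\<close>)
          ultimately show ?thesis by simp
        qed
        have zeroD: "qj \<le> p i" if s0: "s i = 0"
        proof -
          have "0 \<le> p i"
          proof (rule ccontr)
            assume "\<not> 0 \<le> p i"
            moreover have "(u has_real_derivative p i) (at (t i) within {t i..t (Suc i)})"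
              using Pi t_step[OF i] by (force simp: piece_def)
            ultimately obtain d where d: "0 < d"
              "\<And>k. 0 < k \<Longrightarrow> t i + k \<in> {t i..t (Suc i)} \<Longrightarrow> k < d \<Longrightarrow> u (t i + k) < u (t i)"
              using has_real_derivative_neg_dec_right[of u "p i" "t i" "{t i..t (Suc i)}"] by auto
            define k where "k = min (d / 2) (t (Suc i) - t i)"
            have "0 < k" "k < d" "t i + k \<in> {t i..t (Suc i)}" using d(1) t_step[OF i] by (auto simp: k_def)
            then show False using d(2)[of k] nn[OF i, of "t i + k"] us(1)[OF i] s0 by simp
          qed
          moreover have "qj \<le> 0"
          proof (rule ccontr)
            assume "\<not> qj \<le> 0"
            moreover have "(u has_real_derivative qj) (at (t (Suc j)) within {t j..t (Suc j)})"
              using piece_derivative_end[OF Pj, of "t (Suc j)"] t_step[OF j] by (simp add: qj_def)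
            ultimately obtain d where d: "0 < d"
              "\<And>k. 0 < k \<Longrightarrow> t (Suc j) - k \<in> {t j..t (Suc j)} \<Longrightarrow> k < d \<Longrightarrow> u (t (Suc j) - k) < u (t (Suc j))"
              using has_real_derivative_pos_inc_left[of u qj "t (Suc j)" "{t j..t (Suc j)}"] by auto
            define k where "k = min (d / 2) (t (Suc j) - t j)"
            have "0 < k" "k < d" "t (Suc j) - k \<in> {t j..t (Suc j)}" using d(1) t_step[OF j] by (auto simp: k_def)
            then show False using d(2)[of k] nn[OF j, of "t (Suc j) - k"] us(2)[OF j] s0 by (simp add: i_def)
          qed
          ultimately show ?thesis by simp
        qed
        have alt: "p i - qj = 0 \<or> s i = lo i \<and> e i * (p i - qj) < 0 \<or> s i = hi i \<and> e i * (p i - qj) > 0"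
          by (rule kink[OF j i_def]) (simp add: qj_def)
        have "S i = 0 \<or> S i = 1 \<or> S i = 2" using S i by auto
        then have "p i - qj = 0"
        proof (elim disjE)
          assume "S i = 0"
          then show ?thesis using alt lowD zeroD by (auto simp: lo_def hi_def e_def)
        next
          assume "S i = 1"
          then show ?thesis using alt lowD highD by (auto simp: lo_def hi_def e_def)
        next
          assume "S i = 2"
          then show ?thesis using alt lowD highD by (auto simp: lo_def hi_def e_def)
        qed
        then show ?thesis by (simp add: i_def qj_def)
      qed
      note sol = unkinked_solution[OF C1 less_imp_le[OF l] _ ratio s(1) hint us P h nokink]
      have \<mu>0: "0 \<le> \<mu>" using \<mu> by simp
      show ?thesis
        unfolding tracks_def
      proof (rule exI[of _ u], rule exI[of _ "\<lambda>x. p 0 - integral {t 0..x} h"], rule exI[of _ h],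
          intro conjI allI impI ballI)
        show "periodic_orbit l \<mu> u (\<lambda>x. p 0 - integral {t 0..x} h) h" using sol(1) \<mu>0 by blast
        fix j assume j: "j < m"
        have le: "u x \<le> C * s j" if "x \<in> half_lobes j" for x using sol(2) \<mu>0 j that by blast
        have mono: "C * s j \<le> C * hi j" using s(3)[OF j] C1 by simp
        show "u x \<le> r / 2" if "S j = 0" "x \<in> half_lobes j" for x
          using le[OF that(2)] mono r0 that(1) by (simp add: hi_def)
        show "r < u (t j)" if "S j = 1" using s(2)[OF j] us(1)[OF j] that r by (simp add: lo_def)
        show "u x \<le> \<rho> / 2" if "S j = 1" "x \<in> half_lobes j" for x
          using le[OF that(2)] mono \<rho>1 that(1) by (simp add: hi_def)
        show "\<rho> < u (t j)" if "S j = 2" using s(2)[OF j] us(1)[OF j] that \<rho>2 by (simp add: lo_def)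
        show "u x \<le> R - 1" if "S j = 2" "x \<in> half_lobes j" for x
          using le[OF that(2)] mono that(1) by (simp add: hi_def R_def)
      qed
    qed
    have "0 < r" "r < \<rho>" "\<rho> < R" using r r1 \<rho>1(1,2) \<rho>2 R1 CR1 unfolding R_def by linarith+
    moreover have "(0::real) < max 1 \<mu>1" by simp
    ultimately show "\<exists>r R. 0 < r \<and> r < \<rho> \<and> \<rho> < R \<and> (\<exists>\<mu>0>0. \<forall>\<mu>>\<mu>0. \<forall>S :: nat \<Rightarrow> nat.
      (\<forall>j<m. S j \<in> {0, 1, 2}) \<longrightarrow> (\<exists>u v h. periodic_orbit l \<mu> u v h \<and> tracks r \<rho> R S u))"
      using main by blast
  qed auto
qed

section \<open>Periodic extension and counting\<close>

text \<open>Near 0 the quotient \<open>g z / z\<close> is below 1, and away from 0 boundedness of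
  \<open>g\<close> suffices. This replaces a Lipschitz condition in the uniqueness argument for the
  zero solution.\<close>

lemma g_linear_bound: "\<exists>L\<ge>0. \<forall>z\<in>{0..B}. g z \<le> L * z"
proof -
  have "\<forall>\<^sub>F y in at_right 0. g y / y < 1" using order_tendstoD(2)[OF g_lim_0] by simp
  then obtain b where b: "0 < b" "\<And>y. 0 < y \<Longrightarrow> y < b \<Longrightarrow> g y / y < 1"
    by (auto simp: eventually_at_right_field)
  obtain G where G: "0 \<le> G" "\<And>z. z \<le> B \<Longrightarrow> gx z \<le> G" using gx_bounded_above by blast
  show ?thesis
  proof (intro exI[of _ "1 + G / b"] conjI ballI)
    fix z assume z: "z \<in> {0..B}"
    have Gz: "0 \<le> G / b * z" using G b z by simp
    consider "z = 0" | "0 < z" "z < b" | "b \<le> z" using z by fastforce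
    then show "g z \<le> (1 + G / b) * z"
    proof cases
      case 2
      then have "g z < z" using b(2)[of z] by simp
      then show ?thesis using Gz by (simp add: distrib_right)
    next
      case 3
      have "g z \<le> G" using G(2)[of z] z by (simp add: gx_eq)
      also have "G \<le> G / b * z" using mult_left_mono[OF 3, of "G / b"] G b by simp
      finally show ?thesis using z by (simp add: distrib_right)
    qed (simp add: g_zero)
  qed (use G b in auto)
qed

text \<open>One positive value upgrades nonnegativity to positivity: a zero of the periodic
  extension would propagate to the right up to some translate of \<open>x0\<close>.\<close>

lemma orbit_extends:
  assumes orbit: "periodic_orbit l \<mu> u v h"
    and pos: "x0 \<in> {t 0..t m}" "0 < u x0"
    and per: "\<And>x. ap (x + T) = ap x" "\<And>x. an (x + T) = an x"
    and q: "AE x in lebesgue. x \<in> {t 0..t m} \<longrightarrow> q l \<mu> x = l * ap x - \<mu> * an x"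
  obtains U where "positive_periodic_solution T (\<lambda>x. l * ap x - \<mu> * an x) g U"
    "\<And>x. x \<in> {t 0..t m} \<Longrightarrow> U x = u x"
proof -
  define W where "W x = l * ap x - \<mu> * an x" for x
  define wrap where "wrap x = t 0 + T * frac ((x - t 0) / T)" for x
  define U where "U x = u (wrap x)" for x
  define V where "V x = v (wrap x)" for x
  define hh where "hh x = W x * g (U x)" for x
  have vc: "continuous_on {t 0..t m} v"
    and u0: "\<And>x. x \<in> {t 0..t m} \<Longrightarrow> 0 \<le> u x" and h: "\<And>x. x \<in> {t 0..t m} \<Longrightarrow> h x = q l \<mu> x * g (u x)"
    and u_inc: "\<And>x y. \<lbrakk>t 0 \<le> x; x \<le> y; y \<le> t m\<rbrakk> \<Longrightarrow> u y - u x = integral {x..y} v"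
    and v_inc: "\<And>x y. \<lbrakk>t 0 \<le> x; x \<le> y; y \<le> t m\<rbrakk> \<Longrightarrow> v y - v x = - integral {x..y} h"
    and ends: "u (t m) = u (t 0)" "v (t m) = v (t 0)"
    using orbit by (auto simp: periodic_orbit_def)
  have wrap_per: "wrap (x + T) = wrap x" for x
  proof -
    have "(x + T - t 0) / T = (x - t 0) / T + 1" using T_pos by (simp add: field_simps)
    then show ?thesis by (simp add: wrap_def frac_def)
  qed
  have wrap_in: "wrap x \<in> {t 0..t m}" for x
    using T_pos frac_ge_0[of "(x - t 0) / T"] frac_lt_1[of "(x - t 0) / T"] t_m
    by (simp add: wrap_def mult_left_le)
  have wrap_id: "wrap x = x" if "t 0 \<le> x" "x < t m" for x
  proof -
    have "0 \<le> (x - t 0) / T" "(x - t 0) / T < 1" using that T_pos t_m by auto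
    then have "frac ((x - t 0) / T) = (x - t 0) / T" by (simp add: frac_eq)
    then show ?thesis using T_pos by (simp add: wrap_def)
  qed
  have wrap_end: "wrap (t m) = t 0" using wrap_per[of "t 0"] wrap_id[of "t 0"] t_m T_pos by simp
  \<comment> \<open>At \<open>t m\<close> the wrapped argument jumps back to \<open>t 0\<close>,
    where \<open>u\<close> and \<open>v\<close> take the same values.\<close>
  have UV: "U x = u x" "V x = v x" if "x \<in> {t 0..t m}" for x
  proof -
    have "wrap x = x \<or> x = t m \<and> wrap x = t 0" using wrap_id[of x] wrap_end that by force
    then show "U x = u x" "V x = v x" using ends by (auto simp: U_def V_def)
  qed
  have W_per: "W (x + T) = W x" and U_per: "U (x + T) = U x" and V_per: "V (x + T) = V x" for x
    by (simp_all add: W_def per U_def V_def wrap_per)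
  have hh_per: "hh (x + T) = hh x" for x by (simp add: hh_def W_per U_per)
  have U0: "0 \<le> U x" for x using u0[OF wrap_in] by (simp add: U_def)
  have v_int: "v integrable_on {t 0..t m}" by (rule integrable_continuous_real[OF vc])
  have uc: "continuous_on {t 0..t m} u"
  proof -
    have "continuous_on {t 0..t m} (\<lambda>x. u (t 0) + integral {t 0..x} v)"
      by (intro continuous_intros indefinite_integral_continuous_1 v_int)
    moreover have "u (t 0) + integral {t 0..x} v = u x" if "x \<in> {t 0..t m}" for x
      using u_inc[of "t 0" x] that by simp
    ultimately show ?thesis by (rule continuous_on_eq)
  qed
  have guc: "continuous_on {t 0..t m} (\<lambda>x. g (u x))"
    by (rule continuous_on_compose2[OF g_cont uc]) (use u0 in auto)
  have W_int: "W absolutely_integrable_on {x..y}" for x y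
    unfolding W_def[abs_def] using ap_int an_int
    by (intro set_integral_diff set_integrable_mult_right) auto
  have hh_ai: "hh absolutely_integrable_on {t 0..t m}"
  proof -
    have "(\<lambda>x. g (u x) * W x) absolutely_integrable_on {t 0..t m}"
    proof (rule absolutely_integrable_bounded_measurable_product_real[OF _ _ _ W_int])
      show "(\<lambda>x. g (u x)) \<in> borel_measurable (lebesgue_on {t 0..t m})"
        by (rule continuous_imp_measurable_on_sets_lebesgue[OF guc]) auto
      show "bounded ((\<lambda>x. g (u x)) ` {t 0..t m})"
        by (intro compact_imp_bounded compact_continuous_image guc) auto
    qed auto
    then show ?thesis
      by (rule set_integrable_cong[THEN iffD1, rotated -1]) (auto simp: hh_def UV)
  qed
  \<comment> \<open>The null set on which \<open>q\<close> differs from the true weight; it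
    disappears in the integral formula for \<open>V\<close>.\<close>
  obtain N where N: "negligible N" and qW: "\<And>x. x \<in> {t 0..t m} - N \<Longrightarrow> q l \<mu> x = W x"
  proof -
    obtain N where "{x \<in> space lebesgue. \<not> (x \<in> {t 0..t m} \<longrightarrow> q l \<mu> x = l * ap x - \<mu> * an x)} \<subseteq> N"
      "emeasure lebesgue N = 0" "N \<in> sets lebesgue"
      using AE_E[OF q] by blast
    then show ?thesis
      using that[of N] by (auto simp: negligible_iff_null_sets null_sets_def W_def)
  qed
  have V_inc0: "V y - V x = integral {x..y} (\<lambda>x. - hh x)" if xy: "t 0 \<le> x" "x \<le> y" "y \<le> t 0 + T" for x y
  proof -
    have "integral {x..y} h = integral {x..y} hh"
      by (rule integral_spike[OF N]) (use xy t_m qW h in \<open>auto simp: hh_def UV\<close>)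
    then show ?thesis using v_inc[of x y] UV[of x] UV[of y] xy t_m by simp
  qed
  have U_inc0: "U y - U x = integral {x..y} V" if xy: "t 0 \<le> x" "x \<le> y" "y \<le> t 0 + T" for x y
  proof -
    have "integral {x..y} V = integral {x..y} v"
      by (rule Henstock_Kurzweil_Integration.integral_cong) (use xy t_m UV in auto)
    then show ?thesis using u_inc[of x y] UV[of x] UV[of y] xy t_m by simp
  qed
  have "(\<lambda>x. - hh x) absolutely_integrable_on {t 0..t 0 + T}"
    using set_integrable_mult_right[of "-1" lebesgue "{t 0..t m}" hh] hh_ai by (simp add: t_m)
  moreover have "- hh (x + T) = - hh x" for x by (simp add: hh_per)
  ultimately have V_ext: "(\<lambda>x. - hh x) absolutely_integrable_on {x..y}"
    "x \<le> y \<Longrightarrow> V y - V x = integral {x..y} (\<lambda>x. - hh x)" for x y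
    using increments_of_periodic[of T "\<lambda>x. - hh x" V "t 0" x y] T_pos V_per V_inc0 by blast+
  have V_ai: "V absolutely_integrable_on {t 0..t 0 + T}"
  proof -
    have "continuous_on {t 0..t m} V" by (rule continuous_on_eq[OF vc]) (simp add: UV)
    then show ?thesis unfolding t_m by (rule absolutely_integrable_continuous_real)
  qed
  have hh_ai': "hh absolutely_integrable_on {x..y}" for x y
    using set_integrable_mult_right[of "-1" lebesgue "{x..y}" "\<lambda>x. - hh x"] V_ext(1)[of x y] by simp
  have hh_int: "hh integrable_on {x..y}" for x y
    using hh_ai'[of x y] by (simp add: absolutely_integrable_on_def)
  have V_inc: "V y - V x = integral {x..y} (\<lambda>x. - hh x)" if "x \<le> y" for x y using V_ext(2)[OF that] .
  have U_inc: "U y - U x = integral {x..y} V" if "x \<le> y" for x y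
    using increments_of_periodic(2)[of T V U "t 0" x y] T_pos V_per U_per V_ai U_inc0 that by blast
  have V_cont: "continuous_on {x..y} V" for x y
  proof -
    have "continuous_on {x..y} (\<lambda>z. V x + integral {x..z} (\<lambda>x. - hh x))"
      by (intro continuous_intros indefinite_integral_continuous_1 integrable_neg hh_int)
    moreover have "V x + integral {x..z} (\<lambda>x. - hh x) = V z" if "z \<in> {x..y}" for z
      using V_inc[of x z] that by simp
    ultimately show ?thesis by (rule continuous_on_eq)
  qed
  have interior: "x \<in> interior {x - 1..x + 1}" for x :: real by simp
  have U_der: "(U has_real_derivative V x) (at x)" for x
  proof -
    have "((\<lambda>z. integral {x - 1..z} V) has_real_derivative V x) (at x within {x - 1..x + 1})"
      by (rule integral_has_real_derivative[OF V_cont]) simp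
    then have "((\<lambda>z. U (x - 1) + integral {x - 1..z} V) has_real_derivative V x) (at x within {x - 1..x + 1})"
      by (auto intro!: derivative_eq_intros)
    then have "(U has_real_derivative V x) (at x within {x - 1..x + 1})"
    proof (rule has_field_derivative_transform_within[OF _ zero_less_one])
      show "U (x - 1) + integral {x - 1..z} V = U z" if "z \<in> {x - 1..x + 1}" for z
        using U_inc[of "x - 1" z] that by simp
    qed simp
    then show ?thesis using at_within_interior[OF interior] by metis
  qed
  have V_UNIV: "continuous_on UNIV V"
    using continuous_on_interior[OF V_cont interior] by (auto intro!: continuous_at_imp_continuous_on)
  have deriv_U: "deriv U = V" using U_der by (auto intro!: DERIV_imp_deriv)
  have U_pos: "0 < U x" for x
  proof (rule ccontr)
    assume "\<not> 0 < U x"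
    then have Ux: "U x = 0" using U0[of x] by simp
    have shift: "U (x0 + real n * T) = U x0" for n
    proof (induction n)
      case (Suc n)
      have "x0 + real (Suc n) * T = (x0 + real n * T) + T" by (simp add: algebra_simps)
      then show ?case using Suc U_per by metis
    qed simp
    \<comment> \<open>A translate of \<open>x0\<close> to the right of the supposed zero, since
      zeros are propagated only in that direction.\<close>
    obtain n :: nat where "(x - x0) / T \<le> real n" using real_arch_simple by blast
    then have n: "x \<le> x0 + real n * T" using T_pos by (simp add: field_simps)
    obtain B where B: "\<And>x. x \<in> {t 0..t m} \<Longrightarrow> u x \<le> B"
      using continuous_attains_sup[OF compact_Icc _ uc] pos(1) by blast
    obtain L where L: "0 \<le> L" "\<And>z. z \<in> {0..B} \<Longrightarrow> g z \<le> L * z" using g_linear_bound by blast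
    have "U (x0 + real n * T) = 0"
    proof (rule zero_propagates[where U=U and V=V and h=hh and K="\<lambda>x. \<bar>W x\<bar> * L" and a=x and ?t0.0=x])
      show "V z - V y = - integral {y..z} hh" if "y \<le> z" for y z using V_inc[OF that] by simp
      show "(\<lambda>x. \<bar>W x\<bar> * L) integrable_on {x..x0 + real n * T}"
        using W_int[of x "x0 + real n * T"] by (intro integrable_on_mult_left) (simp add: absolutely_integrable_on_def)
      show "\<bar>hh y\<bar> \<le> \<bar>W y\<bar> * L * U y" for y
      proof -
        have "g (U y) \<le> L * U y" using B[OF wrap_in] U0[of y] by (intro L(2)) (simp add: U_def)
        then have "\<bar>W y\<bar> * g (U y) \<le> \<bar>W y\<bar> * (L * U y)" by (intro mult_left_mono) auto
        then show ?thesis using g_nonneg[OF U0[of y]] by (simp add: hh_def abs_mult mult.assoc)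
      qed
    qed (use U_der hh_int U0 L Ux n in auto)
    then show False using shift[of n] UV(1)[OF pos(1)] pos(2) by simp
  qed
  have "caratheodory_solution W g U"
    unfolding caratheodory_solution_def
  proof (intro conjI)
    show "U C1_differentiable_on UNIV"
      unfolding C1_differentiable_on_def
      using U_der V_UNIV by (auto simp: has_real_derivative_iff_has_vector_derivative)
    show "locally_absolutely_continuous (deriv U)"
      unfolding locally_absolutely_continuous_def deriv_U
    proof (intro allI integral_absolutely_continuous[OF hh_ai'])
      show "\<bar>V y - V x\<bar> \<le> \<bar>integral {x..y} hh\<bar>" if "x \<le> y" for x y using V_inc[OF that] by simp
    qed
    have "AE x in lebesgue. (V has_real_derivative - hh x) (at x)"
      by (rule AE_derivative_of_integral[OF _ V_inc]) (intro integrable_neg hh_int)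
    then show "AE x in lebesgue. deriv U differentiable (at x) \<and> deriv (deriv U) x + W x * g (U x) = 0"
    proof eventually_elim
      case (elim x)
      then have "deriv V x = - hh x" by (rule DERIV_imp_deriv)
      then show ?case using elim by (auto simp: deriv_U hh_def real_differentiable_def)
    qed
  qed
  then have "positive_periodic_solution T W g U"
    using U_per U_pos by (simp add: positive_periodic_solution_def)
  then show ?thesis using that[of U] UV(1) by (simp add: W_def[abs_def])
qed

lemma half_lobes_subset: "j < m \<Longrightarrow> half_lobes j \<subseteq> {t 0..t m}"
  using ord piece_subset by (fastforce simp: half_lobes_def)

end

section \<open>From the given weight to the locale, and counting strings\<close>

lemma integral_pos_of_ae_pos:
  assumes "ae_pos_on w {c..d}" and w: "w absolutely_integrable_on {c..d}"
  shows "0 < integral {c..d} (\<lambda>x. max (w x) 0)"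
proof -
  let ?f = "\<lambda>x. max (w x) 0"
  have f: "?f absolutely_integrable_on {c..d}"
    using absolutely_integrable_max_1[OF w, of "\<lambda>_. 0"] by (simp add: set_integrable_def)
  have "0 \<le> integral {c..d} ?f" by (rule integral_nonneg) (use f in \<open>auto simp: absolutely_integrable_on_def\<close>)
  moreover have "integral {c..d} ?f \<noteq> 0"
  proof
    assume "integral {c..d} ?f = 0"
    then have "(LINT x:{c..d}|lebesgue. ?f x) = 0" using set_lebesgue_integral_eq_integral(2)[OF f] by simp
    then have "AE x in lebesgue. indicator {c..d} x *\<^sub>R ?f x = 0"
      using f unfolding set_lebesgue_integral_def set_integrable_def
      by (subst (asm) integral_nonneg_eq_0_iff_AE) auto
    moreover have "AE x in lebesgue. x \<in> {c..d} \<longrightarrow> 0 \<le> w x" using assms(1) by (simp add: ae_pos_on_def)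
    ultimately have "AE x in lebesgue. x \<in> {c..d} \<longrightarrow> w x = 0"
      by eventually_elim (auto simp: indicator_def max_def split: if_splits)
    then show False using assms(1) by (simp add: ae_pos_on_def)
  qed
  ultimately show ?thesis by simp
qed

text \<open>Needed for the left part of lobe 0, which appears translated by the period at the end of
  the last piece.\<close>

lemma AE_lebesgue_translate:
  assumes "AE x in lebesgue. P x"
  shows "AE x in lebesgue. P (x - c :: real)"
proof -
  obtain N where N: "{x \<in> space lebesgue. \<not> P x} \<subseteq> N" "emeasure lebesgue N = 0" "N \<in> sets lebesgue"
    using AE_E[OF assms] by blast
  then have "negligible ((+) c ` N)"
    by (intro negligible_translation) (simp add: negligible_iff_null_sets null_sets_def)
  moreover have "{x. \<not> P (x - c)} \<subseteq> (+) c ` N"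
  proof
    fix x assume "x \<in> {x. \<not> P (x - c)}"
    then have "x - c \<in> N" using N(1) by auto
    then show "x \<in> (+) c ` N" by (intro image_eqI[of _ _ "x - c"]) auto
  qed
  ultimately show ?thesis by (intro AE_I'[of "(+) c ` N"]) (auto simp: negligible_iff_null_sets)
qed

lemma card_strings: "card {S \<in> {1..m} \<rightarrow>\<^sub>E {0, 1, 2::nat}. \<exists>i\<in>{1..m}. S i \<noteq> 0} = 3 ^ m - 1"
proof -
  let ?E = "{1..m} \<rightarrow>\<^sub>E {0, 1, 2::nat}" and ?z = "\<lambda>i\<in>{1..m}. 0 :: nat"
  have z: "?z \<in> ?E" by auto
  have "S = ?z" if "S \<in> ?E" "\<forall>i\<in>{1..m}. S i = 0" for S
    by (rule PiE_ext[OF that(1) z]) (use that(2) in auto)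
  then have "{S \<in> ?E. \<exists>i\<in>{1..m}. S i \<noteq> 0} = ?E - {?z}" by auto
  moreover note z
  moreover have "card ?E = 3 ^ m" by (simp add: card_PiE numeral_3_eq_3)
  ultimately show ?thesis by simp
qed

text \<open>A symbol can be read off from the position of the supremum relative to \<open>r\<close>
  and \<rho>, so different strings force different solutions.\<close>

lemma follows_string_separates:
  assumes S: "follows_string m I r \<rho> R S u" "follows_string m I r \<rho> R S' u" and "r < \<rho>"
    and vals: "S \<in> {1..m} \<rightarrow>\<^sub>E {0, 1, 2}" "S' \<in> {1..m} \<rightarrow>\<^sub>E {0, 1, 2}"
  shows "S = S'"
proof (rule PiE_ext[OF vals])
  fix i assume i: "i \<in> {1..m}"
  have "S i \<in> {0, 1, 2}" "S' i \<in> {0, 1, 2}" using vals i by (auto simp: PiE_iff)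
  moreover define s where "s = (SUP t\<in>I i. u t)"
  have "(S i = 0 \<longrightarrow> s < r) \<and> (S i = 1 \<longrightarrow> r < s \<and> s < \<rho>) \<and> (S i = 2 \<longrightarrow> \<rho> < s)"
    "(S' i = 0 \<longrightarrow> s < r) \<and> (S' i = 1 \<longrightarrow> r < s \<and> s < \<rho>) \<and> (S' i = 2 \<longrightarrow> \<rho> < s)"
    using S i unfolding follows_string_def s_def by blast+
  ultimately show "S i = S' i" using \<open>r < \<rho>\<close> by auto
qed

theorem theorem1p1:
  fixes g a :: "real \<Rightarrow> real" and T :: real and m :: nat and \<sigma> \<tau> :: "nat \<Rightarrow> real"
  assumes g_nonneg: "\<forall>s\<ge>0. g s \<ge> 0"
    and g_cont: "continuous_on {0..} g"
    and g_zero: "g 0 = 0"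
    and g_pos: "\<forall>s>0. g s > 0"
    and g_lim_0: "((\<lambda>s. g s / s) \<longlongrightarrow> 0) (at_right 0)"
    and g_lim_inf: "((\<lambda>s. g s / s) \<longlongrightarrow> 0) at_top"
    and T_pos: "T > 0"
    and a_periodic: "\<forall>t. a (t + T) = a t"
    and a_integrable: "locally_integrable a"
    and m_ge: "m \<ge> 1"
    and points: "\<forall>i\<in>{1..m}. \<sigma> i < \<tau> i \<and> \<tau> i < \<sigma> (i + 1)"
    and period: "\<sigma> (m + 1) - \<sigma> 1 = T"
    and a_pos: "\<forall>i\<in>{1..m}. ae_pos_on a {\<sigma> i..\<tau> i}"
    and a_neg: "\<forall>i\<in>{1..m}. ae_pos_on (\<lambda>t. - a t) {\<tau> i..\<sigma> (i + 1)}"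
  shows "(\<exists>l0>0. \<forall>l>l0. \<exists>\<mu>0>0. \<forall>\<mu>>\<mu>0.
            \<exists>U. finite U \<and> card U \<ge> 3 ^ m - 1 \<and>
                (\<forall>u\<in>U. positive_periodic_solution T (weight a l \<mu>) g u)) \<and>
         (\<forall>\<rho>>0. \<exists>l0>0. \<forall>l>l0. \<exists>r R. 0 < r \<and> r < \<rho> \<and> \<rho> < R \<and>
            (\<exists>\<mu>0>0. \<forall>\<mu>>\<mu>0. \<forall>S :: nat \<Rightarrow> nat.
               (\<forall>i\<in>{1..m}. S i \<in> {0, 1, 2}) \<and> (\<exists>i\<in>{1..m}. S i \<noteq> 0) \<longrightarrow>
               (\<exists>u. positive_periodic_solution T (weight a l \<mu>) g u \<and>
                    follows_string m (\<lambda>i. {\<sigma> i..\<tau> i}) r \<rho> R S u)))"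
proof -
  let ?ap = "positive_part a" and ?an = "negative_part a"
  \<comment> \<open>The statement numbers lobes from 1, the locale from 0; in particular
    \<open>\<sigma>' m\<close> is \<open>\<sigma> (m + 1)\<close>.\<close>
  define \<sigma>' \<tau>' where "\<sigma>' j = \<sigma> (Suc j)" and "\<tau>' j = \<tau> (Suc j)" for j
  have ap_eq: "?ap = (\<lambda>x. max (a x) 0)" and an_eq: "?an = (\<lambda>x. max (- a x) 0)"
    by (auto simp: positive_part_def negative_part_def)
  have ap_zero: "?ap x = 0" if "a x \<le> 0" for x using that by (simp add: ap_eq)
  have an_zero: "?an x = 0" if "0 \<le> a x" for x using that by (simp add: an_eq)
  have a_int: "a absolutely_integrable_on {x..y}" for x y
    using a_integrable by (simp add: locally_integrable_def)
  have neg_a_int: "(\<lambda>x. - a x) absolutely_integrable_on {x..y}" for x y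
    using set_integrable_mult_right[of "-1" lebesgue "{x..y}" a] a_int by simp
  have zero_int: "(\<lambda>_. 0 :: real) absolutely_integrable_on {x..y}" for x y :: real
    by (simp add: set_integrable_def)
  have ap_int: "?ap absolutely_integrable_on {x..y}" and an_int: "?an absolutely_integrable_on {x..y}" for x y
    unfolding ap_eq an_eq by (intro absolutely_integrable_max_1 a_int neg_a_int zero_int)+
  have ap_int': "?ap integrable_on {x..y}" for x y using ap_int by (simp add: absolutely_integrable_on_def)
  have per: "?ap (x + T) = ?ap x" "?an (x + T) = ?an x" for x
    using a_periodic by (simp_all add: ap_eq an_eq)
  have ord: "\<sigma>' j < \<tau>' j" "\<tau>' j < \<sigma>' (Suc j)" if "j < m" for j
    using points that by (auto simp: \<sigma>'_def \<tau>'_def)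
  have period': "\<sigma>' m = \<sigma>' 0 + T" using period by (simp add: \<sigma>'_def)
  have lobe_pos: "0 < integral {\<sigma>' j..\<tau>' j} ?ap" if "j < m" for j
    unfolding ap_eq using a_pos that by (intro integral_pos_of_ae_pos a_int) (auto simp: \<sigma>'_def \<tau>'_def)
  have gap_pos: "0 < integral {\<tau>' j..\<sigma>' (Suc j)} ?an" if "j < m" for j
    unfolding an_eq using a_neg that by (intro integral_pos_of_ae_pos neg_a_int) (auto simp: \<sigma>'_def \<tau>'_def)
  have "\<exists>x. \<sigma>' j < x \<and> x < \<tau>' j \<and> 0 < integral {\<sigma>' j..x} ?ap \<and> 0 < integral {x..\<tau>' j} ?ap" if "j < m" for j
    using integral_pos_split[OF ap_int' ord(1) lobe_pos, OF that that] by blast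
  then obtain t0 where t0: "\<And>j. j < m \<Longrightarrow>
      \<sigma>' j < t0 j \<and> t0 j < \<tau>' j \<and> 0 < integral {\<sigma>' j..t0 j} ?ap \<and> 0 < integral {t0 j..\<tau>' j} ?ap"
    by metis
  \<comment> \<open>The last node is the translate of the first and lies beyond
    \<open>\<sigma>' m\<close>, so the period considered is \<open>[t 0, t 0 + T]\<close> instead of
    \<open>[\<sigma> 1, \<sigma> (m + 1)]\<close>.\<close>
  define t where "t j = (if j = m then t0 0 + T else t0 j)" for j
  have t_eq: "t j = t0 j" if "j < m" for j using that by (simp add: t_def)
  have m_pos: "0 < m" using m_ge by simp
  have t_end: "t m = t 0 + T" using m_pos by (simp add: t_def)
  have left: "\<sigma>' (Suc j) < t (Suc j) \<and> 0 < integral {\<sigma>' (Suc j)..t (Suc j)} ?ap" if j: "j < m" for j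
  proof (cases "Suc j = m")
    case True
    have "?ap \<circ> (+) T = ?ap" using per(1) by (auto simp: add.commute)
    then have "integral {\<sigma>' 0..t0 0} ?ap = integral {\<sigma>' 0 + T..t0 0 + T} ?ap"
      using integral_shift_Icc_real[of "\<sigma>' 0" "t0 0" ?ap T] by simp
    then show ?thesis using t0[OF m_pos] True period' by (simp add: t_def)
  next
    case False
    then show ?thesis using t0[of "Suc j"] t_eq[of "Suc j"] j by simp
  qed
  interpret partitioned_weight g ?ap ?an T m \<sigma>' \<tau>' t
  proof
    show "t j < \<tau>' j \<and> \<tau>' j < \<sigma>' (Suc j) \<and> \<sigma>' (Suc j) < t (Suc j)" if "j < m" for j
      using that t0[OF that] ord[OF that] left[OF that] t_eq[OF that] by simp
    show "0 < integral {t j..\<tau>' j} ?ap" if "j < m" for j using t0[OF that] t_eq[OF that] by simp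
    show "0 < integral {\<sigma>' (Suc j)..t (Suc j)} ?ap" if "j < m" for j using left[OF that] by simp
    show "0 < integral {\<tau>' j..\<sigma>' (Suc j)} ?an" if "j < m" for j by (rule gap_pos[OF that])
  qed (use g_nonneg g_cont g_zero g_pos g_lim_0 g_lim_inf ap_int an_int m_pos t_end in
      \<open>auto simp: ap_eq an_eq\<close>)
  have q_AE: "AE x in lebesgue. x \<in> {t 0..t m} \<longrightarrow> q l \<mu> x = l * ?ap x - \<mu> * ?an x" for l \<mu>
  proof -
    have lobe: "AE x in lebesgue. x \<in> {\<sigma>' j..\<tau>' j} \<longrightarrow> 0 \<le> a x" if "j < m" for j
      using a_pos that by (auto simp: ae_pos_on_def \<sigma>'_def \<tau>'_def)
    have "AE x in lebesgue. \<forall>j\<in>{..<m}. x \<in> {\<sigma>' j..\<tau>' j} \<longrightarrow> 0 \<le> a x"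
      by (rule AE_finite_allI) (use lobe in auto)
    \<comment> \<open>The interval from \<open>\<sigma>' m\<close> to \<open>t m\<close> lies
      outside the lobes and gaps of the statement; the sign of \<open>a\<close> there comes from
      lobe 0 by periodicity.\<close>
    moreover have "AE x in lebesgue. x - T \<in> {\<sigma>' 0..\<tau>' 0} \<longrightarrow> 0 \<le> a (x - T)"
      by (rule AE_lebesgue_translate[OF lobe[OF m_pos]])
    moreover have "AE x in lebesgue. \<forall>j\<in>{..<m}. x \<in> {\<tau>' j..\<sigma>' (Suc j)} \<longrightarrow> a x \<le> 0"
      by (rule AE_finite_allI) (use a_neg in \<open>auto simp: ae_pos_on_def \<sigma>'_def \<tau>'_def\<close>)
    ultimately show ?thesis
    proof eventually_elim
      case (elim x)
      show ?case
      proof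
        assume "x \<in> {t 0..t m}"
        then obtain j where j: "j < m" "x \<in> {t j..t (Suc j)}" by (rule in_piece)
        consider "x \<in> {t j..\<tau>' j}" | "x \<in> {\<tau>' j<..<\<sigma>' (Suc j)}" | "x \<in> {\<sigma>' (Suc j)..t (Suc j)}"
          using j(2) by fastforce
        then show "q l \<mu> x = l * ?ap x - \<mu> * ?an x"
        proof cases
          case 1
          then have "x \<in> {\<sigma>' j..\<tau>' j}" using t0[OF j(1)] t_eq[OF j(1)] by auto
          then have "0 \<le> a x" using elim(1) j(1) by blast
          then show ?thesis using node_right(1)[OF j(1) 1] by (simp add: q_def an_zero)
        next
          case 2
          then have "x \<in> {\<tau>' j..\<sigma>' (Suc j)}" by auto
          then have "a x \<le> 0" using elim(3) j(1) by blast
          then show ?thesis using in_gapI[OF j(1) 2] by (simp add: q_def ap_zero)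
        next
          case 3
          have "0 \<le> a x"
          proof (cases "Suc j = m")
            case True
            have "x - T \<in> {\<sigma>' 0..\<tau>' 0}" using 3 True period' t_end t0[OF m_pos] t_eq[OF m_pos] by auto
            then have "0 \<le> a (x - T)" using elim(2) by blast
            then show ?thesis using a_periodic[rule_format, of "x - T"] by simp
          next
            case False
            then have "Suc j < m" using j(1) by simp
            then have "x \<in> {\<sigma>' (Suc j)..\<tau>' (Suc j)}"
              using 3 t0[of "Suc j"] t_eq[of "Suc j"] by auto
            then show ?thesis using elim(1) \<open>Suc j < m\<close> by blast
          qed
          then show ?thesis using node_left(1)[OF j(1) 3] by (simp add: q_def an_zero)
        qed
      qed
    qed
  qed
  have weight_eq: "weight a l \<mu> = (\<lambda>x. l * ?ap x - \<mu> * ?an x)" for l \<mu>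
    by (auto simp: weight_def)
  have main: "\<exists>l0>0. \<forall>l>l0. \<exists>r R. 0 < r \<and> r < \<rho> \<and> \<rho> < R \<and>
      (\<exists>\<mu>0>0. \<forall>\<mu>>\<mu>0. \<forall>S :: nat \<Rightarrow> nat.
        (\<forall>i\<in>{1..m}. S i \<in> {0, 1, 2}) \<and> (\<exists>i\<in>{1..m}. S i \<noteq> 0) \<longrightarrow>
        (\<exists>u. positive_periodic_solution T (weight a l \<mu>) g u \<and>
          follows_string m (\<lambda>i. {\<sigma> i..\<tau> i}) r \<rho> R S u))" if \<rho>: "0 < \<rho>" for \<rho>
  proof -
    have "\<exists>U. positive_periodic_solution T (weight a l \<mu>) g U \<and>
        follows_string m (\<lambda>i. {\<sigma> i..\<tau> i}) r \<rho> R S U"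
      if r: "0 < r" "r < \<rho>" "\<rho> < R" and S: "\<forall>i\<in>{1..m}. S i \<in> {0, 1, 2}" "\<exists>i\<in>{1..m}. S i \<noteq> 0"
        and orbit: "periodic_orbit l \<mu> u v h" and tr: "tracks r \<rho> R (\<lambda>j. S (Suc j)) u"
      for l \<mu> r R u v h and S :: "nat \<Rightarrow> nat"
    proof -
      have str: "(S (Suc j) = 0 \<longrightarrow> (\<forall>x\<in>half_lobes j. u x \<le> r / 2)) \<and>
          (S (Suc j) = 1 \<longrightarrow> r < u (t j) \<and> (\<forall>x\<in>half_lobes j. u x \<le> \<rho> / 2)) \<and>
          (S (Suc j) = 2 \<longrightarrow> \<rho> < u (t j) \<and> (\<forall>x\<in>half_lobes j. u x \<le> R - 1))" if "j < m" for j
        using tr that unfolding tracks_def by blast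
      \<comment> \<open>A nonzero symbol bounds a nodal value below by \<open>r\<close> or \<rho>,
        which supplies the positive value that \<open>orbit_extends\<close> asks for.\<close>
      obtain i0 where i0: "i0 \<in> {1..m}" "S i0 \<noteq> 0" using S(2) by blast
      then obtain j0 where j0: "i0 = Suc j0" "j0 < m" by (cases i0) auto
      have "S i0 \<in> {0, 1, 2}" using S(1) i0(1) by blast
      then have "S (Suc j0) = 1 \<or> S (Suc j0) = 2" using i0(2) j0(1) by auto
      then have "0 < u (t j0)" using str[OF j0(2)] r by auto
      then obtain U where sol: "positive_periodic_solution T (weight a l \<mu>) g U"
        and U: "\<And>x. x \<in> {t 0..t m} \<Longrightarrow> U x = u x"
        using orbit_extends[OF orbit t_in[of j0] _ per q_AE] j0(2) unfolding weight_eq by auto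
      have U_per: "U (x + T) = U x" for x using sol by (simp add: positive_periodic_solution_def)
      \<comment> \<open>Points of lobe 0 to the left of its node are outside
        \<open>[t 0, t m]\<close>; there \<open>U\<close> is compared with \<open>u\<close> one
        period later.\<close>
      have half: "\<exists>y\<in>half_lobes j. U x = u y" if j: "j < m" and x: "x \<in> {\<sigma>' j..\<tau>' j}" for j x
      proof (cases "t j \<le> x")
        case True
        then have "x \<in> half_lobes j" using x by (simp add: half_lobes_def)
        then show ?thesis using U half_lobes_subset[OF j] by blast
      next
        case False
        show ?thesis
        proof (cases j)
          case 0
          have "x + T \<in> {\<sigma>' (Suc (m - 1))..t (Suc (m - 1))}"
            using x False 0 m_pos period' t_end by simp
          then have "x + T \<in> half_lobes j"
            unfolding half_lobes_def using m_pos 0 by (intro UnI2 UN_I[of "m - 1"]) auto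
          then have "U (x + T) = u (x + T)" using U half_lobes_subset[OF j] by blast
          then show ?thesis using \<open>x + T \<in> half_lobes j\<close> U_per[of x] by metis
        next
          case (Suc i)
          then have "x \<in> half_lobes j"
            unfolding half_lobes_def using x False j by (intro UnI2 UN_I[of i]) auto
          then show ?thesis using U half_lobes_subset[OF j] by blast
        qed
      qed
      have "follows_string m (\<lambda>i. {\<sigma> i..\<tau> i}) r \<rho> R S U"
        unfolding follows_string_def
      proof
        fix i assume "i \<in> {1..m}"
        then obtain j where ij: "i = Suc j" and j: "j < m" by (cases i) auto
        let ?I = "{\<sigma>' j..\<tau>' j}"
        have tj: "t j \<in> ?I" and Utj: "U (t j) = u (t j)"
          using t0[OF j] t_eq[OF j] U[OF t_in, of j] j by auto
        have upper: "(SUP x\<in>?I. U x) \<le> B" if "\<forall>x\<in>half_lobes j. u x \<le> B" for B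
          using tj half[OF j] that by (intro cSUP_least) force+
        have lower: "u (t j) \<le> (SUP x\<in>?I. U x)" if "\<forall>x\<in>half_lobes j. u x \<le> B" for B
          unfolding Utj[symmetric] using half[OF j] that
          by (intro cSUP_upper tj bdd_aboveI2[of _ _ B]) force
        have "(S i = 0 \<longrightarrow> (SUP x\<in>?I. U x) < r) \<and>
            (S i = 1 \<longrightarrow> r < (SUP x\<in>?I. U x) \<and> (SUP x\<in>?I. U x) < \<rho>) \<and>
            (S i = 2 \<longrightarrow> \<rho> < (SUP x\<in>?I. U x) \<and> (SUP x\<in>?I. U x) < R)"
        proof (intro conjI impI)
          assume "S i = 0"
          then show "(SUP x\<in>?I. U x) < r" using upper[of "r / 2"] str[OF j] ij r by auto
        next
          assume "S i = 1"
          then have "r < u (t j)" "\<forall>x\<in>half_lobes j. u x \<le> \<rho> / 2" using str[OF j] ij by auto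
          then show "r < (SUP x\<in>?I. U x)" "(SUP x\<in>?I. U x) < \<rho>"
            using upper[of "\<rho> / 2"] lower[of "\<rho> / 2"] \<rho> by auto
        next
          assume "S i = 2"
          then have "\<rho> < u (t j)" "\<forall>x\<in>half_lobes j. u x \<le> R - 1" using str[OF j] ij by auto
          then show "\<rho> < (SUP x\<in>?I. U x)" "(SUP x\<in>?I. U x) < R"
            using upper[of "R - 1"] lower[of "R - 1"] by auto
        qed
        then show "(S i = 0 \<longrightarrow> (SUP x\<in>{\<sigma> i..\<tau> i}. U x) < r) \<and>
            (S i = 1 \<longrightarrow> r < (SUP x\<in>{\<sigma> i..\<tau> i}. U x) \<and> (SUP x\<in>{\<sigma> i..\<tau> i}. U x) < \<rho>) \<and>
            (S i = 2 \<longrightarrow> \<rho> < (SUP x\<in>{\<sigma> i..\<tau> i}. U x) \<and> (SUP x\<in>{\<sigma> i..\<tau> i}. U x) < R)"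
          by (simp add: ij \<sigma>'_def \<tau>'_def)
      qed
      with sol show ?thesis by blast
    qed
    note follow = this
    obtain l0 where l0: "0 < l0" and orbits: "\<And>l. l0 < l \<Longrightarrow>
      \<exists>r R. 0 < r \<and> r < \<rho> \<and> \<rho> < R \<and> (\<exists>\<mu>0>0. \<forall>\<mu>>\<mu>0. \<forall>S :: nat \<Rightarrow> nat.
      (\<forall>j<m. S j \<in> {0, 1, 2}) \<longrightarrow> (\<exists>u v h. periodic_orbit l \<mu> u v h \<and> tracks r \<rho> R S u))"
      using orbits_follow_strings[OF \<rho>] by blast
    show ?thesis
    proof (rule exI[of _ l0], intro conjI allI impI)
      fix l assume "l0 < l"
      then obtain r R \<mu>0 where r: "0 < r" "r < \<rho>" "\<rho> < R" and "0 < \<mu>0" and orb: "\<And>\<mu> (S :: nat \<Rightarrow> nat).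
        \<lbrakk>\<mu>0 < \<mu>; \<forall>j<m. S j \<in> {0, 1, 2}\<rbrakk> \<Longrightarrow> \<exists>u v h. periodic_orbit l \<mu> u v h \<and> tracks r \<rho> R S u"
        using orbits by metis
      have "\<exists>u. positive_periodic_solution T (weight a l \<mu>) g u \<and>
          follows_string m (\<lambda>i. {\<sigma> i..\<tau> i}) r \<rho> R S u"
        if \<mu>: "\<mu>0 < \<mu>" and S: "\<forall>i\<in>{1..m}. S i \<in> {0, 1, 2}" "\<exists>i\<in>{1..m}. S i \<noteq> 0" for \<mu> and S :: "nat \<Rightarrow> nat"
      proof -
        have "\<forall>j<m. S (Suc j) \<in> {0, 1, 2}" using S(1) by simp
        from orb[OF \<mu> this] show ?thesis using follow[OF r S] by blast
      qed
      then show "\<exists>r R. 0 < r \<and> r < \<rho> \<and> \<rho> < R \<and>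
        (\<exists>\<mu>0>0. \<forall>\<mu>>\<mu>0. \<forall>S :: nat \<Rightarrow> nat.
          (\<forall>i\<in>{1..m}. S i \<in> {0, 1, 2}) \<and> (\<exists>i\<in>{1..m}. S i \<noteq> 0) \<longrightarrow>
          (\<exists>u. positive_periodic_solution T (weight a l \<mu>) g u \<and>
            follows_string m (\<lambda>i. {\<sigma> i..\<tau> i}) r \<rho> R S u))"
        using r \<open>0 < \<mu>0\<close> by blast
    qed (rule l0)
  qed
  have count: "\<exists>U. finite U \<and> card U \<ge> 3 ^ m - 1 \<and> (\<forall>u\<in>U. P u)"
    if "r < \<rho>" and ex: "\<And>S :: nat \<Rightarrow> nat. \<lbrakk>\<forall>i\<in>{1..m}. S i \<in> {0, 1, 2}; \<exists>i\<in>{1..m}. S i \<noteq> 0\<rbrakk> \<Longrightarrow>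
        \<exists>u. P u \<and> follows_string m (\<lambda>i. {\<sigma> i..\<tau> i}) r \<rho> R S u"
    for P :: "(real \<Rightarrow> real) \<Rightarrow> bool" and r \<rho> R
  proof -
    \<comment> \<open>Extensional functions, so that each string is counted once although symbols
      outside \<open>{1..m}\<close> do not affect \<open>follows_string\<close>.\<close>
    let ?E = "{S \<in> {1..m} \<rightarrow>\<^sub>E {0, 1, 2::nat}. \<exists>i\<in>{1..m}. S i \<noteq> 0}"
    have "\<forall>S\<in>?E. \<exists>u. P u \<and> follows_string m (\<lambda>i. {\<sigma> i..\<tau> i}) r \<rho> R S u"
    proof
      fix S assume "S \<in> ?E"
      then show "\<exists>u. P u \<and> follows_string m (\<lambda>i. {\<sigma> i..\<tau> i}) r \<rho> R S u"
        by (intro ex) (auto simp: PiE_iff)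
    qed
    then have "\<exists>F. \<forall>S\<in>?E. P (F S) \<and> follows_string m (\<lambda>i. {\<sigma> i..\<tau> i}) r \<rho> R S (F S)"
      by (rule bchoice)
    then obtain F where F: "\<And>S. S \<in> ?E \<Longrightarrow> P (F S) \<and> follows_string m (\<lambda>i. {\<sigma> i..\<tau> i}) r \<rho> R S (F S)"
      by blast
    have "inj_on F ?E"
    proof (rule inj_onI)
      fix S S' assume S: "S \<in> ?E" "S' \<in> ?E" "F S = F S'"
      show "S = S'"
      proof (rule follows_string_separates[OF _ _ \<open>r < \<rho>\<close>])
        show "follows_string m (\<lambda>i. {\<sigma> i..\<tau> i}) r \<rho> R S (F S)" using F[OF S(1)] by blast
        show "follows_string m (\<lambda>i. {\<sigma> i..\<tau> i}) r \<rho> R S' (F S)" using F[OF S(2)] S(3) by simp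
      qed (use S(1,2) in blast)+
    qed
    then have "card (F ` ?E) = 3 ^ m - 1" using card_strings by (simp add: card_image)
    moreover have "finite ?E" by (rule finite_subset[of _ "{1..m} \<rightarrow>\<^sub>E {0, 1, 2}"]) (auto intro: finite_PiE)
    ultimately show ?thesis using F by (intro exI[of _ "F ` ?E"]) auto
  qed
  \<comment> \<open>For the count any fixed level serves; \<rho> = 1 is taken.\<close>
  obtain l0 where l0: "0 < l0" and strings: "\<And>l. l0 < l \<Longrightarrow> \<exists>r R. 0 < r \<and> r < 1 \<and> 1 < R \<and>
      (\<exists>\<mu>0>0. \<forall>\<mu>>\<mu>0. \<forall>S :: nat \<Rightarrow> nat.
        (\<forall>i\<in>{1..m}. S i \<in> {0, 1, 2}) \<and> (\<exists>i\<in>{1..m}. S i \<noteq> 0) \<longrightarrow>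
        (\<exists>u. positive_periodic_solution T (weight a l \<mu>) g u \<and>
          follows_string m (\<lambda>i. {\<sigma> i..\<tau> i}) r 1 R S u))"
    using main[OF zero_less_one] by blast
  have "\<exists>\<mu>0>0. \<forall>\<mu>>\<mu>0. \<exists>U. finite U \<and> card U \<ge> 3 ^ m - 1 \<and>
      (\<forall>u\<in>U. positive_periodic_solution T (weight a l \<mu>) g u)" if l: "l0 < l" for l
  proof -
    from strings[OF l] obtain r R \<mu>0 where "r < 1" and "0 < \<mu>0" and \<mu>0: "\<forall>\<mu>>\<mu>0. \<forall>S :: nat \<Rightarrow> nat.
        (\<forall>i\<in>{1..m}. S i \<in> {0, 1, 2}) \<and> (\<exists>i\<in>{1..m}. S i \<noteq> 0) \<longrightarrow>
        (\<exists>u. positive_periodic_solution T (weight a l \<mu>) g u \<and>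
          follows_string m (\<lambda>i. {\<sigma> i..\<tau> i}) r 1 R S u)"
      by (elim exE conjE) (rule that)
    have ex: "\<exists>u. positive_periodic_solution T (weight a l \<mu>) g u \<and>
        follows_string m (\<lambda>i. {\<sigma> i..\<tau> i}) r 1 R S u"
      if "\<mu>0 < \<mu>" "\<forall>i\<in>{1..m}. S i \<in> {0, 1, 2}" "\<exists>i\<in>{1..m}. S i \<noteq> 0" for \<mu> and S :: "nat \<Rightarrow> nat"
      by (rule mp[OF spec[OF mp[OF spec[OF \<mu>0] that(1)]] conjI[OF that(2,3)]])
    have "\<exists>U. finite U \<and> card U \<ge> 3 ^ m - 1 \<and> (\<forall>u\<in>U. positive_periodic_solution T (weight a l \<mu>) g u)"
      if "\<mu>0 < \<mu>" for \<mu>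
      by (rule count[OF \<open>r < 1\<close> ex[OF that]])
    with \<open>0 < \<mu>0\<close> show ?thesis by blast
  qed
  then show ?thesis using l0 main by blast
qed

end
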